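(* Under the hypotheses of the asymptotic normality result for $\tau_T$ ((A1)–(A5), initialization $\|\theta_0-\theta_*\|_2,\|\gamma_0-\gamma_*\|_2\le b/\sqrt2$ with $b<b_0$, step sizes $0<\eta_1,\eta_2<\eta_0$ for suitable positive constants $b_0,\eta_0$, and $n\rho_1^T\to0$ for some constant $0<\rho_1<1$), as $n\to\infty$ and $T\to\infty$, $$\big\|S_\gamma^2(\theta_T,\gamma_T)-[\mathcal I_{\gamma\gamma}-\mathcal I_{\theta\gamma}^\top\mathcal I_{\theta\theta}^{-1}\mathcal I_{\theta\gamma}]^{-1}\big\|_2\xrightarrow{p}0,$$ where the Fisher blocks are evaluated at $(\theta_*,\gamma_* )$, and for each $i\in\{1,\dots,d_2\}$, $$\frac{\sqrt n\,e_i^\top(\gamma_T-\gamma_* )}{\sqrt{e_i^\top S_\gamma^2(\theta_T,\gamma_T)e_i}}\xrightarrow{D}\mathcal N(0,1),$$ where $e_i$ is the $i$-th standard unit vector.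
   Context: Let $d_1,d_2\ge1$ be fixed. Observations $(x_i,s_i,a_i^{(0)},a_i^{(1)},y_i)$, $i=1,\dots,n$, are i.i.d. copies of $(x,s,a^{(0)},a^{(1)},y)$, $y\in\{0,1\}$. Known feature maps $\phi$ ($\mathbb{R}^{d_1}$-valued), $\psi_0$ (real), $\psi$ ($\mathbb{R}^{d_2}$-valued). $\sigma_\gamma(x)=\psi_0(x)+\gamma^\top\psi(x)$, $z=\phi(s,a^{(1)})-\phi(s,a^{(0)})$, $z_i$ analogously, $\mu(v)=1/(1+e^{-v})$. Model: $\mathbb{P}(y=1\mid x,s,a^{(0)},a^{(1)})=\mu(\sigma_{\gamma_*}(x)\theta_*^\top z)$. $L_n(\theta,\gamma)=-\frac1n\sum_{i}\{y_i\log\mu(\sigma_\gamma(x_i)\theta^\top z_i)+(1-y_i)\log[1-\mu(\sigma_\gamma(x_i)\theta^\top z_i)]\}$. Alternating gradient descent: $\theta_t=\theta_{t-1}-\eta_1\nabla_\theta L_n(\theta_{t-1},\gamma_{t-1})$, $\gamma_t=\gamma_{t-1}-\eta_2\nabla_\gamma L_n(\theta_t,\gamma_{t-1})$, $t=1,\dots,T$. (A1): $\|\phi\|_2\le\phi_{\max}$; $\|\theta_*\|_\infty\le\theta_{\max}$. (A2): $\psi_0\not\equiv0$; $\sup_x\|(\psi_0(x),\psi(x)^\top)\|_2\le\psi_{\max}$; $\|(1,\gamma_*^\top)\|_\infty\le\gamma_{\max}$. (A3): $\lambda_{\min}(\mathbb{E}[\sigma_{\gamma_*}^2(x)zz^\top])=\lambda_\phi>0$,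 $\lambda_{\min}(\mathbb{E}[(\theta_*^\top z)^2\psi(x)\psi(x)^\top])=\lambda_\psi>0$. (A4): with $u=\sigma_{\gamma_*}(x)\theta_*^\top z$, $M=\|\mathbb{E}\{\mu(u)[1-\mu(u)]\sigma_{\gamma_*}(x)(\theta_*^\top z)\psi(x)z^\top\}\|_2<\min\{\lambda_\phi,\lambda_\psi\}/(6c_0)$, where $c_0=(1+e^{C_{\max}})^2/e^{C_{\max}}$, $C_{\max}=(\sqrt2\gamma_{\max}+\tilde b)(\sqrt2\theta_{\max}+\tilde b)\sqrt{d_1d_2}\phi_{\max}\psi_{\max}$, $\tilde b=\frac{\min\{\lambda_\phi/(\sqrt{d_2}\gamma_{\max}),\lambda_\psi/(\sqrt{d_1}\theta_{\max})\}}{8\sqrt2\phi_{\max}^2\psi_{\max}^2}$. Fisher blocks $\mathcal I_{\theta\theta},\mathcal I_{\theta\gamma},\mathcal I_{\gamma\theta},\mathcal I_{\gamma\gamma}$ are expectations of the corresponding Hessian blocks of $L_n$ at $(\theta_*,\gamma_* )$; (A5): $\mathcal I_{\theta\theta}-\mathcal I_{\theta\gamma}\mathcal I_{\gamma\gamma}^{-1}\mathcal I_{\gamma\theta}$ is positive definite. Empirical matrices, with $m_i=\mu(\sigma_\gamma(x_i)\theta^\top z_i)[1-\mu(\sigma_\gamma(x_i)\theta^\top z_i)]$: $\hat{\mathcal I}_{\theta\theta}(\theta,\gamma)=\frac1n\sum_i m_i\sigma_\gamma^2(x_i)z_iz_i^\top$, $\hat{\mathcal I}_{\gamma\gamma}(\theta,\gamma)=\frac1n\sum_i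 m_i(\theta^\top z_i)^2\psi(x_i)\psi(x_i)^\top$, $\hat{\mathcal I}_{\gamma\theta}(\theta,\gamma)=\frac1n\sum_i m_i\sigma_\gamma(x_i)(\theta^\top z_i)\psi(x_i)z_i^\top$, $\hat{\mathcal I}_{\theta\gamma}=\hat{\mathcal I}_{\gamma\theta}^\top$. Define $S_\gamma^2(\theta,\gamma)=[\hat{\mathcal I}_{\gamma\gamma}(\theta,\gamma)-\hat{\mathcal I}_{\theta\gamma}^\top(\theta,\gamma)\hat{\mathcal I}_{\theta\theta}^{-1}(\theta,\gamma)\hat{\mathcal I}_{\theta\gamma}(\theta,\gamma)]^{-1}$. *)

theory Defs
  imports "HOL-Analysis.Analysis" "HOL-Probability.Probability"
begin

type_synonym ('x,'s,'a) obs = "'x \<times> 's \<times> 'a \<times> 'a \<times> bool"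

definition ob_x :: "('x,'s,'a) obs \<Rightarrow> 'x" where "ob_x ob = fst ob"
definition ob_s :: "('x,'s,'a) obs \<Rightarrow> 's" where "ob_s ob = fst (snd ob)"
definition ob_a0 :: "('x,'s,'a) obs \<Rightarrow> 'a" where "ob_a0 ob = fst (snd (snd ob))"
definition ob_a1 :: "('x,'s,'a) obs \<Rightarrow> 'a" where "ob_a1 ob = fst (snd (snd (snd ob)))"
definition ob_y :: "('x,'s,'a) obs \<Rightarrow> bool" where "ob_y ob = snd (snd (snd (snd ob)))"

definition logistic :: "real \<Rightarrow> real" where "logistic v = 1 / (1 + exp (- v))"

definition sig :: "('x \<Rightarrow> real) \<Rightarrow> ('x \<Rightarrow> real^'d2) \<Rightarrow> real^'d2 \<Rightarrow> 'x \<Rightarrow> real" where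
  "sig psi0 psi \<gamma> x = psi0 x + \<gamma> \<bullet> psi x"

definition zv :: "('s \<Rightarrow> 'a \<Rightarrow> real^'d1) \<Rightarrow> ('x,'s,'a) obs \<Rightarrow> real^'d1" where
  "zv phi ob = phi (ob_s ob) (ob_a1 ob) - phi (ob_s ob) (ob_a0 ob)"

definition uidx :: "('x \<Rightarrow> real) \<Rightarrow> ('x \<Rightarrow> real^'d2) \<Rightarrow> ('s \<Rightarrow> 'a \<Rightarrow> real^'d1)
    \<Rightarrow> real^'d1 \<Rightarrow> real^'d2 \<Rightarrow> ('x,'s,'a) obs \<Rightarrow> real" where
  "uidx psi0 psi phi \<theta> \<gamma> ob = sig psi0 psi \<gamma> (ob_x ob) * (\<theta> \<bullet> zv phi ob)"

definition loss :: "('x \<Rightarrow> real) \<Rightarrow> ('x \<Rightarrow> real^'d2) \<Rightarrow> ('s \<Rightarrow> 'a \<Rightarrow> real^'d1)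
    \<Rightarrow> nat \<Rightarrow> (nat \<Rightarrow> ('x,'s,'a) obs) \<Rightarrow> real^'d1 \<Rightarrow> real^'d2 \<Rightarrow> real" where
  "loss psi0 psi phi n dat \<theta> \<gamma> =
     - (1 / real n) * (\<Sum>i<n.
         of_bool (ob_y (dat i)) * ln (logistic (uidx psi0 psi phi \<theta> \<gamma> (dat i)))
       + (1 - of_bool (ob_y (dat i))) * ln (1 - logistic (uidx psi0 psi phi \<theta> \<gamma> (dat i))))"

definition grad :: "('v::real_inner \<Rightarrow> real) \<Rightarrow> 'v \<Rightarrow> 'v" where
  "grad f v = (THE D. GDERIV f v :> D)"

fun agd :: "(real^'d1 \<Rightarrow> real^'d2 \<Rightarrow> real) \<Rightarrow> real \<Rightarrow> real \<Rightarrow> real^'d1 \<Rightarrow> real^'d2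
    \<Rightarrow> nat \<Rightarrow> (real^'d1) \<times> (real^'d2)" where
  "agd L \<eta>1 \<eta>2 \<theta>0 \<gamma>0 0 = (\<theta>0, \<gamma>0)"
| "agd L \<eta>1 \<eta>2 \<theta>0 \<gamma>0 (Suc t) =
     (let \<theta> = fst (agd L \<eta>1 \<eta>2 \<theta>0 \<gamma>0 t); \<gamma> = snd (agd L \<eta>1 \<eta>2 \<theta>0 \<gamma>0 t);
          \<theta>' = \<theta> - \<eta>1 *\<^sub>R grad (\<lambda>th. L th \<gamma>) \<theta>;
          \<gamma>' = \<gamma> - \<eta>2 *\<^sub>R grad (\<lambda>g. L \<theta>' g) \<gamma>
      in (\<theta>', \<gamma>'))"

definition outer :: "real^'m \<Rightarrow> real^'n \<Rightarrow> real^'n^'m" where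
  "outer u v = (\<chi> i j. u $ i * v $ j)"

definition spec_norm :: "real^'n^'m \<Rightarrow> real" where
  "spec_norm A = onorm (\<lambda>x. A *v x)"

definition lambda_min :: "real^'n^'n \<Rightarrow> real" where
  "lambda_min A = Inf {l. \<exists>v. v \<noteq> 0 \<and> A *v v = l *\<^sub>R v}"

definition pos_def :: "real^'n^'n \<Rightarrow> bool" where
  "pos_def A \<longleftrightarrow> transpose A = A \<and> (\<forall>v. v \<noteq> 0 \<longrightarrow> v \<bullet> (A *v v) > 0)"

definition mw :: "('x \<Rightarrow> real) \<Rightarrow> ('x \<Rightarrow> real^'d2) \<Rightarrow> ('s \<Rightarrow> 'a \<Rightarrow> real^'d1)
    \<Rightarrow> real^'d1 \<Rightarrow> real^'d2 \<Rightarrow> ('x,'s,'a) obs \<Rightarrow> real" where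
  "mw psi0 psi phi \<theta> \<gamma> ob = logistic (uidx psi0 psi phi \<theta> \<gamma> ob) * (1 - logistic (uidx psi0 psi phi \<theta> \<gamma> ob))"

definition htt :: "('x \<Rightarrow> real) \<Rightarrow> ('x \<Rightarrow> real^'d2) \<Rightarrow> ('s \<Rightarrow> 'a \<Rightarrow> real^'d1)
    \<Rightarrow> real^'d1 \<Rightarrow> real^'d2 \<Rightarrow> ('x,'s,'a) obs \<Rightarrow> real^'d1^'d1" where
  "htt psi0 psi phi \<theta> \<gamma> ob = (mw psi0 psi phi \<theta> \<gamma> ob * (sig psi0 psi \<gamma> (ob_x ob))\<^sup>2) *\<^sub>R outer (zv phi ob) (zv phi ob)"

definition hgg :: "('x \<Rightarrow> real) \<Rightarrow> ('x \<Rightarrow> real^'d2) \<Rightarrow> ('s \<Rightarrow> 'a \<Rightarrow> real^'d1)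
    \<Rightarrow> real^'d1 \<Rightarrow> real^'d2 \<Rightarrow> ('x,'s,'a) obs \<Rightarrow> real^'d2^'d2" where
  "hgg psi0 psi phi \<theta> \<gamma> ob = (mw psi0 psi phi \<theta> \<gamma> ob * (\<theta> \<bullet> zv phi ob)\<^sup>2) *\<^sub>R outer (psi (ob_x ob)) (psi (ob_x ob))"

definition hgt :: "('x \<Rightarrow> real) \<Rightarrow> ('x \<Rightarrow> real^'d2) \<Rightarrow> ('s \<Rightarrow> 'a \<Rightarrow> real^'d1)
    \<Rightarrow> real^'d1 \<Rightarrow> real^'d2 \<Rightarrow> ('x,'s,'a) obs \<Rightarrow> real^'d1^'d2" where
  "hgt psi0 psi phi \<theta> \<gamma> ob = (mw psi0 psi phi \<theta> \<gamma> ob * sig psi0 psi \<gamma> (ob_x ob) * (\<theta> \<bullet> zv phi ob)) *\<^sub>R outer (psi (ob_x ob)) (zv phi ob)"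

text \<open>Exact per-observation Hessian block d^2 ell / (d gamma d theta^T); it differs from hgt by
  the score term (mu(u) - y) psi z^T.\<close>
definition hess_gt :: "('x \<Rightarrow> real) \<Rightarrow> ('x \<Rightarrow> real^'d2) \<Rightarrow> ('s \<Rightarrow> 'a \<Rightarrow> real^'d1)
    \<Rightarrow> real^'d1 \<Rightarrow> real^'d2 \<Rightarrow> ('x,'s,'a) obs \<Rightarrow> real^'d1^'d2" where
  "hess_gt psi0 psi phi \<theta> \<gamma> ob = hgt psi0 psi phi \<theta> \<gamma> ob
     + (logistic (uidx psi0 psi phi \<theta> \<gamma> ob) - of_bool (ob_y ob)) *\<^sub>R outer (psi (ob_x ob)) (zv phi ob)"

definition emp :: "nat \<Rightarrow> (nat \<Rightarrow> 'ob) \<Rightarrow> ('ob \<Rightarrow> 'm::real_vector) \<Rightarrow> 'm" where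
  "emp n dat h = (1 / real n) *\<^sub>R (\<Sum>i<n. h (dat i))"

definition S_gamma_sq :: "('x \<Rightarrow> real) \<Rightarrow> ('x \<Rightarrow> real^'d2) \<Rightarrow> ('s \<Rightarrow> 'a \<Rightarrow> real^'d1)
    \<Rightarrow> nat \<Rightarrow> (nat \<Rightarrow> ('x,'s,'a) obs) \<Rightarrow> real^'d1 \<Rightarrow> real^'d2 \<Rightarrow> real^'d2^'d2" where
  "S_gamma_sq psi0 psi phi n dat \<theta> \<gamma> =
     (let Itt = emp n dat (htt psi0 psi phi \<theta> \<gamma>);
          Igg = emp n dat (hgg psi0 psi phi \<theta> \<gamma>);
          Igt = emp n dat (hgt psi0 psi phi \<theta> \<gamma>);
          Itg = transpose Igt
      in matrix_inv (Igg - transpose Itg ** matrix_inv Itt ** Itg))"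

text \<open>Convergence in probability to a constant (robust to measurability: the bad event
  is contained in the complement of an event of probability at least 1 - delta).\<close>
definition conv_in_prob :: "'w measure \<Rightarrow> (nat \<Rightarrow> 'w \<Rightarrow> 'b::metric_space) \<Rightarrow> 'b \<Rightarrow> bool" where
  "conv_in_prob M Z c \<longleftrightarrow> (\<forall>\<epsilon>>0. \<forall>\<delta>>0. eventually (\<lambda>n. \<exists>A\<in>sets M.
       measure M A \<ge> 1 - \<delta> \<and> (\<forall>\<omega>\<in>A. dist (Z n \<omega>) c \<le> \<epsilon>)) sequentially)"

definition b_tilde :: "nat \<Rightarrow> nat \<Rightarrow> real \<Rightarrow> real \<Rightarrow> real \<Rightarrow> real \<Rightarrow> real \<Rightarrow> real \<Rightarrow> real" where
  "b_tilde d1 d2 lphi lpsi \<phi>max \<psi>max \<theta>max \<gamma>max =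
     min (lphi / (sqrt d2 * \<gamma>max)) (lpsi / (sqrt d1 * \<theta>max)) / (8 * sqrt 2 * \<phi>max\<^sup>2 * \<psi>max\<^sup>2)"

definition C_max :: "nat \<Rightarrow> nat \<Rightarrow> real \<Rightarrow> real \<Rightarrow> real \<Rightarrow> real \<Rightarrow> real \<Rightarrow> real \<Rightarrow> real" where
  "C_max d1 d2 lphi lpsi \<phi>max \<psi>max \<theta>max \<gamma>max =
     (let bt = b_tilde d1 d2 lphi lpsi \<phi>max \<psi>max \<theta>max \<gamma>max in
      (sqrt 2 * \<gamma>max + bt) * (sqrt 2 * \<theta>max + bt) * sqrt (real d1 * real d2) * \<phi>max * \<psi>max)"

definition c_zero :: "nat \<Rightarrow> nat \<Rightarrow> real \<Rightarrow> real \<Rightarrow> real \<Rightarrow> real \<Rightarrow> real \<Rightarrow> real \<Rightarrow> real" where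
  "c_zero d1 d2 lphi lpsi \<phi>max \<psi>max \<theta>max \<gamma>max =
     (let C = C_max d1 d2 lphi lpsi \<phi>max \<psi>max \<theta>max \<gamma>max in (1 + exp C)\<^sup>2 / exp C)"

definition Eobs :: "'w measure \<Rightarrow> ('w \<Rightarrow> 'o) \<Rightarrow> ('o \<Rightarrow> 'b::{banach,second_countable_topology}) \<Rightarrow> 'b" where
  "Eobs M X f = integral\<^sup>L M (\<lambda>\<omega>. f (X \<omega>))"

end

theory Submission
  imports Defs
begin

text \<open>
  Write \<open>w = (\<theta>, \<gamma>)\<close>. Assumption (A5) and the definiteness of the \<open>\<gamma>\<close>-block, which follows from (A3),
  make the Fisher information \<open>H\<close> at the truth positive definite. The per-observation Hessian is
  bounded and Lipschitz near the truth, so with high probability the empirical loss is strongly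
  convex and smooth on a fixed ball. There each half step of the alternating descent decreases the
  loss; hence the iterates stay in the ball and the squared gradient norm decays geometrically, and
  \<open>n \<rho>\<^sup>T \<rightarrow> 0\<close> makes it \<open>o(1/n)\<close>. A mean value expansion of the gradient along the solution \<open>h\<close> of
  \<open>H h = (0, e\<^sub>i)\<close> gives \<open>\<surd>n e\<^sub>i \<bullet> (\<gamma>\<^sub>T - \<gamma>\<^sub>*) = - \<surd>n \<nabla>L\<^sub>n(w\<^sub>*) \<bullet> h + o\<^sub>p(1)\<close>. The right-hand side is a normalised i.i.d.
  sum whose variance \<open>h \<bullet> H h\<close> is the \<open>i\<close>-th diagonal entry of the inverse Schur complement, which the
  plug-in estimator consistently estimates; Slutsky's theorem concludes.
\<close>

section \<open>Logistic loss\<close>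

text \<open>The index is a product of a factor affine in gamma and a factor linear in theta, so the
  loss is not convex in the joint parameter: its exact Hessian carries a score term of no definite
  sign. Under the model this term has mean zero at the truth, so the exact Hessian and the plug-in
  information share one population limit, the form \<open>Hh\<close>, and the covariance of the
  score equals it too. This single form therefore supplies the local curvature, the asymptotic
  variance and the target of the plug-in estimator. Sample-dependent points such as the iterates
  would ordinarily call for a uniform law of large numbers. Here the Hessian of each observation has
  the deterministic Lipschitz constant \<open>Hb\<close>, so a law at the truth alone is transported
  to nearby points at a cost proportional to their distance from it. No empirical minimiser is
  introduced: a small gradient at the iterate takes the place of a first-order condition. Randomness
  is thereby confined to a few events about averages at the truth, and the analysis of the descent
  on them is deterministic.\<close>

lemma logistic_pos: "0 < logistic v"
  by (simp add: logistic_def add_pos_pos)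

lemma logistic_less_1: "logistic v < 1"
  by (simp add: logistic_def add_pos_pos)

lemma DERIV_logistic: "(logistic has_real_derivative logistic v * (1 - logistic v)) (at v)"
proof -
  have "1 + exp (-v) > 0" by (simp add: add_pos_pos)
  then show ?thesis
    unfolding logistic_def[abs_def]
    by (auto intro!: derivative_eq_intros simp: field_simps power2_eq_square)
qed

lemmas DERIV_logistic_chain [derivative_intros] = DERIV_logistic[THEN DERIV_chain2]

definition logistic_deriv :: "real \<Rightarrow> real" where
  "logistic_deriv v = logistic v * (1 - logistic v)"

lemma logistic_deriv_pos: "0 < logistic_deriv v"
  by (simp add: logistic_deriv_def logistic_pos logistic_less_1)

lemma logistic_deriv_le_1: "logistic_deriv v \<le> 1"
  unfolding logistic_deriv_def
  using logistic_pos[of v] logistic_less_1[of v] mult_mono[of "logistic v" 1 "1 - logistic v" 1] by simp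

lemma logistic_lipschitz: "\<bar>logistic a - logistic b\<bar> \<le> \<bar>a - b\<bar>"
proof -
  have "norm (logistic a - logistic b) \<le> 1 * norm (a - b)"
  proof (rule field_differentiable_bound[where S = UNIV])
    show "(logistic has_field_derivative logistic_deriv v) (at v within UNIV)" for v
      using DERIV_logistic by (simp add: logistic_deriv_def)
    show "norm (logistic_deriv v) \<le> 1" for v
      using logistic_deriv_pos[of v] logistic_deriv_le_1[of v] by simp
  qed auto
  then show ?thesis by simp
qed

lemma logistic_deriv_lipschitz: "\<bar>logistic_deriv a - logistic_deriv b\<bar> \<le> \<bar>a - b\<bar>"
proof -
  have "norm (logistic_deriv a - logistic_deriv b) \<le> 1 * norm (a - b)"
  proof (rule field_differentiable_bound[where S = UNIV])
    show "(logistic_deriv has_field_derivative logistic_deriv v * (1 - 2 * logistic v)) (at v within UNIV)" for v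
      unfolding logistic_deriv_def[abs_def]
      by (auto intro!: derivative_eq_intros simp: algebra_simps)
    show "norm (logistic_deriv v * (1 - 2 * logistic v)) \<le> 1" for v
    proof -
      have "\<bar>1 - 2 * logistic v\<bar> \<le> 1"
        using logistic_pos[of v] logistic_less_1[of v] by (simp add: abs_le_iff)
      then have "\<bar>logistic_deriv v\<bar> * \<bar>1 - 2 * logistic v\<bar> \<le> 1 * 1"
        using logistic_deriv_pos[of v] logistic_deriv_le_1[of v] by (intro mult_mono) auto
      then show ?thesis by (simp add: abs_mult)
    qed
  qed auto
  then show ?thesis by simp
qed

text \<open>The logit is the canonical link of the Bernoulli likelihood: the factor
  \<open>logistic u * (1 - logistic u)\<close> cancels and the plain residual is left.\<close>

lemma DERIV_logit_loss:
  "((\<lambda>u. - (c * ln (logistic u) + (1 - c) * ln (1 - logistic u))) has_real_derivative logistic u - c) (at u)"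
proof -
  have a: "((\<lambda>u. ln (logistic u)) has_real_derivative 1 - logistic u) (at u)"
    using logistic_pos[of u] by (auto intro!: derivative_eq_intros)
  have b: "((\<lambda>u. ln (1 - logistic u)) has_real_derivative - logistic u) (at u)"
    using logistic_less_1[of u] by (auto intro!: derivative_eq_intros)
  show ?thesis
    by (rule DERIV_cong[OF DERIV_minus[OF DERIV_add[OF DERIV_cmult[OF a] DERIV_cmult[OF b]]]])
      (simp add: algebra_simps)
qed

lemma abs_mult_diff_le:
  fixes a b a' b' :: real
  assumes "\<bar>a - a'\<bar> \<le> p" "\<bar>b - b'\<bar> \<le> q" "\<bar>a\<bar> \<le> A" "\<bar>b'\<bar> \<le> B"
  shows "\<bar>a * b - a' * b'\<bar> \<le> A * q + p * B"
proof -
  have "a * b - a' * b' = a * (b - b') + (a - a') * b'"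
    by (simp add: algebra_simps)
  moreover have "\<bar>a * (b - b')\<bar> \<le> A * q" "\<bar>(a - a') * b'\<bar> \<le> p * B"
    using assms unfolding abs_mult by (auto intro!: mult_mono order_trans[OF abs_ge_zero])
  ultimately show ?thesis by linarith
qed

section \<open>Empirical averages\<close>

lemma emp_inner: "emp n dat f \<bullet> d = emp n dat (\<lambda>ob. f ob \<bullet> d)"
  by (simp add: emp_def inner_sum_left)

lemma emp_diff: "emp n dat f - emp n dat g = emp n dat (\<lambda>ob. f ob - g ob)"
  by (simp add: emp_def sum_subtractf algebra_simps)

lemma abs_emp_le:
  fixes f :: "'o \<Rightarrow> real"
  assumes "\<And>ob. \<bar>f ob\<bar> \<le> B"
  shows "\<bar>emp n dat f\<bar> \<le> B"
proof -
  \<comment> \<open>The case \<open>n = 0\<close> is included: there \<open>1 / real n\<close> is 0,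
    the average vanishes, and \<open>0 \<le> B\<close> is what has to be known.\<close>
  have B: "0 \<le> B" using assms[of undefined] by linarith
  have "\<bar>\<Sum>i<n. f (dat i)\<bar> \<le> (\<Sum>i<n. B)"
    by (rule sum_norm_le[of _ f, THEN order_trans, unfolded real_norm_def] order_trans[OF sum_abs] sum_mono assms)+
  then have "\<bar>\<Sum>i<n. f (dat i)\<bar> \<le> real n * B" by simp
  then show ?thesis
    using B by (cases "n = 0") (auto simp: emp_def abs_mult field_simps)
qed

lemma DERIV_emp:
  fixes f :: "real \<Rightarrow> 'o \<Rightarrow> real"
  assumes "\<And>ob. ((\<lambda>t. f t ob) has_real_derivative f' ob) (at s)"
  shows "((\<lambda>t. emp n dat (f t)) has_real_derivative emp n dat f') (at s)"
  unfolding emp_def real_scaleR_def by (intro DERIV_cmult DERIV_sum assms)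

section \<open>Derivatives of the loss of one observation and their bounds near the truth\<close>

locale logit_features =
  fixes p0 :: "'o \<Rightarrow> real" and p :: "'o \<Rightarrow> 'g::euclidean_space"
    and z :: "'o \<Rightarrow> 't::euclidean_space" and y :: "'o \<Rightarrow> real"
    and K :: real and ws :: "'t \<times> 'g"
  assumes K1: "1 \<le> K" and p0K: "\<And>ob. \<bar>p0 ob\<bar> \<le> K" and pK: "\<And>ob. norm (p ob) \<le> K"
    and zK: "\<And>ob. norm (z ob) \<le> K" and y0: "\<And>ob. 0 \<le> y ob" and y1: "\<And>ob. y ob \<le> 1"
begin

definition lin :: "'t \<times> 'g \<Rightarrow> 'o \<Rightarrow> real" where "lin w ob = fst w \<bullet> z ob"
definition sg :: "'t \<times> 'g \<Rightarrow> 'o \<Rightarrow> real" where "sg w ob = p0 ob + snd w \<bullet> p ob"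
definition ix :: "'t \<times> 'g \<Rightarrow> 'o \<Rightarrow> real" where "ix w ob = sg w ob * lin w ob"
text \<open>The derivative of \<open>ix\<close> at \<open>w\<close> in direction
  \<open>d\<close>.\<close>

definition dix :: "'t \<times> 'g \<Rightarrow> 't \<times> 'g \<Rightarrow> 'o \<Rightarrow> real" where
  "dix w d ob = (snd d \<bullet> p ob) * lin w ob + sg w ob * (fst d \<bullet> z ob)"
definition res :: "'t \<times> 'g \<Rightarrow> 'o \<Rightarrow> real" where "res w ob = logistic (ix w ob) - y ob"
definition ell :: "'t \<times> 'g \<Rightarrow> 'o \<Rightarrow> real" where
  "ell w ob = - (y ob * ln (logistic (ix w ob)) + (1 - y ob) * ln (1 - logistic (ix w ob)))"
definition gr :: "'t \<times> 'g \<Rightarrow> 'o \<Rightarrow> 't \<times> 'g" where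
  "gr w ob = ((res w ob * sg w ob) *\<^sub>R z ob, (res w ob * lin w ob) *\<^sub>R p ob)"
text \<open>The second derivative of \<open>ix\<close>. It is constant in \<open>w\<close>, as
  \<open>ix\<close> is affine in each block, and it vanishes when both directions lie in the same
  block.\<close>

definition d2ix :: "'t \<times> 'g \<Rightarrow> 't \<times> 'g \<Rightarrow> 'o \<Rightarrow> real" where
  "d2ix d e ob = (snd d \<bullet> p ob) * (fst e \<bullet> z ob) + (snd e \<bullet> p ob) * (fst d \<bullet> z ob)"

text \<open>For \<open>\<kappa> = 1\<close> this is the exact Hessian form of the loss; for \<open>\<kappa> = 0\<close> the score term is
  dropped, which gives the plug-in information matrices.\<close>
definition hs :: "real \<Rightarrow> 't \<times> 'g \<Rightarrow> 't \<times> 'g \<Rightarrow> 't \<times> 'g \<Rightarrow> 'o \<Rightarrow> real" where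
  "hs \<kappa> w d e ob = logistic_deriv (ix w ob) * (dix w d ob * dix w e ob) + \<kappa> * (res w ob * d2ix d e ob)"

text \<open>Of the summand 2, one unit pays for the radius of \<open>cball ws 1\<close> and the
  other for the offset \<open>p0\<close> in \<open>sg_le\<close>.\<close>

definition Cb :: real where "Cb = K * (norm ws + 2)"

lemma Cb_ge_K: "K \<le> Cb"
  unfolding Cb_def using K1 mult_left_mono[of 1 "norm ws + 2" K] by simp

lemma Cb_ge_1: "1 \<le> Cb"
  using Cb_ge_K K1 by simp

lemma ell_nonneg: "0 \<le> ell w ob"
proof -
  have "ln (logistic (ix w ob)) \<le> 0" "ln (1 - logistic (ix w ob)) \<le> 0"
    using logistic_pos[of "ix w ob"] logistic_less_1[of "ix w ob"] by simp_all
  then have "y ob * ln (logistic (ix w ob)) \<le> 0" "(1 - y ob) * ln (1 - logistic (ix w ob)) \<le> 0"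
    using y0[of ob] y1[of ob] by (simp_all add: mult_nonneg_nonpos)
  then show ?thesis by (simp add: ell_def)
qed

lemma gr_inner: "gr w ob \<bullet> d = res w ob * dix w d ob"
  by (simp add: gr_def dix_def inner_prod_def algebra_simps inner_commute)

text \<open>Taylor and mean value arguments only use derivatives along lines, so \<open>gr\<close>
  enters through its inner products with directions; its agreement with \<open>grad\<close> is a
  separate, blockwise matter.\<close>

lemma DERIV_ell_along:
  "((\<lambda>t. ell (w + t *\<^sub>R d) ob) has_real_derivative gr (w + t *\<^sub>R d) ob \<bullet> d) (at t)"
proof -
  have ix: "((\<lambda>t. ix (w + t *\<^sub>R d) ob) has_real_derivative dix (w + t *\<^sub>R d) d ob) (at t)"
    unfolding ix_def sg_def lin_def dix_def
    by (auto intro!: derivative_eq_intros simp: inner_add_left algebra_simps)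
  show ?thesis
    unfolding ell_def gr_inner res_def by (rule DERIV_chain2[OF DERIV_logit_loss ix])
qed

lemma DERIV_gr_along:
  "((\<lambda>t. gr (w + t *\<^sub>R d) ob \<bullet> e) has_real_derivative hs 1 (w + t *\<^sub>R d) d e ob) (at t)"
proof -
  have ix: "((\<lambda>t. ix (w + t *\<^sub>R d) ob) has_real_derivative dix (w + t *\<^sub>R d) d ob) (at t)"
    unfolding ix_def sg_def lin_def dix_def
    by (auto intro!: derivative_eq_intros simp: inner_add_left algebra_simps)
  have dix: "((\<lambda>t. dix (w + t *\<^sub>R d) e ob) has_real_derivative d2ix d e ob) (at t)"
    unfolding sg_def lin_def dix_def d2ix_def
    by (auto intro!: derivative_eq_intros simp: inner_add_left algebra_simps)
  show ?thesis
    unfolding gr_inner res_def hs_def logistic_deriv_def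
    by (auto intro!: derivative_eq_intros ix dix simp: algebra_simps)
qed

lemma res_le: "\<bar>res w ob\<bar> \<le> 1"
  using logistic_pos[of "ix w ob"] logistic_less_1[of "ix w ob"] y0[of ob] y1[of ob]
  by (auto simp: res_def abs_le_iff)

lemma inner_p_le: "\<bar>snd d \<bullet> p ob\<bar> \<le> Cb * norm d"
proof -
  have "\<bar>snd d \<bullet> p ob\<bar> \<le> norm (snd d) * norm (p ob)" by (rule Cauchy_Schwarz_ineq2)
  also have "\<dots> \<le> norm d * Cb"
    using norm_snd_le[of "snd d" "fst d"] pK[of ob] Cb_ge_K by (intro mult_mono) auto
  finally show ?thesis by (simp add: mult.commute)
qed

lemma inner_z_le: "\<bar>fst d \<bullet> z ob\<bar> \<le> Cb * norm d"
proof -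
  have "\<bar>fst d \<bullet> z ob\<bar> \<le> norm (fst d) * norm (z ob)" by (rule Cauchy_Schwarz_ineq2)
  also have "\<dots> \<le> norm d * Cb"
    using norm_fst_le[of "fst d" "snd d"] zK[of ob] Cb_ge_K by (intro mult_mono) auto
  finally show ?thesis by (simp add: mult.commute)
qed

lemma norm_le_of_ball:
  assumes "w \<in> cball ws 1" shows "norm w \<le> norm ws + 1"
  using assms norm_triangle_ineq2[of w ws] by (auto simp: dist_norm norm_minus_commute)

lemma lin_le: assumes "w \<in> cball ws 1" shows "\<bar>lin w ob\<bar> \<le> Cb"
proof -
  have "\<bar>lin w ob\<bar> \<le> norm (fst w) * norm (z ob)" unfolding lin_def by (rule Cauchy_Schwarz_ineq2)
  also have "\<dots> \<le> (norm ws + 2) * K"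
    using norm_fst_le[of "fst w" "snd w"] zK[of ob] norm_le_of_ball[OF assms] K1 by (intro mult_mono) auto
  finally show ?thesis by (simp add: Cb_def mult.commute)
qed

lemma sg_le: assumes "w \<in> cball ws 1" shows "\<bar>sg w ob\<bar> \<le> Cb"
proof -
  have "\<bar>snd w \<bullet> p ob\<bar> \<le> norm (snd w) * norm (p ob)" by (rule Cauchy_Schwarz_ineq2)
  also have "\<dots> \<le> (norm ws + 1) * K"
    using norm_snd_le[of "snd w" "fst w"] pK[of ob] norm_le_of_ball[OF assms] K1 by (intro mult_mono) auto
  finally show ?thesis using p0K[of ob] by (simp add: Cb_def sg_def algebra_simps)
qed

lemma dix_le: assumes "w \<in> cball ws 1" shows "\<bar>dix w d ob\<bar> \<le> 2 * Cb^2 * norm d"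
proof -
  have "\<bar>(snd d \<bullet> p ob) * lin w ob\<bar> \<le> (Cb * norm d) * Cb"
    unfolding abs_mult using Cb_ge_1 by (intro mult_mono inner_p_le lin_le assms) auto
  moreover have "\<bar>sg w ob * (fst d \<bullet> z ob)\<bar> \<le> Cb * (Cb * norm d)"
    unfolding abs_mult using Cb_ge_1 by (intro mult_mono inner_z_le sg_le assms) auto
  ultimately show ?thesis unfolding dix_def by (simp add: power2_eq_square algebra_simps)
qed

lemma d2ix_le: "\<bar>d2ix d e ob\<bar> \<le> 2 * Cb^2 * norm d * norm e"
proof -
  have "\<bar>(snd d \<bullet> p ob) * (fst e \<bullet> z ob)\<bar> \<le> (Cb * norm d) * (Cb * norm e)"
    unfolding abs_mult using Cb_ge_1 by (intro mult_mono inner_p_le inner_z_le) auto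
  moreover have "\<bar>(snd e \<bullet> p ob) * (fst d \<bullet> z ob)\<bar> \<le> (Cb * norm e) * (Cb * norm d)"
    unfolding abs_mult using Cb_ge_1 by (intro mult_mono inner_p_le inner_z_le) auto
  ultimately show ?thesis unfolding d2ix_def by (simp add: power2_eq_square algebra_simps)
qed

lemma ix_lipschitz:
  assumes "w \<in> cball ws 1" "v \<in> cball ws 1"
  shows "\<bar>ix w ob - ix v ob\<bar> \<le> 2 * Cb^2 * norm (w - v)"
proof -
  have "\<bar>ix w ob - ix v ob\<bar> \<le> Cb * (Cb * norm (w - v)) + (Cb * norm (w - v)) * Cb"
    unfolding ix_def
  proof (rule abs_mult_diff_le)
    show "\<bar>sg w ob - sg v ob\<bar> \<le> Cb * norm (w - v)"
      using inner_p_le[of "w - v" ob] by (simp add: sg_def inner_diff_left)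
    show "\<bar>lin w ob - lin v ob\<bar> \<le> Cb * norm (w - v)"
      using inner_z_le[of "w - v" ob] by (simp add: lin_def inner_diff_left)
  qed (use assms sg_le lin_le in auto)
  then show ?thesis by (simp add: power2_eq_square algebra_simps)
qed

text \<open>\<open>dix\<close> is affine in \<open>w\<close>, so the difference is exactly the
  second derivative in direction \<open>w - v\<close>; this is why the bound holds globally and not
  just on a ball.\<close>

lemma dix_lipschitz: "\<bar>dix w d ob - dix v d ob\<bar> \<le> 2 * Cb^2 * norm d * norm (w - v)"
proof -
  have "dix w d ob - dix v d ob = d2ix d (w - v) ob"
    by (simp add: dix_def d2ix_def lin_def sg_def inner_diff_left algebra_simps)
  then show ?thesis using d2ix_le[of d "w - v" ob] by (simp add: mult_ac)
qed

text \<open>One constant for two purposes: the size of the Hessian,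
  \<open>4 * Cb^4 + 2 * Cb^2\<close>, and its Lipschitz constant,
  \<open>12 * Cb^4 + 8 * Cb^6\<close>, are both below it because \<open>1 \<le> Cb\<close>.\<close>

definition Hb :: real where "Hb = 24 * Cb^6"

lemma Cb_pow: "i \<le> 6 \<Longrightarrow> Cb ^ i \<le> Cb ^ 6"
  using Cb_ge_1 by (intro power_increasing) auto

lemma Hb_pos: "0 < Hb"
  using Cb_ge_1 by (simp add: Hb_def)

lemma hs_le:
  assumes "w \<in> cball ws 1" "\<bar>\<kappa>\<bar> \<le> 1"
  shows "\<bar>hs \<kappa> w d e ob\<bar> \<le> Hb * norm d * norm e"
proof -
  let ?n = "norm d * norm e"
  have n: "0 \<le> ?n" by simp
  have "\<bar>dix w d ob * dix w e ob\<bar> \<le> (2 * Cb^2 * norm d) * (2 * Cb^2 * norm e)"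
    unfolding abs_mult using Cb_ge_1 by (intro mult_mono dix_le assms) auto
  then have "\<bar>logistic_deriv (ix w ob)\<bar> * \<bar>dix w d ob * dix w e ob\<bar> \<le> 1 * ((2 * Cb^2 * norm d) * (2 * Cb^2 * norm e))"
    using logistic_deriv_pos[of "ix w ob"] logistic_deriv_le_1[of "ix w ob"] by (intro mult_mono) auto
  also have "\<dots> = 4 * Cb^4 * ?n" by (simp add: algebra_simps power2_eq_square power4_eq_xxxx)
  finally have a: "\<bar>logistic_deriv (ix w ob) * (dix w d ob * dix w e ob)\<bar> \<le> 4 * Cb^4 * ?n"
    by (simp add: abs_mult)
  have "\<bar>res w ob\<bar> * \<bar>d2ix d e ob\<bar> \<le> 1 * (2 * Cb^2 * norm d * norm e)"
    by (intro mult_mono res_le d2ix_le) auto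
  then have "\<bar>\<kappa>\<bar> * (\<bar>res w ob\<bar> * \<bar>d2ix d e ob\<bar>) \<le> 1 * (1 * (2 * Cb^2 * norm d * norm e))"
    by (rule mult_mono[OF assms(2)]) auto
  then have b: "\<bar>\<kappa> * (res w ob * d2ix d e ob)\<bar> \<le> 2 * Cb^2 * ?n"
    by (simp add: abs_mult mult_ac)
  have "\<bar>hs \<kappa> w d e ob\<bar> \<le> (4 * Cb^4 + 2 * Cb^2) * ?n"
    unfolding hs_def using a b by (simp add: algebra_simps)
  also have "\<dots> \<le> (24 * Cb^6) * ?n"
    using Cb_pow[of 4] Cb_pow[of 2] zero_le_power[OF order_trans[OF zero_le_one Cb_ge_1], of 6] by (intro mult_right_mono n) linarith+
  finally show ?thesis by (simp add: Hb_def mult_ac)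
qed

lemma hs_lipschitz:
  assumes w: "w \<in> cball ws 1" and v: "v \<in> cball ws 1" and \<kappa>: "\<bar>\<kappa>\<bar> \<le> 1"
  shows "\<bar>hs \<kappa> w d e ob - hs \<kappa> v d e ob\<bar> \<le> Hb * norm (w - v) * norm d * norm e"
proof -
  let ?n = "norm (w - v) * (norm d * norm e)"
  have n: "0 \<le> ?n" by simp
  have dd: "\<bar>dix w d ob * dix w e ob - dix v d ob * dix v e ob\<bar>
     \<le> (2 * Cb^2 * norm d) * (2 * Cb^2 * norm e * norm (w - v)) + (2 * Cb^2 * norm d * norm (w - v)) * (2 * Cb^2 * norm e)"
    by (intro abs_mult_diff_le dix_lipschitz dix_le assms)
  have vv: "\<bar>dix v d ob * dix v e ob\<bar> \<le> (2 * Cb^2 * norm d) * (2 * Cb^2 * norm e)"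
    unfolding abs_mult using Cb_ge_1 by (intro mult_mono dix_le assms) auto
  have ld: "\<bar>logistic_deriv (ix w ob) - logistic_deriv (ix v ob)\<bar> \<le> 2 * Cb^2 * norm (w - v)"
    using logistic_deriv_lipschitz ix_lipschitz[OF w v] by (rule order_trans)
  have ld1: "\<bar>logistic_deriv (ix w ob)\<bar> \<le> 1"
    using logistic_deriv_pos[of "ix w ob"] logistic_deriv_le_1[of "ix w ob"] by simp
  have a: "\<bar>logistic_deriv (ix w ob) * (dix w d ob * dix w e ob) - logistic_deriv (ix v ob) * (dix v d ob * dix v e ob)\<bar>
     \<le> (8 * Cb^4 + 8 * Cb^6) * ?n"
    using abs_mult_diff_le[OF ld dd ld1 vv] by (simp add: algebra_simps power2_eq_square eval_nat_numeral)
  have "\<bar>res w ob - res v ob\<bar> \<le> 2 * Cb^2 * norm (w - v)"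
    using order_trans[OF logistic_lipschitz ix_lipschitz[OF w v]] by (simp add: res_def)
  then have "\<bar>res w ob - res v ob\<bar> * \<bar>d2ix d e ob\<bar> \<le> (2 * Cb^2 * norm (w - v)) * (2 * Cb^2 * norm d * norm e)"
    using Cb_ge_1 by (intro mult_mono d2ix_le) auto
  then have "\<bar>\<kappa>\<bar> * (\<bar>res w ob - res v ob\<bar> * \<bar>d2ix d e ob\<bar>) \<le> 1 * ((2 * Cb^2 * norm (w - v)) * (2 * Cb^2 * norm d * norm e))"
    by (rule mult_mono[OF \<kappa>]) auto
  then have b: "\<bar>\<kappa> * (res w ob * d2ix d e ob) - \<kappa> * (res v ob * d2ix d e ob)\<bar> \<le> 4 * Cb^4 * ?n"
    unfolding abs_mult[symmetric] by (simp add: algebra_simps power2_eq_square eval_nat_numeral)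
  have "\<bar>hs \<kappa> w d e ob - hs \<kappa> v d e ob\<bar> \<le> (12 * Cb^4 + 8 * Cb^6) * ?n"
    unfolding hs_def using a b by (simp add: algebra_simps)
  also have "\<dots> \<le> (24 * Cb^6) * ?n"
    using Cb_pow[of 4] zero_le_power[OF order_trans[OF zero_le_one Cb_ge_1], of 6] by (intro mult_right_mono n) linarith+
  finally show ?thesis by (simp add: Hb_def mult_ac)
qed

text \<open>Testing the averaged gradient against itself turns scalar bounds into a norm bound: one
  factor of the norm cancels.\<close>

lemma norm_gr_le:
  assumes "w \<in> cball ws 1" shows "norm (emp n dat (gr w)) \<le> 2 * Cb^2"
proof -
  let ?g = "emp n dat (gr w)"
  have "\<bar>res w ob * dix w ?g ob\<bar> \<le> 1 * (2 * Cb^2 * norm ?g)" for ob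
    unfolding abs_mult by (intro mult_mono res_le dix_le assms) auto
  then have "\<bar>emp n dat (\<lambda>ob. gr w ob \<bullet> ?g)\<bar> \<le> 2 * Cb^2 * norm ?g"
    unfolding gr_inner by (intro abs_emp_le) simp
  then have "norm ?g * norm ?g \<le> 2 * Cb^2 * norm ?g"
    by (simp add: emp_inner[symmetric] power2_norm_eq_inner[symmetric] power2_eq_square)
  then show ?thesis by (cases "?g = 0") auto
qed

lemma segment_mem:
  assumes "w \<in> cball ws r" "v \<in> cball ws r" "0 \<le> t" "t \<le> 1"
  shows "w + t *\<^sub>R (v - w) \<in> cball ws r"
proof -
  have "(1 - t) *\<^sub>R w + t *\<^sub>R v \<in> cball ws r"
    using assms by (intro convexD convex_cball) auto
  then show ?thesis by (simp add: algebra_simps)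
qed

text \<open>The intermediate point depends on \<open>e\<close>. This is harmless, since all later
  estimates of the Hessian use only the distance of \<open>u\<close> from the centre, which the last
  conclusion controls.\<close>

lemma gradient_mean_value:
  assumes "w \<in> cball ws r" "v \<in> cball ws r"
  obtains u where "u \<in> cball ws r"
    "(emp n dat (gr v) - emp n dat (gr w)) \<bullet> e = emp n dat (hs 1 u (v - w) e)"
    "norm (u - w) \<le> norm (v - w)"
proof -
  have "\<exists>t. 0 < t \<and> t < 1 \<and>
      emp n dat (\<lambda>ob. gr (w + 1 *\<^sub>R (v - w)) ob \<bullet> e) - emp n dat (\<lambda>ob. gr (w + 0 *\<^sub>R (v - w)) ob \<bullet> e)
      = (1 - 0) * emp n dat (hs 1 (w + t *\<^sub>R (v - w)) (v - w) e)"
    by (rule MVT2) (auto intro!: DERIV_emp DERIV_gr_along)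
  then obtain t where t: "0 < t" "t < 1"
    "(emp n dat (gr v) - emp n dat (gr w)) \<bullet> e = emp n dat (hs 1 (w + t *\<^sub>R (v - w)) (v - w) e)"
    by (auto simp: inner_diff_left emp_inner)
  show ?thesis
    by (rule that[OF segment_mem[OF assms] t(3)]) (use t mult_right_mono[of t 1 "norm (v - w)"] in auto)
qed

lemma loss_taylor:
  assumes "w \<in> cball ws r" "v \<in> cball ws r"
  obtains u where "u \<in> cball ws r"
    "emp n dat (ell v) = emp n dat (ell w) + emp n dat (gr w) \<bullet> (v - w) + emp n dat (hs 1 u (v - w) (v - w)) / 2"
proof -
  define f where "f = (\<lambda>t. emp n dat (\<lambda>ob. ell (w + t *\<^sub>R (v - w)) ob))"
  define f' where "f' = (\<lambda>t. emp n dat (\<lambda>ob. gr (w + t *\<^sub>R (v - w)) ob \<bullet> (v - w)))"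
  define f'' where "f'' = (\<lambda>t. emp n dat (hs 1 (w + t *\<^sub>R (v - w)) (v - w) (v - w)))"
  \<comment> \<open>\<open>Maclaurin\<close> takes the derivatives as a sequence indexed by order;
    orders 0, 1 and 2 are the ones consulted.\<close>
  define df where "df = (\<lambda>m::nat. if m = 0 then f else if m = 1 then f' else f'')"
  have "\<exists>t>0. t < 1 \<and> f 1 = (\<Sum>m<2. df m 0 / fact m * 1 ^ m) + df 2 t / fact 2 * 1 ^ 2"
  proof (rule Maclaurin)
    show "\<forall>m t. m < 2 \<and> 0 \<le> t \<and> t \<le> 1 \<longrightarrow> (df m has_real_derivative df (Suc m) t) (at t)"
    proof (intro allI impI)
      fix m :: nat and t :: real
      assume "m < 2 \<and> 0 \<le> t \<and> t \<le> 1"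
      then consider "m = 0" | "m = 1" by linarith
      then show "(df m has_real_derivative df (Suc m) t) (at t)"
        by cases (auto simp: df_def f_def f'_def f''_def intro!: DERIV_emp DERIV_ell_along DERIV_gr_along)
    qed
  qed (auto simp: df_def)
  then obtain t where t: "0 < t" "t < 1" "f 1 = f 0 + f' 0 + f'' t / 2"
    by (auto simp: df_def eval_nat_numeral)
  show ?thesis
    by (rule that[OF segment_mem[OF assms]])
      (use t in \<open>auto simp: f_def f'_def f''_def emp_inner eval_nat_numeral\<close>)
qed

text \<open>A mean value equality is available only for scalar functions; choosing the gradient
  difference itself as test direction recovers its norm.\<close>

lemma gradient_lipschitz:
  assumes "w \<in> cball ws 1" "v \<in> cball ws 1"
  shows "norm (emp n dat (gr v) - emp n dat (gr w)) \<le> Hb * norm (v - w)"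
proof -
  let ?g = "emp n dat (gr v) - emp n dat (gr w)"
  obtain u where u: "u \<in> cball ws 1" "?g \<bullet> ?g = emp n dat (hs 1 u (v - w) ?g)"
    using gradient_mean_value[OF assms] by metis
  have "\<bar>emp n dat (hs 1 u (v - w) ?g)\<bar> \<le> Hb * norm (v - w) * norm ?g"
    by (intro abs_emp_le hs_le u) auto
  then have "norm ?g * norm ?g \<le> Hb * norm (v - w) * norm ?g"
    using u by (simp add: power2_norm_eq_inner[symmetric] power2_eq_square)
  then show ?thesis using Hb_pos by (cases "?g = 0") auto
qed

end

section \<open>Alternating gradient descent on a strongly convex ball\<close>

definition agd_step :: "('t::euclidean_space \<times> 'g::euclidean_space \<Rightarrow> 't \<times> 'g) \<Rightarrow> real \<Rightarrow> real \<Rightarrow> 't \<times> 'g \<Rightarrow> 't \<times> 'g" where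
  "agd_step G \<eta>1 \<eta>2 w =
     (let \<theta>' = fst w - \<eta>1 *\<^sub>R fst (G w) in (\<theta>', snd w - \<eta>2 *\<^sub>R snd (G (\<theta>', snd w))))"

lemma norm_Pair_sq: "(norm (a, b))\<^sup>2 = (norm a)\<^sup>2 + (norm b)\<^sup>2"
  by (simp add: norm_Pair)

text \<open>The loss itself is the Lyapunov function: each half step decreases it, so the iterates stay
  in the ball, and strong convexity turns the decrease into a linear rate. Measuring the decrease
  by the loss (not by a norm) is what makes the admissible radius independent of \<open>\<eta>1 / \<eta>2\<close>.\<close>
lemma agd_linear_convergence:
  fixes L :: "'t::euclidean_space \<times> 'g::euclidean_space \<Rightarrow> real" and G :: "'t \<times> 'g \<Rightarrow> 't \<times> 'g"
  assumes lower: "\<And>w v. w \<in> cball ws r \<Longrightarrow> v \<in> cball ws r \<Longrightarrow>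
      L w + G w \<bullet> (v - w) + \<mu> / 2 * (norm (v - w))\<^sup>2 \<le> L v"
    and upper: "\<And>w v. w \<in> cball ws r \<Longrightarrow> v \<in> cball ws r \<Longrightarrow>
      L v \<le> L w + G w \<bullet> (v - w) + \<beta> / 2 * (norm (v - w))\<^sup>2"
    and lip: "\<And>w v. w \<in> cball ws r \<Longrightarrow> v \<in> cball ws r \<Longrightarrow> norm (G v - G w) \<le> \<beta> * norm (v - w)"
    and bnd: "\<And>w. w \<in> cball ws r \<Longrightarrow> norm (G w) \<le> A"
    and nonneg: "\<And>w. 0 \<le> L w"
    and pos: "0 < \<mu>" "\<mu> \<le> \<beta>" "0 < r" "0 \<le> b"
    and start: "norm (w0 - ws) \<le> b" and b: "b \<le> r / 2"
    and small: "norm (G ws) \<le> \<delta>" and gap: "\<delta> * (r + b) + \<beta> / 2 * b\<^sup>2 < \<mu> * r\<^sup>2 / 8"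
    and step1: "0 < \<eta>1" "\<eta>1 * \<beta> \<le> 1" "\<eta>1 * A \<le> r / 2"
    and step2: "0 < \<eta>2" "\<eta>2 * \<beta> \<le> 1" "\<eta>2 * A \<le> r / 2"
  defines "W \<equiv> \<lambda>t. (agd_step G \<eta>1 \<eta>2 ^^ t) w0"
  shows "W t \<in> cball ws (r / 2)"
    and "(norm (G (W t)))\<^sup>2 \<le> A\<^sup>2 / (\<mu> * \<eta>1) * (1 - min \<eta>1 \<eta>2 * \<mu> / 3) ^ t"
proof -
  define m where "m = min \<eta>1 \<eta>2"
  \<comment> \<open>The infimum over the ball plays the optimal value, so no minimiser has to be
    located.\<close>
  define Ls where "Ls = Inf (L ` cball ws r)"
  have ws: "ws \<in> cball ws r" and half: "cball ws (r / 2) \<subseteq> cball ws r"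
    using pos by auto
  have w0: "w0 \<in> cball ws (r / 2)"
    using start b by (simp add: dist_norm norm_minus_commute)
  have \<beta>: "0 < \<beta>" using pos by linarith
  have A: "0 \<le> A" using bnd[OF ws] norm_ge_zero order_trans by blast
  have Ls_le: "Ls \<le> L v" if "v \<in> cball ws r" for v
    unfolding Ls_def by (rule cINF_lower) (use that nonneg in \<open>auto intro!: bdd_belowI2\<close>)
  \<comment> \<open>Polyak-Lojasiewicz inequality: by completing the square in
    \<open>norm (v - w)\<close>, the quadratic lower bound lies at most
    \<open>(norm (G w))^2 / (2 * \<mu>)\<close> below \<open>L w\<close>.\<close>
  have PL: "2 * \<mu> * (L w - Ls) \<le> (norm (G w))\<^sup>2" if w: "w \<in> cball ws r" for w
  proof -
    have "L w - (norm (G w))\<^sup>2 / (2 * \<mu>) \<le> Ls" unfolding Ls_def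
    proof (rule cINF_greatest)
      fix v assume v: "v \<in> cball ws r"
      have "\<bar>G w \<bullet> (v - w)\<bar> \<le> norm (G w) * norm (v - w)" by (rule Cauchy_Schwarz_ineq2)
      moreover have "0 \<le> (norm (G w) - \<mu> * norm (v - w))\<^sup>2 / (2 * \<mu>)" using pos by simp
      then have "norm (G w) * norm (v - w) \<le> (norm (G w))\<^sup>2 / (2 * \<mu>) + \<mu> / 2 * (norm (v - w))\<^sup>2"
        using pos by (simp add: power2_diff field_simps power2_eq_square)
      ultimately show "L w - (norm (G w))\<^sup>2 / (2 * \<mu>) \<le> L v"
        using lower[OF w v] by linarith
    qed (use ws in auto)
    then show ?thesis using pos by (simp add: field_simps)
  qed
  \<comment> \<open>Barrier argument: beyond the half ball, strong convexity at \<open>ws\<close>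
    lifts the loss to at least \<open>L ws - \<delta> * r + \<mu> * r^2 / 8\<close>, while
    smoothness caps \<open>L w0\<close> by \<open>L ws + \<delta> * b + \<beta> / 2 * b^2\<close>.
    The hypothesis \<open>gap\<close> separates the two.\<close>
  have sub: "w \<in> cball ws (r / 2)" if w: "w \<in> cball ws r" and le: "L w \<le> L w0" for w
  proof (rule ccontr)
    assume "w \<notin> cball ws (r / 2)"
    then have far: "r / 2 < norm (w - ws)" by (simp add: dist_norm norm_minus_commute)
    have near: "norm (w - ws) \<le> r" using w by (simp add: dist_norm norm_minus_commute)
    have "\<bar>G ws \<bullet> (w - ws)\<bar> \<le> \<delta> * r"
      using Cauchy_Schwarz_ineq2[of "G ws" "w - ws"] mult_mono[OF small near]
        order_trans[OF norm_ge_zero small] by force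
    moreover have "\<bar>G ws \<bullet> (w0 - ws)\<bar> \<le> \<delta> * b"
      using Cauchy_Schwarz_ineq2[of "G ws" "w0 - ws"] mult_mono[OF small start]
        order_trans[OF norm_ge_zero small] by force
    moreover have "\<beta> / 2 * (norm (w0 - ws))\<^sup>2 \<le> \<beta> / 2 * b\<^sup>2"
      using start \<beta> by (intro mult_left_mono power_mono) auto
    moreover have "\<mu> / 2 * (r / 2)\<^sup>2 \<le> \<mu> / 2 * (norm (w - ws))\<^sup>2"
      using far pos by (intro mult_left_mono power_mono) auto
    moreover have "\<mu> / 2 * (r / 2)\<^sup>2 = \<mu> * r\<^sup>2 / 8" by (simp add: power2_eq_square)
    moreover note lower[OF ws w] upper[OF ws subsetD[OF half w0]] le gap
    moreover have "\<delta> * (r + b) = \<delta> * r + \<delta> * b" by (simp add: algebra_simps)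
    ultimately show False by linarith
  qed
  \<comment> \<open>A short step from the half ball stays where the hypotheses on \<open>L\<close>
    apply; \<open>sub\<close> then puts the new point back into the half ball because the loss has
    not risen.\<close>
  have move: "w + d \<in> cball ws r" if "w \<in> cball ws (r / 2)" "norm d \<le> r / 2" for w d
    using that norm_triangle_ineq[of "w - ws" d] by (simp add: dist_norm norm_minus_commute add_diff_eq diff_add_eq)
  \<comment> \<open>\<open>g\<close> is kept abstract so that the same estimate serves each half
    step and the full gradient step at the end.\<close>
  have descent: "L (w + d) \<le> L w - \<eta> / 2 * (norm g)\<^sup>2"
    if "w \<in> cball ws r" "w + d \<in> cball ws r" "G w \<bullet> d = - \<eta> * (norm g)\<^sup>2" "norm d = \<eta> * norm g"
      "0 < \<eta>" "\<eta> * \<beta> \<le> 1" for w d \<eta> and g :: "'c::real_normed_vector"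
  proof -
    have "L (w + d) \<le> L w - \<eta> * (norm g)\<^sup>2 + \<beta> / 2 * (\<eta> * norm g)\<^sup>2"
      using upper[OF that(1,2)] that by simp
    also have "\<beta> / 2 * (\<eta> * norm g)\<^sup>2 = (\<eta> * \<beta>) * (\<eta> / 2 * (norm g)\<^sup>2)"
      by (simp add: power2_eq_square)
    also have "\<dots> \<le> 1 * (\<eta> / 2 * (norm g)\<^sup>2)"
      using that by (intro mult_right_mono) auto
    finally show ?thesis by (simp add: field_simps)
  qed
  have one: "agd_step G \<eta>1 \<eta>2 w \<in> cball ws (r / 2) \<and> L (agd_step G \<eta>1 \<eta>2 w) \<le> L w0 \<and>
      L (agd_step G \<eta>1 \<eta>2 w) - Ls \<le> (1 - m * \<mu> / 3) * (L w - Ls)"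
    if w: "w \<in> cball ws (r / 2)" and le: "L w \<le> L w0" for w
  proof -
    define g1 where "g1 = fst (G w)"
    define w1 where "w1 = w + (- \<eta>1 *\<^sub>R g1, 0)"
    define g2 where "g2 = snd (G w1)"
    define w2 where "w2 = w1 + (0, - \<eta>2 *\<^sub>R g2)"
    have w2: "agd_step G \<eta>1 \<eta>2 w = w2"
      by (cases w) (auto simp: agd_step_def Let_def w2_def w1_def g1_def g2_def)
    have wr: "w \<in> cball ws r" using w half by blast
    have n1: "norm g1 \<le> A"
      using norm_fst_le[of g1 "snd (G w)"] bnd[OF wr] by (simp add: g1_def)
    have "\<eta>1 * norm g1 \<le> r / 2" using mult_left_mono[OF n1, of \<eta>1] step1 by linarith
    then have w1r: "w1 \<in> cball ws r" unfolding w1_def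
      by (intro move[OF w]) (use step1 in \<open>simp add: norm_Pair\<close>)
    have d1: "L w1 \<le> L w - \<eta>1 / 2 * (norm g1)\<^sup>2" unfolding w1_def
      by (rule descent) (use wr w1r step1 in
        \<open>auto simp: w1_def norm_Pair inner_prod_def g1_def power2_norm_eq_inner\<close>)
    then have "L w1 \<le> L w0" using le step1 zero_le_power2[of "norm g1"]
      by (smt (verit) mult_nonneg_nonneg divide_nonneg_pos)
    then have w1: "w1 \<in> cball ws (r / 2)" using sub w1r by blast
    have n2: "norm g2 \<le> A"
      using norm_snd_le[of g2 "fst (G w1)"] bnd[OF w1r] by (simp add: g2_def)
    have "\<eta>2 * norm g2 \<le> r / 2" using mult_left_mono[OF n2, of \<eta>2] step2 by linarith
    then have w2r: "w2 \<in> cball ws r" unfolding w2_def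
      by (intro move[OF w1]) (use step2 in \<open>simp add: norm_Pair\<close>)
    have d2: "L w2 \<le> L w1 - \<eta>2 / 2 * (norm g2)\<^sup>2" unfolding w2_def
      by (rule descent) (use w1r w2r step2 in
        \<open>auto simp: w2_def norm_Pair inner_prod_def g2_def power2_norm_eq_inner\<close>)
    then have w2L: "L w2 \<le> L w0" using \<open>L w1 \<le> L w0\<close> step2 zero_le_power2[of "norm g2"]
      by (smt (verit) mult_nonneg_nonneg divide_nonneg_pos)
    \<comment> \<open>The second half step sees the gradient at \<open>w1\<close> instead of
      \<open>w\<close>; the Lipschitz bound and \<open>\<eta>1 * \<beta> \<le> 1\<close> transfer it
      back at the price of \<open>norm g1\<close>.\<close>
    have "norm (snd (G w)) \<le> norm g2 + norm g1"
    proof -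
      have "norm (G w1 - G w) \<le> \<beta> * (\<eta>1 * norm g1)"
        using lip[OF wr w1r] step1 by (simp add: w1_def norm_Pair)
      also have "\<dots> \<le> 1 * norm g1"
        unfolding mult.assoc[symmetric] using step1 by (intro mult_right_mono) (auto simp: mult.commute)
      finally have "norm (snd (G w1 - G w)) \<le> norm g1"
        using norm_snd_le[of "snd (G w1 - G w)" "fst (G w1 - G w)"] unfolding prod.collapse by linarith
      then show ?thesis using norm_triangle_sub[of "snd (G w)" g2]
        by (simp add: g2_def norm_minus_commute)
    qed
    then have "(norm (snd (G w)))\<^sup>2 \<le> (norm g2 + norm g1)\<^sup>2" by (intro power_mono) auto
    also have "\<dots> \<le> 2 * (norm g2)\<^sup>2 + 2 * (norm g1)\<^sup>2"
      using zero_le_power2[of "norm g2 - norm g1"] by (simp add: power2_sum power2_diff)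
    \<comment> \<open>The square of \<open>norm g1\<close> is counted once for its own block and
      twice through the transfer, hence 3. Since each half step gains at least \<open>m / 2\<close>
      times its square, the total gain is \<open>m / 6\<close> times the full square, and
      \<open>PL\<close> converts this to the rate \<open>m * \<mu> / 3\<close>.\<close>
    finally have "(norm (G w))\<^sup>2 \<le> 3 * ((norm g1)\<^sup>2 + (norm g2)\<^sup>2)"
      using norm_Pair_sq[of "fst (G w)" "snd (G w)"] zero_le_power2[of "norm g2"]
      unfolding g1_def prod.collapse by (smt (verit))
    then have "m / 6 * (norm (G w))\<^sup>2 \<le> m / 6 * (3 * ((norm g1)\<^sup>2 + (norm g2)\<^sup>2))"
      using step1 step2 by (intro mult_left_mono) (auto simp: m_def)
    also have "\<dots> = m / 2 * (norm g1)\<^sup>2 + m / 2 * (norm g2)\<^sup>2" by (simp add: algebra_simps)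
    also have "\<dots> \<le> \<eta>1 / 2 * (norm g1)\<^sup>2 + \<eta>2 / 2 * (norm g2)\<^sup>2"
      by (intro add_mono mult_right_mono) (auto simp: m_def)
    finally have "L w2 \<le> L w - m / 6 * (norm (G w))\<^sup>2" using d1 d2 by linarith
    moreover have "m / 6 * (2 * \<mu> * (L w - Ls)) \<le> m / 6 * (norm (G w))\<^sup>2"
      using PL[OF wr] step1 step2 by (intro mult_left_mono) (auto simp: m_def)
    moreover have "(1 - m * \<mu> / 3) * (L w - Ls) = L w - Ls - m / 6 * (2 * \<mu> * (L w - Ls))"
      by (simp add: field_simps)
    ultimately have "L w2 - Ls \<le> (1 - m * \<mu> / 3) * (L w - Ls)" by linarith
    then show ?thesis using sub[OF w2r w2L] w2L unfolding w2 by blast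
  qed
  have "m * \<mu> \<le> \<eta>1 * \<beta>" using step1 step2 pos by (intro mult_mono) (auto simp: m_def)
  then have rho: "0 \<le> 1 - m * \<mu> / 3" using step1 by simp
  have all: "W t \<in> cball ws (r / 2) \<and> L (W t) \<le> L w0 \<and> L (W t) - Ls \<le> (1 - m * \<mu> / 3) ^ t * (L w0 - Ls)" for t
  proof (induction t)
    case 0 show ?case using w0 by (simp add: W_def)
  next
    case (Suc t)
    have eq: "W (Suc t) = agd_step G \<eta>1 \<eta>2 (W t)" by (simp add: W_def)
    have o: "W (Suc t) \<in> cball ws (r / 2)" "L (W (Suc t)) \<le> L w0"
      "L (W (Suc t)) - Ls \<le> (1 - m * \<mu> / 3) * (L (W t) - Ls)"
      unfolding eq using one[of "W t"] Suc by blast+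
    have "(1 - m * \<mu> / 3) * (L (W t) - Ls) \<le> (1 - m * \<mu> / 3) * ((1 - m * \<mu> / 3) ^ t * (L w0 - Ls))"
      using Suc rho by (intro mult_left_mono) auto
    then show ?case using o by simp
  qed
  then show W: "W t \<in> cball ws (r / 2)" by blast
  have Wr: "W t \<in> cball ws r" using W half by blast
  \<comment> \<open>An auxiliary full gradient step from \<open>W t\<close> lowers the loss by
    \<open>\<eta>1 / 2 * (norm (G (W t)))^2\<close> but not below \<open>Ls\<close>, so the excess
    loss controls the squared gradient. The initial excess is in turn bounded by \<open>PL\<close>
    and \<open>A\<close>.\<close>
  have nW: "\<eta>1 * norm (G (W t)) \<le> r / 2"
    using mult_left_mono[OF bnd[OF Wr], of \<eta>1] step1 by linarith
  have v: "W t + - \<eta>1 *\<^sub>R G (W t) \<in> cball ws r"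
    by (rule move[OF W]) (use nW step1 in simp)
  have "L (W t + - \<eta>1 *\<^sub>R G (W t)) \<le> L (W t) - \<eta>1 / 2 * (norm (G (W t)))\<^sup>2"
    by (rule descent) (use Wr v step1 in \<open>auto simp: power2_norm_eq_inner\<close>)
  then have "\<eta>1 / 2 * (norm (G (W t)))\<^sup>2 \<le> L (W t) - Ls" using Ls_le[OF v] by linarith
  also have "\<dots> \<le> (1 - m * \<mu> / 3) ^ t * (L w0 - Ls)" using all by blast
  also have "\<dots> \<le> (1 - m * \<mu> / 3) ^ t * (A\<^sup>2 / (2 * \<mu>))"
  proof (rule mult_left_mono)
    have "2 * \<mu> * (L w0 - Ls) \<le> A\<^sup>2"
      using PL[OF subsetD[OF half w0]] power_mono[OF bnd[OF subsetD[OF half w0]], of 2] by force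
    then show "L w0 - Ls \<le> A\<^sup>2 / (2 * \<mu>)" using pos by (simp add: field_simps)
  qed (use rho in auto)
  finally show "(norm (G (W t)))\<^sup>2 \<le> A\<^sup>2 / (\<mu> * \<eta>1) * (1 - min \<eta>1 \<eta>2 * \<mu> / 3) ^ t"
    using step1 pos by (simp add: m_def field_simps)
qed

section \<open>Events of high probability\<close>

text \<open>Only a measurable event inside the property is demanded, so \<open>P\<close> may
  quantify over uncountably many vectors.\<close>

definition high_prob :: "'w measure \<Rightarrow> real \<Rightarrow> (nat \<Rightarrow> 'w \<Rightarrow> bool) \<Rightarrow> bool" where
  "high_prob M \<delta> P \<longleftrightarrow> eventually (\<lambda>n. \<exists>A\<in>sets M. measure M A \<ge> 1 - \<delta> \<and> (\<forall>\<omega>\<in>A. P n \<omega>)) sequentially"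

lemma conv_in_prob_iff:
  "conv_in_prob M Z c \<longleftrightarrow> (\<forall>\<epsilon>>0. \<forall>\<delta>>0. high_prob M \<delta> (\<lambda>n \<omega>. dist (Z n \<omega>) c \<le> \<epsilon>))"
  by (simp add: conv_in_prob_def high_prob_def)

lemma high_prob_mono:
  assumes "high_prob M \<delta> P" "eventually (\<lambda>n. \<forall>\<omega>\<in>space M. P n \<omega> \<longrightarrow> Q n \<omega>) sequentially"
  shows "high_prob M \<delta> Q"
  using assms unfolding high_prob_def
proof eventually_elim
  case (elim n)
  then show ?case using sets.sets_into_space by (metis subsetD)
qed

context prob_space
begin

lemma high_prob_conj:
  assumes "high_prob M \<delta> P" "high_prob M \<delta>' Q" "\<delta> + \<delta>' \<le> \<epsilon>"
  shows "high_prob M \<epsilon> (\<lambda>n \<omega>. P n \<omega> \<and> Q n \<omega>)"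
  using assms(1,2) unfolding high_prob_def
proof eventually_elim
  case (elim n)
  then obtain A B where A: "A \<in> sets M" "prob A \<ge> 1 - \<delta>" "\<forall>\<omega>\<in>A. P n \<omega>"
    and B: "B \<in> sets M" "prob B \<ge> 1 - \<delta>'" "\<forall>\<omega>\<in>B. Q n \<omega>" by blast
  have "prob (A \<union> B) = prob A + prob B - prob (A \<inter> B)"
    using A B by (simp add: finite_measure_Union' measure_Un3 fmeasurable_eq_sets)
  moreover have "prob (A \<union> B) \<le> 1" by simp
  ultimately have "prob (A \<inter> B) \<ge> 1 - \<epsilon>" using A B assms(3) by linarith
  then show ?case using A B by (intro bexI[of _ "A \<inter> B"]) auto
qed

lemma high_prob_finite_all:
  assumes "finite I" "\<And>i \<delta>. i \<in> I \<Longrightarrow> 0 < \<delta> \<Longrightarrow> high_prob M \<delta> (P i)" "0 < \<delta>"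
  shows "high_prob M \<delta> (\<lambda>n \<omega>. \<forall>i\<in>I. P i n \<omega>)"
  using assms
proof (induction I arbitrary: \<delta>)
  case empty
  then show ?case by (auto simp: high_prob_def prob_space intro!: always_eventually bexI[of _ "space M"])
next
  case (insert i I)
  have "high_prob M \<delta> (\<lambda>n \<omega>. P i n \<omega> \<and> (\<forall>i\<in>I. P i n \<omega>))"
    by (rule high_prob_conj[of "\<delta> / 2" _ "\<delta> / 2"]) (use insert in auto)
  then show ?case by simp
qed

end

lemma high_prob_eventually:
  assumes "high_prob M \<delta> P" "\<forall>\<^sub>F n in sequentially. R n"
    "\<And>n \<omega>. R n \<Longrightarrow> \<omega> \<in> space M \<Longrightarrow> P n \<omega> \<Longrightarrow> Q n \<omega>"
  shows "high_prob M \<delta> Q"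
  by (rule high_prob_mono[OF assms(1)]) (use assms(2) in eventually_elim, use assms(3) in blast)

section \<open>Convergence in distribution\<close>

lemma isCont_cdf_std_normal: "isCont (cdf std_normal_distribution) x"
proof -
  interpret real_distribution std_normal_distribution by (rule real_dist_normal_dist)
  have "emeasure std_normal_distribution {x} = 0"
    by (subst emeasure_density) (auto simp: nn_integral_0_iff_AE intro!: AE_I[of _ _ "{x}"])
  then show ?thesis by (simp add: isCont_cdf measure_def)
qed

context prob_space
begin

lemma cdf_distr_eq:
  assumes "X \<in> borel_measurable M"
  shows "cdf (distr M borel X) x = prob {\<omega> \<in> space M. X \<omega> \<le> x}"
  using assms by (simp add: cdf_def2 measure_distr vimage_def Int_def conj_commute)

text \<open>Sandwich: off a small event, \<open>X n \<le> x - e\<close> implies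
  \<open>Z n \<le> x\<close>, which implies \<open>X n \<le> x + e\<close>. As the limit cdf is
  continuous everywhere, both shifted points are admissible. Convergence, exceptional event and
  modulus of continuity cost \<open>r / 4\<close> each.\<close>

lemma weak_conv_m_slutsky:
  assumes X: "\<And>n. X n \<in> borel_measurable M" and Z: "\<And>n. Z n \<in> borel_measurable M"
    and conv: "weak_conv_m (\<lambda>n. distr M borel (X n)) \<mu>"
    and cont: "\<And>x. isCont (cdf \<mu>) x"
    and close: "\<And>\<epsilon> \<delta>. 0 < \<epsilon> \<Longrightarrow> 0 < \<delta> \<Longrightarrow> high_prob M \<delta> (\<lambda>n \<omega>. \<bar>Z n \<omega> - X n \<omega>\<bar> \<le> \<epsilon>)"
  shows "weak_conv_m (\<lambda>n. distr M borel (Z n)) \<mu>"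
  unfolding weak_conv_m_def weak_conv_def
proof (intro allI impI tendstoI)
  fix x r :: real assume r: "0 < r"
  have lim: "(\<lambda>n. prob {\<omega> \<in> space M. X n \<omega> \<le> t}) \<longlonglongrightarrow> cdf \<mu> t" for t
    using conv cont X by (simp add: weak_conv_m_def weak_conv_def cdf_distr_eq)
  obtain s where s: "0 < s" "\<And>t. dist t x < s \<Longrightarrow> dist (cdf \<mu> t) (cdf \<mu> x) < r / 4"
    using cont[of x] r unfolding continuous_at_eps_delta by (metis zero_less_divide_iff zero_less_numeral)
  define e where "e = s / 2"
  have e: "0 < e" "dist (cdf \<mu> (x + e)) (cdf \<mu> x) < r / 4" "dist (cdf \<mu> (x - e)) (cdf \<mu> x) < r / 4"
    using s by (auto simp: e_def dist_real_def)
  have ev: "\<forall>\<^sub>F n in sequentially. dist (prob {\<omega> \<in> space M. X n \<omega> \<le> t}) (cdf \<mu> t) < r / 4" for t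
    using lim[of t] r by (intro tendstoD) auto
  have "\<forall>\<^sub>F n in sequentially. \<exists>A\<in>sets M. prob A \<ge> 1 - r / 4 \<and> (\<forall>\<omega>\<in>A. \<bar>Z n \<omega> - X n \<omega>\<bar> \<le> e)"
    using close[of e "r / 4"] e r by (simp add: high_prob_def)
  then show "\<forall>\<^sub>F n in sequentially. dist (cdf (distr M borel (Z n)) x) (cdf \<mu> x) < r"
    using ev[of "x + e"] ev[of "x - e"]
  proof eventually_elim
    case (elim n)
    then obtain A where A: "A \<in> sets M" "prob A \<ge> 1 - r / 4" "\<forall>\<omega>\<in>A. \<bar>Z n \<omega> - X n \<omega>\<bar> \<le> e" by blast
    have [measurable]: "X n \<in> borel_measurable M" "Z n \<in> borel_measurable M" "A \<in> sets M"
      using X Z A by auto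
    have cA: "prob (space M - A) \<le> r / 4" using A prob_compl[of A] by simp
    have 1: "prob {\<omega> \<in> space M. Z n \<omega> \<le> x} \<le> prob {\<omega> \<in> space M. X n \<omega> \<le> x + e} + prob (space M - A)"
    proof (rule order_trans[OF finite_measure_mono measure_Un_le])
      show "{\<omega> \<in> space M. Z n \<omega> \<le> x} \<subseteq> {\<omega> \<in> space M. X n \<omega> \<le> x + e} \<union> (space M - A)"
        using A(3) by fastforce
    qed auto
    have 2: "prob {\<omega> \<in> space M. X n \<omega> \<le> x - e} \<le> prob {\<omega> \<in> space M. Z n \<omega> \<le> x} + prob (space M - A)"
    proof (rule order_trans[OF finite_measure_mono measure_Un_le])
      show "{\<omega> \<in> space M. X n \<omega> \<le> x - e} \<subseteq> {\<omega> \<in> space M. Z n \<omega> \<le> x} \<union> (space M - A)"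
        using A(3) by fastforce
    qed auto
    show ?case
      using 1 2 cA e elim(2,3) unfolding cdf_distr_eq[OF Z] dist_real_def by linarith
  qed
qed

text \<open>The difference \<open>Z n - X n\<close> splits into
  \<open>X n * (sqrt v / sqrt (S n) - 1)\<close> and \<open>R n / sqrt (S n)\<close>. In the first
  summand a vanishing factor multiplies \<open>X n\<close>, and tightness keeps that product
  small.\<close>

lemma weak_conv_m_ratio:
  fixes v :: real
  assumes X: "\<And>n. X n \<in> borel_measurable M" and Z: "\<And>n. Z n \<in> borel_measurable M"
    and conv: "weak_conv_m (\<lambda>n. distr M borel (X n)) std_normal_distribution"
    and tight: "\<And>\<delta>. 0 < \<delta> \<Longrightarrow> \<exists>k. high_prob M \<delta> (\<lambda>n \<omega>. \<bar>X n \<omega>\<bar> \<le> k)"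
    and v: "0 < v"
    and eq: "\<And>n \<omega>. \<omega> \<in> space M \<Longrightarrow> Z n \<omega> = (sqrt v * X n \<omega> + R n \<omega>) / sqrt (S n \<omega>)"
    and R: "\<And>\<epsilon> \<delta>. 0 < \<epsilon> \<Longrightarrow> 0 < \<delta> \<Longrightarrow> high_prob M \<delta> (\<lambda>n \<omega>. \<bar>R n \<omega>\<bar> \<le> \<epsilon>)"
    and S: "\<And>\<epsilon> \<delta>. 0 < \<epsilon> \<Longrightarrow> 0 < \<delta> \<Longrightarrow> high_prob M \<delta> (\<lambda>n \<omega>. \<bar>S n \<omega> - v\<bar> \<le> \<epsilon>)"
  shows "weak_conv_m (\<lambda>n. distr M borel (Z n)) std_normal_distribution"
proof (rule weak_conv_m_slutsky[OF X Z conv isCont_cdf_std_normal])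
  fix \<epsilon> \<delta> :: real assume \<epsilon>: "0 < \<epsilon>" and \<delta>: "0 < \<delta>"
  obtain k0 where k0: "high_prob M (\<delta> / 3) (\<lambda>n \<omega>. \<bar>X n \<omega>\<bar> \<le> k0)"
    using tight[of "\<delta> / 3"] \<delta> by auto
  define k where "k = \<bar>k0\<bar> + 1"
  have k: "0 < k" by (simp add: k_def)
  have "((\<lambda>s. sqrt v / sqrt s - 1) \<longlongrightarrow> sqrt v / sqrt v - 1) (nhds v)"
    using v by (intro tendsto_intros) (auto intro: filterlim_ident)
  then have a: "\<forall>\<^sub>F s in nhds v. dist (sqrt v / sqrt s - 1) 0 < \<epsilon> / (2 * k)"
    using v k \<epsilon> by (intro tendstoD) auto
  have "((\<lambda>s. 1 / sqrt s) \<longlongrightarrow> 1 / sqrt v) (nhds v)"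
    using v by (intro tendsto_intros) (auto intro: filterlim_ident)
  then have b: "\<forall>\<^sub>F s in nhds v. dist (1 / sqrt s) (1 / sqrt v) < 1"
    by (intro tendstoD) auto
  obtain q where q: "0 < q" "\<And>s. dist s v < q \<Longrightarrow>
      \<bar>sqrt v / sqrt s - 1\<bar> < \<epsilon> / (2 * k) \<and> dist (1 / sqrt s) (1 / sqrt v) < 1"
    using eventually_conj[OF a b] unfolding eventually_nhds_metric by auto
  \<comment> \<open>For \<open>s\<close> within \<open>q\<close> of \<open>v\<close>,
    \<open>1 / sqrt s\<close> differs from \<open>1 / sqrt v\<close> by less than 1, so
    \<open>c\<close> bounds it.\<close>
  define c where "c = 1 / sqrt v + 1"
  have inv_pos: "0 < 1 / sqrt v" using v by simp
  then have c: "0 < c" by (simp only: c_def add_pos_pos zero_less_one)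
  have H: "high_prob M \<delta> (\<lambda>n \<omega>. (\<bar>X n \<omega>\<bar> \<le> k0 \<and> \<bar>R n \<omega>\<bar> \<le> \<epsilon> / (2 * c)) \<and> \<bar>S n \<omega> - v\<bar> \<le> q / 2)"
  proof (rule high_prob_conj[of "2 * \<delta> / 3" _ "\<delta> / 3"])
    show "high_prob M (2 * \<delta> / 3) (\<lambda>n \<omega>. \<bar>X n \<omega>\<bar> \<le> k0 \<and> \<bar>R n \<omega>\<bar> \<le> \<epsilon> / (2 * c))"
      by (rule high_prob_conj[OF k0 R[of _ "\<delta> / 3"]]) (use \<epsilon> c \<delta> in auto)
  qed (use S[of "q / 2" "\<delta> / 3"] q \<delta> in auto)
  show "high_prob M \<delta> (\<lambda>n \<omega>. \<bar>Z n \<omega> - X n \<omega>\<bar> \<le> \<epsilon>)"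
  proof (rule high_prob_mono[OF H], rule always_eventually, intro allI ballI impI)
    fix n \<omega> assume om: "\<omega> \<in> space M"
      and h: "(\<bar>X n \<omega>\<bar> \<le> k0 \<and> \<bar>R n \<omega>\<bar> \<le> \<epsilon> / (2 * c)) \<and> \<bar>S n \<omega> - v\<bar> \<le> q / 2"
    have "dist (S n \<omega>) v < q" using h q by (simp add: dist_real_def)
    from q(2)[OF this] have s: "\<bar>sqrt v / sqrt (S n \<omega>) - 1\<bar> \<le> \<epsilon> / (2 * k)" "\<bar>1 / sqrt (S n \<omega>)\<bar> \<le> c"
      using inv_pos unfolding c_def dist_real_def by linarith+
    have "\<bar>X n \<omega> * (sqrt v / sqrt (S n \<omega>) - 1)\<bar> \<le> k * (\<epsilon> / (2 * k))"
      unfolding abs_mult using h s k by (intro mult_mono) (auto simp: k_def)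
    moreover have "\<bar>R n \<omega> * (1 / sqrt (S n \<omega>))\<bar> \<le> \<epsilon> / (2 * c) * c"
      unfolding abs_mult using h s c \<epsilon> by (intro mult_mono) auto
    moreover have "Z n \<omega> - X n \<omega> = X n \<omega> * (sqrt v / sqrt (S n \<omega>) - 1) + R n \<omega> * (1 / sqrt (S n \<omega>))"
      by (simp add: eq[OF om] algebra_simps add_divide_distrib)
    moreover have "k * (\<epsilon> / (2 * k)) = \<epsilon> / 2" "\<epsilon> / (2 * c) * c = \<epsilon> / 2"
      using k c by simp_all
    ultimately show "\<bar>Z n \<omega> - X n \<omega>\<bar> \<le> \<epsilon>" by linarith
  qed
qed

end

section \<open>Averages of bounded functions of an i.i.d. sample\<close>

lemma sqrt_n_at_top: "filterlim (\<lambda>n. sqrt (real n)) at_top sequentially"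
  by (intro filterlim_compose[OF sqrt_at_top filterlim_real_sequentially])

locale iid_sample = prob_space M for M :: "'w measure" +
  fixes N :: "'o measure" and D :: "nat \<Rightarrow> 'w \<Rightarrow> 'o"
  assumes D_meas [measurable]: "\<And>i. D i \<in> measurable M N"
    and D_indep: "indep_vars (\<lambda>_. N) D UNIV"
    and D_ident: "\<And>i. distr M N (D i) = distr M N (D 0)"
begin

lemma distr_comp:
  assumes [measurable]: "f \<in> borel_measurable N"
  shows "distr M borel (\<lambda>\<omega>. f (D i \<omega>)) = distr M borel (\<lambda>\<omega>. f (D 0 \<omega>))"
proof -
  have "distr M borel (\<lambda>\<omega>. f (D j \<omega>)) = distr (distr M N (D j)) borel f" for j
    by (simp add: distr_distr o_def)
  then show ?thesis using D_ident by metis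
qed

lemma indep_comp:
  assumes [measurable]: "f \<in> borel_measurable N"
  shows "indep_vars (\<lambda>_. borel) (\<lambda>i \<omega>. f (D i \<omega>)) I"
  by (rule indep_vars_subset[OF indep_vars_compose2[OF D_indep]]) auto

lemma integrable_bounded:
  fixes f :: "'o \<Rightarrow> real"
  assumes [measurable]: "f \<in> borel_measurable N" and "\<And>ob. \<bar>f ob\<bar> \<le> c"
  shows "integrable M (\<lambda>\<omega>. f (D i \<omega>))"
  by (rule integrable_const_bound[of _ c]) (use assms in auto)

text \<open>Hoeffding's inequality at deviation \<open>k / sqrt n\<close> has a right-hand side free
  of \<open>n\<close>, so a single \<open>k\<close> serves all sample sizes.\<close>

lemma sqrt_deviation_tight:
  fixes f :: "'o \<Rightarrow> real"
  assumes f [measurable]: "f \<in> borel_measurable N" and c: "\<And>ob. \<bar>f ob\<bar> \<le> c" and \<delta>: "0 < \<delta>"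
  shows "\<exists>k>0. high_prob M \<delta> (\<lambda>n \<omega>. sqrt n * \<bar>emp n (\<lambda>i. D i \<omega>) f - Eobs M (D 0) f\<bar> \<le> k)"
proof -
  define C where "C = \<bar>c\<bar> + 1"
  have C: "0 < C" by (simp add: C_def)
  have fC: "\<bar>f ob\<bar> \<le> C" for ob using c[of ob] by (simp add: C_def)
  \<comment> \<open>Chosen to make \<open>k^2 / (2 * C^2)\<close> equal to
    \<open>\<bar>ln (2 / \<delta>)\<bar> + 1\<close>; absolute value and summand 1 keep
    \<open>k\<close> positive for every \<open>\<delta>\<close>.\<close>
  define k where "k = C * sqrt (2 * (\<bar>ln (2 / \<delta>)\<bar> + 1))"
  have k: "0 < k" using C by (auto simp: k_def intro!: mult_pos_pos)
  have "- k\<^sup>2 / (2 * C\<^sup>2) = - (\<bar>ln (2 / \<delta>)\<bar> + 1)"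
    using C by (simp add: k_def power_mult_distrib field_simps)
  then have "exp (- k\<^sup>2 / (2 * C\<^sup>2)) \<le> exp (- ln (2 / \<delta>))" by simp
  also have "\<dots> = \<delta> / 2" using \<delta> by (simp add: exp_minus)
  finally have ex: "2 * exp (- k\<^sup>2 / (2 * C\<^sup>2)) \<le> \<delta>" by simp
  have "\<exists>A\<in>sets M. prob A \<ge> 1 - \<delta> \<and>
      (\<forall>\<omega>\<in>A. sqrt n * \<bar>emp n (\<lambda>i. D i \<omega>) f - Eobs M (D 0) f\<bar> \<le> k)" if n: "0 < n" for n
  proof -
    interpret Hoeffding_ineq_iid M "{..<n}" "\<lambda>i \<omega>. f (D i \<omega>)" "\<lambda>\<omega>. f (D 0 \<omega>)" "- C" C "expectation (\<lambda>\<omega>. f (D 0 \<omega>))"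
    proof unfold_locales
      show "indep_vars (\<lambda>_. borel) (\<lambda>i \<omega>. f (D i \<omega>)) {..<n}" by (rule indep_comp[OF f])
      show "distr M borel (\<lambda>\<omega>. f (D i \<omega>)) = distr M borel (\<lambda>\<omega>. f (D 0 \<omega>))" for i by (rule distr_comp[OF f])
      show "AE \<omega> in M. f (D 0 \<omega>) \<in> {- C..C}" using fC by (auto simp: abs_le_iff minus_le_iff)
    qed auto
    note expectation_X [simp del] \<comment> \<open>would loop: the reference variable is itself a member of the sequence\<close>
    let ?B = "{\<omega> \<in> space M. \<bar>(\<Sum>i<n. f (D i \<omega>)) / n - expectation (\<lambda>\<omega>. f (D 0 \<omega>))\<bar> \<ge> k / sqrt n}"
    have "prob ?B \<le> 2 * exp (- 2 * real n * (k / sqrt n)\<^sup>2 / (C - - C)\<^sup>2)"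
      by (rule Hoeffding_ineq_abs_ge'[of "k / sqrt n", unfolded card_lessThan])
        (use k n C in \<open>auto intro: divide_nonneg_nonneg\<close>)
    also have "- 2 * real n * (k / sqrt n)\<^sup>2 / (C - - C)\<^sup>2 = - k\<^sup>2 / (2 * C\<^sup>2)"
      using n C by (simp add: power_divide mult_2[symmetric] power_mult_distrib)
    finally have B: "prob ?B \<le> \<delta>" using ex by linarith
    have Bs: "?B \<in> sets M" by measurable
    show ?thesis
    proof (intro bexI conjI ballI)
      show "prob (space M - ?B) \<ge> 1 - \<delta>" using prob_compl[OF Bs] B by simp
      fix \<omega> assume "\<omega> \<in> space M - ?B"
      then have "\<bar>(\<Sum>i<n. f (D i \<omega>)) / n - expectation (\<lambda>\<omega>. f (D 0 \<omega>))\<bar> < k / sqrt n" by auto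
      then have "sqrt n * \<bar>(\<Sum>i<n. f (D i \<omega>)) / n - expectation (\<lambda>\<omega>. f (D 0 \<omega>))\<bar> < k"
        using n by (simp add: field_simps)
      then show "sqrt n * \<bar>emp n (\<lambda>i. D i \<omega>) f - Eobs M (D 0) f\<bar> \<le> k"
        by (simp add: emp_def Eobs_def)
    qed (use Bs in auto)
  qed
  then have "high_prob M \<delta> (\<lambda>n \<omega>. sqrt n * \<bar>emp n (\<lambda>i. D i \<omega>) f - Eobs M (D 0) f\<bar> \<le> k)"
    unfolding high_prob_def using eventually_gt_at_top[of 0] by (rule eventually_mono[rotated]) auto
  then show ?thesis using k by blast
qed

lemma weak_law:
  fixes f :: "'o \<Rightarrow> real"
  assumes "f \<in> borel_measurable N" "\<And>ob. \<bar>f ob\<bar> \<le> c" "0 < \<delta>" "0 < \<epsilon>"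
  shows "high_prob M \<delta> (\<lambda>n \<omega>. \<bar>emp n (\<lambda>i. D i \<omega>) f - Eobs M (D 0) f\<bar> \<le> \<epsilon>)"
proof -
  obtain k where k: "0 < k" "high_prob M \<delta> (\<lambda>n \<omega>. sqrt n * \<bar>emp n (\<lambda>i. D i \<omega>) f - Eobs M (D 0) f\<bar> \<le> k)"
    using sqrt_deviation_tight[OF assms(1-3)] by blast
  have ev: "\<forall>\<^sub>F n in sequentially. k / \<epsilon> + 1 \<le> sqrt n"
    using sqrt_n_at_top by (auto simp: filterlim_at_top)
  show ?thesis
  proof (rule high_prob_eventually[OF k(2) ev])
    fix n \<omega>
    assume n: "k / \<epsilon> + 1 \<le> sqrt n" and le: "sqrt n * \<bar>emp n (\<lambda>i. D i \<omega>) f - Eobs M (D 0) f\<bar> \<le> k"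
    have "k / \<epsilon> * \<bar>emp n (\<lambda>i. D i \<omega>) f - Eobs M (D 0) f\<bar> \<le> sqrt n * \<bar>emp n (\<lambda>i. D i \<omega>) f - Eobs M (D 0) f\<bar>"
      using n by (intro mult_right_mono) auto
    also note le
    finally show "\<bar>emp n (\<lambda>i. D i \<omega>) f - Eobs M (D 0) f\<bar> \<le> \<epsilon>"
      using k \<open>0 < \<epsilon>\<close> by (simp add: field_simps)
  qed
qed

lemma central_limit_emp:
  fixes f :: "'o \<Rightarrow> real"
  assumes f [measurable]: "f \<in> borel_measurable N" and c: "\<And>ob. \<bar>f ob\<bar> \<le> c"
    and mean: "Eobs M (D 0) f = 0" and var: "Eobs M (D 0) (\<lambda>ob. (f ob)\<^sup>2) = v" and v: "0 < v"
  shows "weak_conv_m (\<lambda>n. distr M borel (\<lambda>\<omega>. sqrt n * emp n (\<lambda>i. D i \<omega>) f / sqrt v)) std_normal_distribution"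
proof -
  have E: "expectation (\<lambda>\<omega>. g (D i \<omega>)) = expectation (\<lambda>\<omega>. g (D 0 \<omega>))"
    if [measurable]: "g \<in> borel_measurable N" for i and g :: "'o \<Rightarrow> real"
  proof -
    have "expectation (\<lambda>\<omega>. g (D j \<omega>)) = integral\<^sup>L (distr M borel (\<lambda>\<omega>. g (D j \<omega>))) (\<lambda>x. x)" for j
      by (subst integral_distr) auto
    then show ?thesis using distr_comp[OF that] by metis
  qed
  have m0: "expectation (\<lambda>\<omega>. f (D i \<omega>)) = 0" for i
    using E[of f] mean by (simp add: Eobs_def)
  have "weak_conv_m (\<lambda>n. distr M borel (\<lambda>\<omega>. (\<Sum>i<n. f (D i \<omega>)) / sqrt (n * (sqrt v)\<^sup>2))) std_normal_distribution"
  proof (rule central_limit_theorem_zero_mean[where \<mu> = "distr M borel (\<lambda>\<omega>. f (D 0 \<omega>))"])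
    show "integrable M (\<lambda>\<omega>. (f (D i \<omega>))\<^sup>2)" for i
      by (rule integrable_bounded[of "\<lambda>ob. (f ob)\<^sup>2" "c\<^sup>2"])
        (use power_mono[OF c abs_ge_zero, of _ 2] in auto)
    show "variance (\<lambda>\<omega>. f (D i \<omega>)) = (sqrt v)\<^sup>2" for i
      using v var E[of "\<lambda>ob. (f ob)\<^sup>2" i] by (simp add: m0 Eobs_def)
    show "distr M borel (\<lambda>\<omega>. f (D i \<omega>)) = distr M borel (\<lambda>\<omega>. f (D 0 \<omega>))" for i
      by (rule distr_comp[OF f])
  qed (use v m0 indep_comp[OF f] in auto)
  moreover have "(\<Sum>i<n. f (D i \<omega>)) / sqrt (n * (sqrt v)\<^sup>2) = sqrt n * emp n (\<lambda>i. D i \<omega>) f / sqrt v" for n \<omega>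
    using v by (cases "n = 0") (auto simp: emp_def real_sqrt_mult field_simps)
  ultimately show ?thesis by simp
qed

end

section \<open>Bilinear forms\<close>

lemma bilinear_expand:
  fixes B :: "'a::euclidean_space \<Rightarrow> 'b::euclidean_space \<Rightarrow> real"
  assumes "bilinear B"
  shows "B d e = (\<Sum>(i, j)\<in>Basis \<times> Basis. (d \<bullet> i) * (e \<bullet> j) * B i j)"
proof -
  have "B d e = B (\<Sum>i\<in>Basis. (d \<bullet> i) *\<^sub>R i) (\<Sum>j\<in>Basis. (e \<bullet> j) *\<^sub>R j)"
    by (simp add: euclidean_representation)
  also have "\<dots> = (\<Sum>(i, j)\<in>Basis \<times> Basis. B ((d \<bullet> i) *\<^sub>R i) ((e \<bullet> j) *\<^sub>R j))"
    by (rule bilinear_sum[OF assms])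
  finally show ?thesis
    by (simp add: bilinear_lmul[OF assms] bilinear_rmul[OF assms] mult_ac case_prod_unfold)
qed

text \<open>Turns finitely many scalar estimates on basis pairs into one that is uniform in all
  directions; the dimension factor is harmless because the dimension is fixed.\<close>

lemma bilinear_abs_le:
  fixes B :: "'a::euclidean_space \<Rightarrow> 'b::euclidean_space \<Rightarrow> real"
  assumes "bilinear B" "\<And>i j. i \<in> Basis \<Longrightarrow> j \<in> Basis \<Longrightarrow> \<bar>B i j\<bar> \<le> \<epsilon>"
  shows "\<bar>B d e\<bar> \<le> \<epsilon> * (DIM('a) * DIM('b)) * norm d * norm e"
proof -
  have "\<bar>B d e\<bar> \<le> (\<Sum>(i, j)\<in>(Basis :: 'a set) \<times> (Basis :: 'b set). norm d * norm e * \<epsilon>)"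
    unfolding bilinear_expand[OF assms(1), of d e] real_norm_def[symmetric, of "sum _ _"]
  proof (rule sum_norm_le)
    fix ij :: "'a \<times> 'b" assume "ij \<in> Basis \<times> Basis"
    then obtain i j where ij: "ij = (i, j)" "i \<in> Basis" "j \<in> Basis" by auto
    show "norm (case ij of (i, j) \<Rightarrow> (d \<bullet> i) * (e \<bullet> j) * B i j) \<le> (case ij of (i, j) \<Rightarrow> norm d * norm e * \<epsilon>)"
      unfolding ij prod.case real_norm_def abs_mult
      using Basis_le_norm[of i d] Basis_le_norm[of j e] assms(2)[of i j] ij
      by (intro mult_mono) auto
  qed
  then show ?thesis by (simp add: card_cartesian_product case_prod_unfold mult_ac)
qed

text \<open>The minimum over the compact unit sphere is attained and positive, and homogeneity
  extends it to all vectors. No symmetry or spectral decomposition is involved.\<close>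

lemma bilinear_coercive:
  fixes B :: "'a::euclidean_space \<Rightarrow> 'a \<Rightarrow> real"
  assumes B: "bilinear B" and pd: "\<And>d. d \<noteq> 0 \<Longrightarrow> 0 < B d d"
  shows "\<exists>l>0. \<forall>d. l * (norm d)\<^sup>2 \<le> B d d"
proof -
  have "(\<lambda>d. B d d) = (\<lambda>d. \<Sum>ij\<in>Basis \<times> Basis. (d \<bullet> fst ij) * (d \<bullet> snd ij) * B (fst ij) (snd ij))"
    by (rule ext, subst bilinear_expand[OF B]) (simp only: case_prod_unfold)
  moreover have "continuous_on (sphere 0 1) \<dots>"
    by (intro continuous_intros)
  ultimately have cont: "continuous_on (sphere 0 1) (\<lambda>d. B d d)" by (simp only:)
  have ne: "sphere 0 1 \<noteq> ({} :: 'a set)" by simp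
  obtain x where x: "x \<in> sphere 0 1" "\<And>d. d \<in> sphere 0 1 \<Longrightarrow> B x x \<le> B d d"
    using continuous_attains_inf[OF compact_sphere ne cont] by blast
  have "B x x * (norm d)\<^sup>2 \<le> B d d" for d
  proof (cases "d = 0")
    case True
    then show ?thesis using bilinear_lzero[OF B] by simp
  next
    case False
    have "B x x \<le> B ((1 / norm d) *\<^sub>R d) ((1 / norm d) *\<^sub>R d)"
      using False by (intro x) auto
    also have "\<dots> = B d d / (norm d)\<^sup>2"
      by (simp only: bilinear_lmul[OF B] bilinear_rmul[OF B]) (simp add: power2_eq_square)
    finally show ?thesis using False by (simp add: field_simps)
  qed
  moreover have "0 < B x x" using x by (intro pd) auto
  ultimately show ?thesis by blast
qed

section \<open>Asymptotics of the iterates\<close>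

lemma borel_measurable_logistic [measurable]: "logistic \<in> borel_measurable borel"
  unfolding logistic_def[abs_def] by measurable

lemma borel_measurable_logistic_deriv [measurable]: "logistic_deriv \<in> borel_measurable borel"
  unfolding logistic_deriv_def[abs_def] by measurable

lemma borel_measurable_fst_snd [measurable (raw)]:
  fixes f :: "'m \<Rightarrow> 'a::second_countable_topology \<times> 'b::second_countable_topology"
  assumes "f \<in> borel_measurable M"
  shows "(\<lambda>x. fst (f x)) \<in> borel_measurable M" "(\<lambda>x. snd (f x)) \<in> borel_measurable M"
  using assms by (auto intro!: borel_measurable_continuous_on[OF continuous_on_fst[OF continuous_on_id]]
      borel_measurable_continuous_on[OF continuous_on_snd[OF continuous_on_id]])

text \<open>\<open>label_mean\<close> states the conditional model without conditional expectations:
  label and success probability have the same integral against every bounded measurable function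
  that depends on the observation through \<open>cov\<close> alone.\<close>

locale logit_sample = logit_features p0 p z y K ws + iid_sample M N D
  for p0 :: "'o \<Rightarrow> real" and p :: "'o \<Rightarrow> 'g::euclidean_space" and z :: "'o \<Rightarrow> 't::euclidean_space"
    and y :: "'o \<Rightarrow> real" and K :: real and ws :: "'t \<times> 'g"
    and M :: "'w measure" and N :: "'o measure" and D :: "nat \<Rightarrow> 'w \<Rightarrow> 'o" +
  fixes cov :: "'o \<Rightarrow> 'c"
  assumes p0_meas [measurable]: "p0 \<in> borel_measurable N" and p_meas [measurable]: "p \<in> borel_measurable N"
    and z_meas [measurable]: "z \<in> borel_measurable N" and y_meas [measurable]: "y \<in> borel_measurable N"
    and features_cov: "\<And>ob ob'. cov ob = cov ob' \<Longrightarrow> p0 ob = p0 ob' \<and> p ob = p ob' \<and> z ob = z ob'"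
    and y_binary: "\<And>ob. y ob = 0 \<or> y ob = 1"
    and label_mean: "\<And>f c. f \<in> borel_measurable N \<Longrightarrow> (\<And>ob. \<bar>f ob\<bar> \<le> c) \<Longrightarrow>
        (\<And>ob ob'. cov ob = cov ob' \<Longrightarrow> f ob = f ob') \<Longrightarrow>
        Eobs M (D 0) (\<lambda>ob. y ob * f ob) = Eobs M (D 0) (\<lambda>ob. logistic (ix ws ob) * f ob)"
begin

text \<open>The parameter is a measurable function here because features are also evaluated at
  iterates, which depend on the sample.\<close>

lemma features_measurable:
  fixes w :: "'m \<Rightarrow> 't \<times> 'g"
  assumes [measurable]: "w \<in> borel_measurable R" "X \<in> measurable R N"
  shows sg_measurable: "(\<lambda>x. sg (w x) (X x)) \<in> borel_measurable R"
    and lin_measurable: "(\<lambda>x. lin (w x) (X x)) \<in> borel_measurable R"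
    and ix_measurable: "(\<lambda>x. ix (w x) (X x)) \<in> borel_measurable R"
    and dix_measurable: "(\<lambda>x. dix (w x) d (X x)) \<in> borel_measurable R"
    and d2ix_measurable: "(\<lambda>x. d2ix d e (X x)) \<in> borel_measurable R"
    and res_measurable: "(\<lambda>x. res (w x) (X x)) \<in> borel_measurable R"
    and gr_measurable: "(\<lambda>x. gr (w x) (X x)) \<in> borel_measurable R"
    and hs_measurable: "(\<lambda>x. hs \<kappa> (w x) d e (X x)) \<in> borel_measurable R"
  unfolding gr_def hs_def d2ix_def res_def dix_def ix_def sg_def lin_def by measurable

lemma const_features_measurable [measurable]:
  "sg w \<in> borel_measurable N" "lin w \<in> borel_measurable N" "ix w \<in> borel_measurable N"
  "dix w d \<in> borel_measurable N" "d2ix d e \<in> borel_measurable N" "res w \<in> borel_measurable N"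
  "gr w \<in> borel_measurable N" "hs \<kappa> w d e \<in> borel_measurable N"
  using features_measurable[of "\<lambda>_. w" N "\<lambda>x. x"] by auto

lemma agd_step_measurable:
  assumes [measurable]: "W \<in> borel_measurable M"
  shows "(\<lambda>\<omega>. agd_step (\<lambda>w. emp n (\<lambda>i. D i \<omega>) (gr w)) \<eta>1 \<eta>2 (W \<omega>)) \<in> borel_measurable M"
proof -
  note [measurable] = gr_measurable
  show ?thesis unfolding agd_step_def Let_def emp_def by measurable
qed

lemma iterates_measurable:
  "(\<lambda>\<omega>. (agd_step (\<lambda>w. emp n (\<lambda>i. D i \<omega>) (gr w)) \<eta>1 \<eta>2 ^^ t) w0) \<in> borel_measurable M"
  by (induction t) (auto intro: agd_step_measurable)

lemma ws_ball: "ws \<in> cball ws 1" by simp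

lemma cov_ws:
  assumes "cov ob = cov ob'"
  shows "ix ws ob = ix ws ob'" "dix ws d ob = dix ws d ob'" "d2ix d e ob = d2ix d e ob'"
  using features_cov[OF assms] by (simp_all add: ix_def dix_def d2ix_def lin_def sg_def)

lemma integrable_bounded_mult:
  assumes [measurable]: "f \<in> borel_measurable N" and c: "\<And>ob. \<bar>f ob\<bar> \<le> c"
    and g [measurable]: "g \<in> borel_measurable N" "\<And>ob. \<bar>g ob\<bar> \<le> (1::real)"
  shows "integrable M (\<lambda>\<omega>. g (D 0 \<omega>) * f (D 0 \<omega>))"
proof (rule integrable_bounded[of "\<lambda>ob. g ob * f ob" "1 * c"])
  show "\<bar>g ob * f ob\<bar> \<le> 1 * c" for ob
    unfolding abs_mult using g(2) c by (intro mult_mono) auto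
qed measurable

section \<open>Moments of the score at the truth\<close>

lemma abs_logistic_le_1: "\<bar>logistic v\<bar> \<le> 1"
  using logistic_pos[of v] logistic_less_1[of v] by simp

text \<open>Given the covariates the residual averages to zero, so it is orthogonal to every bounded
  function of them.\<close>

lemma score_mean:
  assumes f [measurable]: "f \<in> borel_measurable N" and c: "\<And>ob. \<bar>f ob\<bar> \<le> c"
    and cov: "\<And>ob ob'. cov ob = cov ob' \<Longrightarrow> f ob = f ob'"
  shows "Eobs M (D 0) (\<lambda>ob. res ws ob * f ob) = 0"
proof -
  have "integrable M (\<lambda>\<omega>. y (D 0 \<omega>) * f (D 0 \<omega>))"
    by (rule integrable_bounded_mult[OF f c, where g = y]) (use y0 y1 in auto)
  moreover have "integrable M (\<lambda>\<omega>. logistic (ix ws (D 0 \<omega>)) * f (D 0 \<omega>))"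
    by (rule integrable_bounded_mult[OF f c, where g = "\<lambda>ob. logistic (ix ws ob)"])
      (use abs_logistic_le_1 in auto)
  moreover have "Eobs M (D 0) (\<lambda>ob. y ob * f ob) = Eobs M (D 0) (\<lambda>ob. logistic (ix ws ob) * f ob)"
    by (rule label_mean[OF f c cov])
  ultimately show ?thesis
    by (simp add: Eobs_def res_def left_diff_distrib)
qed

text \<open>This is the conditional Bernoulli variance. The model only speaks of first moments of
  the label, so the square must first be linearised, with a remainder to which
  \<open>score_mean\<close> applies.\<close>

lemma score_second_moment:
  assumes f [measurable]: "f \<in> borel_measurable N" and c: "\<And>ob. \<bar>f ob\<bar> \<le> c"
    and cov: "\<And>ob ob'. cov ob = cov ob' \<Longrightarrow> f ob = f ob'"
  shows "Eobs M (D 0) (\<lambda>ob. (res ws ob)\<^sup>2 * f ob) = Eobs M (D 0) (\<lambda>ob. logistic_deriv (ix ws ob) * f ob)"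
proof -
  let ?l = "\<lambda>ob. logistic (ix ws ob)"
  have l1: "\<bar>?l ob\<bar> \<le> 1" for ob
    using logistic_pos[of "ix ws ob"] logistic_less_1[of "ix ws ob"] by simp
  define g where "g = (\<lambda>ob. (1 - 2 * ?l ob) * f ob)"
  have g [measurable]: "g \<in> borel_measurable N" unfolding g_def by measurable
  have gc: "\<bar>g ob\<bar> \<le> c" for ob
  proof -
    have "\<bar>1 - 2 * ?l ob\<bar> \<le> 1"
      using logistic_pos[of "ix ws ob"] logistic_less_1[of "ix ws ob"] by (simp add: abs_le_iff)
    then have "\<bar>1 - 2 * ?l ob\<bar> * \<bar>f ob\<bar> \<le> 1 * c" using c[of ob] by (intro mult_mono) auto
    then show ?thesis by (simp add: g_def abs_mult)
  qed
  have i: "integrable M (\<lambda>\<omega>. res ws (D 0 \<omega>) * g (D 0 \<omega>))"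
    by (rule integrable_bounded_mult[OF g gc, where g = "res ws"]) (use res_le in auto)
  have j: "integrable M (\<lambda>\<omega>. logistic_deriv (ix ws (D 0 \<omega>)) * f (D 0 \<omega>))"
    by (rule integrable_bounded_mult[OF f c, where g = "\<lambda>ob. logistic_deriv (ix ws ob)"])
      (use logistic_deriv_pos logistic_deriv_le_1 in \<open>auto simp: abs_of_pos\<close>)
  have "Eobs M (D 0) (\<lambda>ob. res ws ob * g ob) = 0"
    by (rule score_mean[OF g gc]) (unfold g_def, metis cov_ws(1) cov)
  \<comment> \<open>For \<open>y \<in> {0, 1}\<close>: \<open>(l - y)\<^sup>2 = l (1 - l) - (l - y) (1 - 2 l)\<close>.\<close>
  moreover have "(res ws ob)\<^sup>2 * f ob = logistic_deriv (ix ws ob) * f ob - res ws ob * g ob" for ob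
    using y_binary[of ob] by (auto simp: res_def g_def logistic_deriv_def power2_eq_square algebra_simps)
  ultimately show ?thesis using i j by (simp add: Eobs_def)
qed

text \<open>The Fisher information at the truth, as a bilinear form on the joint parameter.\<close>

definition Hh :: "'t \<times> 'g \<Rightarrow> 't \<times> 'g \<Rightarrow> real" where
  "Hh d e = Eobs M (D 0) (hs 0 ws d e)"

lemma bilinear_hs: "bilinear (\<lambda>d e. hs \<kappa> w d e ob)"
  unfolding bilinear_def hs_def dix_def d2ix_def
  by (auto intro!: linearI simp: algebra_simps inner_add_left)

lemma hs_integrable: "\<bar>\<kappa>\<bar> \<le> 1 \<Longrightarrow> integrable M (\<lambda>\<omega>. hs \<kappa> ws d e (D 0 \<omega>))"
  by (rule integrable_bounded[OF _ hs_le[OF ws_ball]]) auto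

lemmas hs_linear = bilinear_ladd[OF bilinear_hs] bilinear_radd[OF bilinear_hs]
  bilinear_lmul[OF bilinear_hs] bilinear_rmul[OF bilinear_hs]

lemma bilinear_Hh: "bilinear Hh"
  unfolding bilinear_def Hh_def Eobs_def
  by (intro conjI allI linearI) (simp_all add: hs_linear hs_integrable)

text \<open>The exact Hessian and its plug-in version differ by a residual times a function of the
  covariates, which has mean zero at the truth.\<close>

lemma hs_mean:
  assumes "\<kappa> = 0 \<or> \<kappa> = 1" shows "Eobs M (D 0) (hs \<kappa> ws d e) = Hh d e"
proof -
  have "Eobs M (D 0) (\<lambda>ob. res ws ob * d2ix d e ob) = 0"
    by (rule score_mean[OF const_features_measurable(5) d2ix_le cov_ws(3)])
  moreover have "hs 1 ws d e ob = hs 0 ws d e ob + res ws ob * d2ix d e ob" for ob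
    by (simp add: hs_def)
  moreover have "integrable M (\<lambda>\<omega>. res ws (D 0 \<omega>) * d2ix d e (D 0 \<omega>))"
    by (rule integrable_bounded_mult[OF _ d2ix_le, where g = "res ws"]) (use res_le in auto)
  ultimately show ?thesis using assms hs_integrable[of 0 d e]
    by (auto simp: Hh_def Eobs_def)
qed

text \<open>Information identity: the squared residual may be replaced by its conditional variance,
  so the variance of the score along \<open>h\<close> equals the curvature along
  \<open>h\<close>.\<close>

lemma score_variance: "Eobs M (D 0) (\<lambda>ob. (gr ws ob \<bullet> h)\<^sup>2) = Hh h h"
proof -
  have "Eobs M (D 0) (\<lambda>ob. (res ws ob)\<^sup>2 * (dix ws h ob)\<^sup>2) = Eobs M (D 0) (\<lambda>ob. logistic_deriv (ix ws ob) * (dix ws h ob)\<^sup>2)"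
  proof (rule score_second_moment[where c = "(2 * Cb^2 * norm h)\<^sup>2"])
    show "\<bar>(dix ws h ob)\<^sup>2\<bar> \<le> (2 * Cb^2 * norm h)\<^sup>2" for ob
      using power_mono[OF dix_le[OF ws_ball] abs_ge_zero, of h ob 2] by simp
    show "(dix ws h ob)\<^sup>2 = (dix ws h ob')\<^sup>2" if "cov ob = cov ob'" for ob ob'
      using cov_ws(2)[OF that] by metis
  qed measurable
  then show ?thesis
    by (simp add: Hh_def hs_def[abs_def] gr_inner power_mult_distrib power2_eq_square[of "dix _ _ _"])
qed

lemma gr_inner_le: "\<bar>gr ws ob \<bullet> h\<bar> \<le> 2 * Cb^2 * norm h"
proof -
  have "\<bar>gr ws ob \<bullet> h\<bar> \<le> 1 * (2 * Cb^2 * norm h)"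
    unfolding gr_inner abs_mult by (intro mult_mono res_le dix_le ws_ball) auto
  then show ?thesis by simp
qed

lemma score_mean_inner: "Eobs M (D 0) (\<lambda>ob. gr ws ob \<bullet> h) = 0"
  unfolding gr_inner by (rule score_mean[OF const_features_measurable(4) dix_le[OF ws_ball] cov_ws(2)])

lemma info_law:
  assumes "\<kappa> = 0 \<or> \<kappa> = 1" "0 < \<delta>" "0 < \<epsilon>"
  shows "high_prob M \<delta> (\<lambda>n \<omega>. \<forall>d e. \<bar>emp n (\<lambda>i. D i \<omega>) (hs \<kappa> ws d e) - Hh d e\<bar> \<le> \<epsilon> * norm d * norm e)"
proof -
  \<comment> \<open>The number of basis pairs is divided out in advance, to cancel the dimension
    factor of \<open>bilinear_abs_le\<close>.\<close>
  define q where "q = \<epsilon> / (DIM('t \<times> 'g) * DIM('t \<times> 'g))"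
  have dim: "0 < real (DIM('t \<times> 'g) * DIM('t \<times> 'g))"
    by (simp only: of_nat_0_less_iff nat_0_less_mult_iff DIM_positive)
  have q: "0 < q" unfolding q_def using assms dim by (simp only: zero_less_divide_iff simp_thms)
  have \<kappa>: "\<bar>\<kappa>\<bar> \<le> 1" using assms by auto
  have "high_prob M \<delta> (\<lambda>n \<omega>. \<forall>ij\<in>Basis \<times> Basis. \<bar>emp n (\<lambda>i. D i \<omega>) (hs \<kappa> ws (fst ij) (snd ij)) - Hh (fst ij) (snd ij)\<bar> \<le> q)"
  proof (rule high_prob_finite_all[OF _ _ \<open>0 < \<delta>\<close>])
    fix ij :: "('t \<times> 'g) \<times> ('t \<times> 'g)" and \<delta>' :: real assume "0 < \<delta>'"
    then show "high_prob M \<delta>' (\<lambda>n \<omega>. \<bar>emp n (\<lambda>i. D i \<omega>) (hs \<kappa> ws (fst ij) (snd ij)) - Hh (fst ij) (snd ij)\<bar> \<le> q)"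
      unfolding hs_mean[OF assms(1), symmetric]
      by (intro weak_law[OF _ hs_le[OF ws_ball \<kappa>]] q) auto
  qed auto
  then show ?thesis
  proof (rule high_prob_mono, intro always_eventually allI ballI impI)
    fix n \<omega> d e
    assume H: "\<forall>ij\<in>Basis \<times> Basis. \<bar>emp n (\<lambda>i. D i \<omega>) (hs \<kappa> ws (fst ij) (snd ij)) - Hh (fst ij) (snd ij)\<bar> \<le> q"
    have bl: "bilinear (\<lambda>d e. emp n (\<lambda>i. D i \<omega>) (hs \<kappa> ws d e) - Hh d e)"
      unfolding bilinear_def emp_def
      by (intro conjI allI linearI)
        (simp_all add: hs_linear bilinear_ladd[OF bilinear_Hh] bilinear_radd[OF bilinear_Hh]
          bilinear_lmul[OF bilinear_Hh] bilinear_rmul[OF bilinear_Hh]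
          sum.distrib sum_distrib_left[symmetric] algebra_simps)
    have "\<bar>emp n (\<lambda>i. D i \<omega>) (hs \<kappa> ws d e) - Hh d e\<bar> \<le> q * (DIM('t \<times> 'g) * DIM('t \<times> 'g)) * norm d * norm e"
      by (rule bilinear_abs_le[OF bl]) (use H in auto)
    moreover have "q * (DIM('t \<times> 'g) * DIM('t \<times> 'g)) = \<epsilon>"
      unfolding q_def using dim by (metis nonzero_eq_divide_eq order_less_irrefl)
    ultimately show "\<bar>emp n (\<lambda>i. D i \<omega>) (hs \<kappa> ws d e) - Hh d e\<bar> \<le> \<epsilon> * norm d * norm e" by metis
  qed
qed

text \<open>The threshold \<open>k b\<close> depends on the error level, so the level has to be
  fixed before the events are intersected: every coordinate gets an equal share of
  \<open>\<delta>\<close>. \<open>high_prob_finite_all\<close>, which asks for a fixed property at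
  every level, does not fit.\<close>

lemma score_tight:
  assumes "0 < \<delta>"
  shows "\<exists>k>0. high_prob M \<delta> (\<lambda>n \<omega>. sqrt n * norm (emp n (\<lambda>i. D i \<omega>) (gr ws)) \<le> k)"
proof -
  let ?B = "Basis :: ('t \<times> 'g) set"
  define \<delta>' where "\<delta>' = \<delta> / card ?B"
  have \<delta>': "0 < \<delta>'" using assms by (simp add: \<delta>'_def add_pos_pos)
  have "\<exists>k>0. high_prob M \<delta>' (\<lambda>n \<omega>. sqrt n * \<bar>emp n (\<lambda>i. D i \<omega>) (gr ws) \<bullet> b\<bar> \<le> k)" for b
  proof -
    have "(\<lambda>ob. gr ws ob \<bullet> b) \<in> borel_measurable N" by measurable
    from sqrt_deviation_tight[OF this gr_inner_le \<delta>'] show ?thesis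
      by (simp add: score_mean_inner emp_inner)
  qed
  then have "\<forall>b. \<exists>k>0. high_prob M \<delta>' (\<lambda>n \<omega>. sqrt n * \<bar>emp n (\<lambda>i. D i \<omega>) (gr ws) \<bullet> b\<bar> \<le> k)" ..
  from choice[OF this] obtain k where k: "\<And>b. 0 < k b"
    "\<And>b. high_prob M \<delta>' (\<lambda>n \<omega>. sqrt n * \<bar>emp n (\<lambda>i. D i \<omega>) (gr ws) \<bullet> b\<bar> \<le> k b)" by blast
  have all: "high_prob M (card J * \<delta>') (\<lambda>n \<omega>. \<forall>b\<in>J. sqrt n * \<bar>emp n (\<lambda>i. D i \<omega>) (gr ws) \<bullet> b\<bar> \<le> k b)"
    if "finite J" for J using that
  proof (induction J)
    case empty
    then show ?case by (auto simp: high_prob_def prob_space intro!: always_eventually bexI[of _ "space M"])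
  next
    case (insert b J)
    have "high_prob M (card (insert b J) * \<delta>') (\<lambda>n \<omega>. sqrt n * \<bar>emp n (\<lambda>i. D i \<omega>) (gr ws) \<bullet> b\<bar> \<le> k b \<and>
        (\<forall>b\<in>J. sqrt n * \<bar>emp n (\<lambda>i. D i \<omega>) (gr ws) \<bullet> b\<bar> \<le> k b))"
      by (rule high_prob_conj[OF k(2) insert.IH]) (use insert in \<open>simp add: algebra_simps\<close>)
    then show ?case by simp
  qed
  have "real (card ?B) * \<delta>' = \<delta>"
    unfolding \<delta>'_def using DIM_positive[where 'a = "'t \<times> 'g"] by (simp del: DIM_prod)
  then have "high_prob M \<delta> (\<lambda>n \<omega>. \<forall>b\<in>?B. sqrt n * \<bar>emp n (\<lambda>i. D i \<omega>) (gr ws) \<bullet> b\<bar> \<le> k b)"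
    using all[OF finite_Basis] by (simp only:)
  then have "high_prob M \<delta> (\<lambda>n \<omega>. sqrt n * norm (emp n (\<lambda>i. D i \<omega>) (gr ws)) \<le> sum k ?B)"
  proof (rule high_prob_mono, intro always_eventually allI ballI impI)
    fix n \<omega> assume H: "\<forall>b\<in>?B. sqrt n * \<bar>emp n (\<lambda>i. D i \<omega>) (gr ws) \<bullet> b\<bar> \<le> k b"
    have "sqrt n * norm (emp n (\<lambda>i. D i \<omega>) (gr ws)) \<le> sqrt n * (\<Sum>b\<in>?B. \<bar>emp n (\<lambda>i. D i \<omega>) (gr ws) \<bullet> b\<bar>)"
      by (intro mult_left_mono norm_le_l1) auto
    also have "\<dots> \<le> sum k ?B"
      unfolding sum_distrib_left using H by (intro sum_mono) auto
    finally show "sqrt n * norm (emp n (\<lambda>i. D i \<omega>) (gr ws)) \<le> sum k ?B" .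
  qed
  moreover have "0 < sum k ?B" using k(1) by (intro sum_pos) auto
  ultimately show ?thesis by blast
qed

text \<open>Holds for all \<open>u\<close> in the unit ball on the same event, hence also at
  sample-dependent points.\<close>

lemma emp_hs_near:
  assumes E: "\<And>d e. \<bar>emp n dat (hs \<kappa> ws d e) - Hh d e\<bar> \<le> q * norm d * norm e"
    and \<kappa>: "\<bar>\<kappa>\<bar> \<le> 1" and u: "u \<in> cball ws 1"
  shows "\<bar>emp n dat (hs \<kappa> u d e) - Hh d e\<bar> \<le> (Hb * norm (u - ws) + q) * norm d * norm e"
proof -
  have "\<bar>emp n dat (hs \<kappa> u d e) - emp n dat (hs \<kappa> ws d e)\<bar> \<le> Hb * norm (u - ws) * norm d * norm e"
    unfolding emp_diff by (intro abs_emp_le hs_lipschitz u ws_ball \<kappa>)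
  then show ?thesis using E[of d e] by (simp add: algebra_simps)
qed

text \<open>A deterministic statement; the sample enters through \<open>E1\<close> and
  \<open>E2\<close>. Of the curvature \<open>l\<close>, one quarter is lost to sampling error and
  one quarter to the drift \<open>Hb * r\<close> of the Hessian over the ball, which leaves the
  modulus \<open>l / 2\<close>.\<close>

lemma agd_good_event:
  assumes l: "0 < l" "l \<le> Hb" and coer: "\<And>d. l * (norm d)\<^sup>2 \<le> Hh d d"
    and r: "0 < r" "r \<le> 1" "Hb * r \<le> l / 4"
    and E1: "\<And>d e. \<bar>emp n dat (hs 1 ws d e) - Hh d e\<bar> \<le> l / 4 * norm d * norm e"
    and E2: "norm (emp n dat (gr ws)) \<le> l * r / 64"
    and b: "norm (w0 - ws) \<le> b" "b \<le> r * l / (16 * Hb)"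
    and step1: "0 < \<eta>1" "\<eta>1 * Hb \<le> 1" "\<eta>1 * (2 * Cb\<^sup>2) \<le> r / 2"
    and step2: "0 < \<eta>2" "\<eta>2 * Hb \<le> 1" "\<eta>2 * (2 * Cb\<^sup>2) \<le> r / 2"
  defines "W \<equiv> \<lambda>t. (agd_step (\<lambda>w. emp n dat (gr w)) \<eta>1 \<eta>2 ^^ t) w0"
  shows "W t \<in> cball ws r"
    and "(norm (emp n dat (gr (W t))))\<^sup>2 \<le> (2 * Cb\<^sup>2)\<^sup>2 / (l / 2 * \<eta>1) * (1 - min \<eta>1 \<eta>2 * (l / 2) / 3) ^ t"
    and "l / 2 * norm (W t - ws) \<le> norm (emp n dat (gr (W t))) + norm (emp n dat (gr ws))"
proof -
  have r1: "cball ws r \<subseteq> cball ws 1" using r by auto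
  have conv: "l / 2 * (norm d)\<^sup>2 \<le> emp n dat (hs 1 u d d)" if u: "u \<in> cball ws r" for u d
  proof -
    have "\<bar>emp n dat (hs 1 u d d) - Hh d d\<bar> \<le> (Hb * norm (u - ws) + l / 4) * norm d * norm d"
      by (rule emp_hs_near[OF E1]) (use u r1 in auto)
    also have "\<dots> \<le> (l / 2) * norm d * norm d"
    proof (intro mult_right_mono)
      have "Hb * norm (u - ws) \<le> Hb * r"
        using u Hb_pos by (intro mult_left_mono) (auto simp: dist_norm norm_minus_commute)
      then show "Hb * norm (u - ws) + l / 4 \<le> l / 2" using r by linarith
    qed auto
    finally have "\<bar>emp n dat (hs 1 u d d) - Hh d d\<bar> \<le> l / 2 * (norm d)\<^sup>2"
      by (simp add: power2_eq_square)
    moreover have "l * (norm d)\<^sup>2 = l / 2 * (norm d)\<^sup>2 + l / 2 * (norm d)\<^sup>2" by simp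
    ultimately show ?thesis using coer[of d] by linarith
  qed
  have smooth: "emp n dat (hs 1 u d d) \<le> Hb * (norm d)\<^sup>2" if u: "u \<in> cball ws r" for u d
  proof -
    have "\<bar>emp n dat (hs 1 u d d)\<bar> \<le> Hb * norm d * norm d"
      by (intro abs_emp_le hs_le subsetD[OF r1 u]) auto
    then show ?thesis by (simp add: power2_eq_square mult.assoc)
  qed
  have bpos: "0 \<le> b" using b norm_ge_zero order_trans by blast
  have "r * l / (16 * Hb) \<le> r / 16"
    using l r Hb_pos by (simp add: field_simps)
  then have b16: "b \<le> r / 16" using b by linarith
  \<comment> \<open>The two summands are at most \<open>l * r^2 / 32\<close> and
    \<open>l * r^2 / 512\<close>, against \<open>l * r^2 / 16\<close> on the right.\<close>
  have gap: "l * r / 64 * (r + b) + Hb / 2 * b\<^sup>2 < l / 2 * r\<^sup>2 / 8"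
  proof -
    have "Hb * b \<le> r * l / 16" using b(2) Hb_pos by (simp add: field_simps)
    then have "Hb * b * b \<le> (r * l / 16) * (r / 16)"
      using b16 bpos l r by (intro mult_mono) auto
    then have 1: "Hb / 2 * b\<^sup>2 \<le> l * r\<^sup>2 / 512" by (simp add: power2_eq_square mult_ac)
    have "l * r / 64 * (r + b) \<le> l * r / 64 * (2 * r)"
      using b16 l r by (intro mult_left_mono) auto
    then have 2: "l * r / 64 * (r + b) \<le> l * r\<^sup>2 / 32" by (simp add: power2_eq_square)
    have "0 < l * r\<^sup>2" using l r by simp
    then show ?thesis using 1 2 by linarith
  qed
  note conclusion = agd_linear_convergence[where L = "\<lambda>w. emp n dat (ell w)" and G = "\<lambda>w. emp n dat (gr w)"
      and ws = ws and r = r and \<mu> = "l / 2" and \<beta> = Hb and A = "2 * Cb\<^sup>2" and \<delta> = "l * r / 64"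
      and b = b and ?w0.0 = w0 and ?\<eta>1.0 = \<eta>1 and ?\<eta>2.0 = \<eta>2]
  have prems:
    "emp n dat (ell w) + emp n dat (gr w) \<bullet> (v - w) + l / 2 / 2 * (norm (v - w))\<^sup>2 \<le> emp n dat (ell v)"
    "emp n dat (ell v) \<le> emp n dat (ell w) + emp n dat (gr w) \<bullet> (v - w) + Hb / 2 * (norm (v - w))\<^sup>2"
    "norm (emp n dat (gr v) - emp n dat (gr w)) \<le> Hb * norm (v - w)"
    if w: "w \<in> cball ws r" and v: "v \<in> cball ws r" for w v
  proof -
    obtain u where u: "u \<in> cball ws r"
      "emp n dat (ell v) = emp n dat (ell w) + emp n dat (gr w) \<bullet> (v - w) + emp n dat (hs 1 u (v - w) (v - w)) / 2"
      using loss_taylor[OF w v] by blast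
    show "emp n dat (ell w) + emp n dat (gr w) \<bullet> (v - w) + l / 2 / 2 * (norm (v - w))\<^sup>2 \<le> emp n dat (ell v)"
      "emp n dat (ell v) \<le> emp n dat (ell w) + emp n dat (gr w) \<bullet> (v - w) + Hb / 2 * (norm (v - w))\<^sup>2"
      using conv[OF u(1), of "v - w"] smooth[OF u(1), of "v - w"] unfolding u(2) by linarith+
    show "norm (emp n dat (gr v) - emp n dat (gr w)) \<le> Hb * norm (v - w)"
      using gradient_lipschitz w v r1 by blast
  qed
  have bnd: "norm (emp n dat (gr w)) \<le> 2 * Cb\<^sup>2" if "w \<in> cball ws r" for w
    using norm_gr_le that r1 by blast
  have nonneg: "0 \<le> emp n dat (ell w)" for w
    by (simp add: emp_def sum_nonneg ell_nonneg)
  have side: "0 < l / 2" "l / 2 \<le> Hb" "b \<le> r / 2" using l b16 r by auto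
  show Wb: "W t \<in> cball ws r"
    unfolding W_def
    by (rule subsetD[OF _ conclusion(1)[OF prems bnd nonneg side(1,2) r(1) bpos b(1) side(3) E2 gap step1 step2]]) (use r in auto)
  show "(norm (emp n dat (gr (W t))))\<^sup>2 \<le> (2 * Cb\<^sup>2)\<^sup>2 / (l / 2 * \<eta>1) * (1 - min \<eta>1 \<eta>2 * (l / 2) / 3) ^ t"
    unfolding W_def by (rule conclusion(2)[OF prems bnd nonneg side(1,2) r(1) bpos b(1) side(3) E2 gap step1 step2])
  have ws: "ws \<in> cball ws r" using r by simp
  \<comment> \<open>Strong monotonicity of the gradient: testing its increment with
    \<open>?D\<close> bounds the distance to the truth by the two gradient norms.\<close>
  let ?D = "W t - ws"
  obtain u where u: "u \<in> cball ws r"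
    "(emp n dat (gr (W t)) - emp n dat (gr ws)) \<bullet> ?D = emp n dat (hs 1 u ?D ?D)"
    using gradient_mean_value[OF ws Wb] by metis
  have "l / 2 * (norm ?D)\<^sup>2 \<le> norm (emp n dat (gr (W t)) - emp n dat (gr ws)) * norm ?D"
    using conv[OF u(1), of ?D] norm_cauchy_schwarz[of "emp n dat (gr (W t)) - emp n dat (gr ws)" ?D] u(2) by linarith
  then have "l / 2 * norm ?D \<le> norm (emp n dat (gr (W t)) - emp n dat (gr ws))"
    by (cases "?D = 0") (auto simp: power2_eq_square)
  then show "l / 2 * norm ?D \<le> norm (emp n dat (gr (W t))) + norm (emp n dat (gr ws))"
    using norm_triangle_ineq4 order_trans by blast
qed

definition iterate :: "real \<Rightarrow> real \<Rightarrow> 't \<times> 'g \<Rightarrow> (nat \<Rightarrow> nat) \<Rightarrow> nat \<Rightarrow> 'w \<Rightarrow> 't \<times> 'g" where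
  "iterate \<eta>1 \<eta>2 w0 T n \<omega> = (agd_step (\<lambda>w. emp n (\<lambda>i. D i \<omega>) (gr w)) \<eta>1 \<eta>2 ^^ T n) w0"

text \<open>Consistency together with the influence function expansion. Here \<open>h\<close> is the
  inverse information applied to \<open>e\<close>, described by the equation it solves; the
  expansion appears as a sum because the influence of an observation is minus its score along
  \<open>h\<close>.\<close>

definition asym_linear :: "(nat \<Rightarrow> 'w \<Rightarrow> 't \<times> 'g) \<Rightarrow> bool" where
  "asym_linear W \<longleftrightarrow>
    (\<forall>\<epsilon> \<delta>. 0 < \<epsilon> \<longrightarrow> 0 < \<delta> \<longrightarrow> high_prob M \<delta> (\<lambda>n \<omega>. norm (W n \<omega> - ws) \<le> \<epsilon>)) \<and>
    (\<forall>e h \<epsilon> \<delta>. (\<forall>d. Hh d h = e \<bullet> d) \<longrightarrow> 0 < \<epsilon> \<longrightarrow> 0 < \<delta> \<longrightarrow>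
      high_prob M \<delta> (\<lambda>n \<omega>. \<bar>sqrt n * (e \<bullet> (W n \<omega> - ws)) + sqrt n * (emp n (\<lambda>i. D i \<omega>) (gr ws) \<bullet> h)\<bar> \<le> \<epsilon>))"

text \<open>\<open>b0\<close> and \<open>\<eta>0\<close> come from population constants and
  \<open>\<rho>\<close> from these and the step sizes; none depends on the schedule
  \<open>T\<close>.\<close>

theorem agd_asymptotics:
  assumes info_pos: "\<And>d. d \<noteq> 0 \<Longrightarrow> 0 < Hh d d"
  shows "\<exists>b0>0. \<exists>\<eta>0>0. \<forall>b w0 \<eta>1 \<eta>2. b < b0 \<and> norm (w0 - ws) \<le> b \<and> 0 < \<eta>1 \<and> \<eta>1 < \<eta>0 \<and> 0 < \<eta>2 \<and> \<eta>2 < \<eta>0 \<longrightarrow>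
    (\<exists>\<rho>. 0 < \<rho> \<and> \<rho> < 1 \<and> (\<forall>T. (\<lambda>n. real n * \<rho> ^ T n) \<longlonglongrightarrow> 0 \<longrightarrow> asym_linear (iterate \<eta>1 \<eta>2 w0 T)))"
proof -
  obtain l0 where l0: "0 < l0" "\<And>d. l0 * (norm d)\<^sup>2 \<le> Hh d d"
    using bilinear_coercive[OF bilinear_Hh] info_pos by blast
  define l where "l = min l0 Hb"
  have l: "0 < l" "l \<le> Hb" using l0 Hb_pos by (auto simp: l_def)
  have coer: "l * (norm d)\<^sup>2 \<le> Hh d d" for d
    using l0(2)[of d] mult_right_mono[of l l0 "(norm d)\<^sup>2"] by (simp add: l_def)
  \<comment> \<open>Radius 1 keeps the uniform bounds valid, and \<open>l / (4 * Hb)\<close> limits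
    the drift of the Hessian over the ball to \<open>l / 4\<close>.\<close>
  define r where "r = min 1 (l / (4 * Hb))"
  have r: "0 < r" "r \<le> 1" using l Hb_pos by (auto simp: r_def)
  have "r \<le> l / (4 * Hb)" by (simp add: r_def)
  then have r3: "Hb * r \<le> l / 4" using Hb_pos by (simp add: field_simps)
  define b0 where "b0 = r * l / (16 * Hb)"
  \<comment> \<open>The first bound makes each half step a descent step; the second keeps a step
    along a gradient of norm at most \<open>2 * Cb^2\<close> shorter than
    \<open>r / 2\<close>.\<close>
  define \<eta>0 where "\<eta>0 = min (1 / Hb) (r / (4 * Cb\<^sup>2))"
  have Cb: "0 < Cb\<^sup>2" using Cb_ge_1 by simp
  have b0: "0 < b0" using r l Hb_pos by (simp add: b0_def)
  have \<eta>0: "0 < \<eta>0" using r Hb_pos Cb by (simp add: \<eta>0_def)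
  have step: "\<eta> * Hb \<le> 1" "\<eta> * (2 * Cb\<^sup>2) \<le> r / 2" if "0 < \<eta>" "\<eta> < \<eta>0" for \<eta>
  proof -
    have "\<eta> \<le> 1 / Hb" "\<eta> \<le> r / (4 * Cb\<^sup>2)" using that by (auto simp: \<eta>0_def)
    then show "\<eta> * Hb \<le> 1" "\<eta> * (2 * Cb\<^sup>2) \<le> r / 2" using Hb_pos Cb by (auto simp: field_simps)
  qed
  show ?thesis
  proof (rule exI[of _ b0], rule conjI[OF b0], rule exI[of _ \<eta>0], rule conjI[OF \<eta>0], intro allI impI)
    fix b w0 \<eta>1 \<eta>2
    assume A: "b < b0 \<and> norm (w0 - ws) \<le> b \<and> 0 < \<eta>1 \<and> \<eta>1 < \<eta>0 \<and> 0 < \<eta>2 \<and> \<eta>2 < \<eta>0"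
    define \<rho> where "\<rho> = 1 - min \<eta>1 \<eta>2 * (l / 2) / 3"
    have m: "0 < min \<eta>1 \<eta>2 * l" "min \<eta>1 \<eta>2 * l \<le> 1"
      using A l step(1)[of \<eta>1] mult_mono[of "min \<eta>1 \<eta>2" \<eta>1 l Hb] by auto
    have \<rho>: "0 < \<rho>" "\<rho> < 1" using m by (auto simp: \<rho>_def)
    define C where "C = (2 * Cb\<^sup>2)\<^sup>2 / (l / 2 * \<eta>1)"
    have C: "0 \<le> C" using A l by (simp add: C_def)
    let ?it = "\<lambda>T n \<omega>. iterate \<eta>1 \<eta>2 w0 T n \<omega>"
    define good where "good T q s k n \<omega> \<longleftrightarrow>
        (\<forall>d e. \<bar>emp n (\<lambda>i. D i \<omega>) (hs 1 ws d e) - Hh d e\<bar> \<le> q * norm d * norm e) \<and>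
        ?it T n \<omega> \<in> cball ws r \<and>
        sqrt n * norm (emp n (\<lambda>i. D i \<omega>) (gr (?it T n \<omega>))) \<le> s \<and>
        sqrt n * norm (?it T n \<omega> - ws) \<le> k" for T q s k n \<omega>
    \<comment> \<open>The order of the quantifiers matters: \<open>k\<close> bounds the scaled error
      of the iterate and is fixed first, so that the Hessian error \<open>q\<close> and the scaled
      gradient \<open>s\<close> can be chosen small relative to it.\<close>
    have main: "\<exists>k>0. \<forall>q>0. \<forall>s>0. high_prob M \<delta> (good T q s k)"
      if T: "(\<lambda>n. real n * \<rho> ^ T n) \<longlonglongrightarrow> 0" and \<delta>: "0 < \<delta>" for T \<delta>
    proof -
      obtain k where k: "0 < k" "high_prob M (\<delta> / 2) (\<lambda>n \<omega>. sqrt n * norm (emp n (\<lambda>i. D i \<omega>) (gr ws)) \<le> k)"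
        using score_tight[of "\<delta> / 2"] \<delta> by auto
      show ?thesis
      proof (intro exI[of _ "(1 + k) * 2 / l"] conjI allI impI)
        show "0 < (1 + k) * 2 / l" using k l by simp
        fix q s :: real assume q: "0 < q" and s: "0 < s"
        define q' where "q' = min q (l / 4)"
        have q': "0 < q'" "q' \<le> q" "q' \<le> l / 4" using q l by (auto simp: q'_def)
        have H: "high_prob M \<delta> (\<lambda>n \<omega>. sqrt n * norm (emp n (\<lambda>i. D i \<omega>) (gr ws)) \<le> k \<and>
            (\<forall>d e. \<bar>emp n (\<lambda>i. D i \<omega>) (hs 1 ws d e) - Hh d e\<bar> \<le> q' * norm d * norm e))"
          by (rule high_prob_conj[OF k(2) info_law[of 1 "\<delta> / 2" q']]) (use \<delta> q' in auto)
        have "(\<lambda>n. C * (real n * \<rho> ^ T n)) \<longlonglongrightarrow> C * 0" by (intro tendsto_mult_left T)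
        \<comment> \<open>\<open>s\<close> is the accuracy requested; the cap at 1 keeps the error
          bound \<open>(1 + k) * 2 / l\<close> independent of it.\<close>
        then have "\<forall>\<^sub>F n in sequentially. C * (real n * \<rho> ^ T n) < (min s 1)\<^sup>2"
          using s by (intro order_tendstoD) auto
        moreover have "\<forall>\<^sub>F n in sequentially. k * 64 / (l * r) + 1 \<le> sqrt n"
          using sqrt_n_at_top by (auto simp: filterlim_at_top)
        ultimately have ev: "\<forall>\<^sub>F n in sequentially. C * (real n * \<rho> ^ T n) < (min s 1)\<^sup>2 \<and> k * 64 / (l * r) + 1 \<le> sqrt n"
          by (rule eventually_conj)
        show "high_prob M \<delta> (good T q s ((1 + k) * 2 / l))"
        proof (rule high_prob_eventually[OF H ev])
          fix n \<omega>
          let ?d = "\<lambda>i. D i \<omega>"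
          assume n: "C * (real n * \<rho> ^ T n) < (min s 1)\<^sup>2 \<and> k * 64 / (l * r) + 1 \<le> sqrt n"
            and h: "sqrt n * norm (emp n ?d (gr ws)) \<le> k \<and>
              (\<forall>d e. \<bar>emp n ?d (hs 1 ws d e) - Hh d e\<bar> \<le> q' * norm d * norm e)"
          have weaken: "\<bar>emp n ?d (hs 1 ws d e) - Hh d e\<bar> \<le> q'' * norm d * norm e" if "q' \<le> q''" for q'' d e
          proof -
            have "q' * (norm d * norm e) \<le> q'' * (norm d * norm e)"
              using that by (intro mult_right_mono) auto
            moreover have "\<bar>emp n ?d (hs 1 ws d e) - Hh d e\<bar> \<le> q' * (norm d * norm e)"
              using h unfolding mult.assoc by blast
            ultimately show ?thesis unfolding mult.assoc by linarith
          qed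
          have E2: "norm (emp n ?d (gr ws)) \<le> l * r / 64"
          proof -
            have "k * 64 / (l * r) * norm (emp n ?d (gr ws)) \<le> sqrt n * norm (emp n ?d (gr ws))"
              using n by (intro mult_right_mono) auto
            then have "k * 64 / (l * r) * norm (emp n ?d (gr ws)) \<le> k" using h by linarith
            then show ?thesis using k l r by (simp add: field_simps)
          qed
          have st: "0 < \<eta>1" "\<eta>1 * Hb \<le> 1" "\<eta>1 * (2 * Cb\<^sup>2) \<le> r / 2" "0 < \<eta>2" "\<eta>2 * Hb \<le> 1" "\<eta>2 * (2 * Cb\<^sup>2) \<le> r / 2"
            using A step by auto
          have bb: "norm (w0 - ws) \<le> b" "b \<le> r * l / (16 * Hb)" using A by (auto simp: b0_def)
          note it = agd_good_event[OF l coer r r3 weaken[OF q'(3)] E2 bb st, of "T n", folded iterate_def[of \<eta>1 \<eta>2 w0 T n \<omega>]]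
          let ?g = "norm (emp n ?d (gr (?it T n \<omega>)))"
          have "(sqrt n * ?g)\<^sup>2 = real n * ?g\<^sup>2" by (simp add: power_mult_distrib)
          also have "\<dots> \<le> real n * (C * \<rho> ^ T n)"
            using it(2) by (intro mult_left_mono) (auto simp: C_def \<rho>_def)
          also have "\<dots> \<le> (min s 1)\<^sup>2" using n by (simp add: mult_ac)
          finally have g: "sqrt n * ?g \<le> min s 1" by (rule power2_le_imp_le) (use s in auto)
          have "sqrt n * (l / 2 * norm (?it T n \<omega> - ws)) \<le> sqrt n * (?g + norm (emp n ?d (gr ws)))"
            by (intro mult_left_mono it(3)) auto
          also have "\<dots> \<le> 1 + k" using g h by (simp add: algebra_simps)
          finally have "sqrt n * norm (?it T n \<omega> - ws) \<le> (1 + k) * 2 / l"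
            using l by (simp add: field_simps)
          moreover have "sqrt n * ?g \<le> s" using g by linarith
          ultimately show "good T q s ((1 + k) * 2 / l) n \<omega>"
            unfolding good_def using weaken[OF q'(2)] it(1) by blast
        qed
      qed
    qed
    show "\<exists>\<rho>. 0 < \<rho> \<and> \<rho> < 1 \<and> (\<forall>T. (\<lambda>n. real n * \<rho> ^ T n) \<longlonglongrightarrow> 0 \<longrightarrow> asym_linear (?it T))"
      unfolding asym_linear_def
    proof (rule exI[of _ \<rho>], intro conjI \<rho> allI impI)
      fix T and \<epsilon> \<delta> :: real
      assume T: "(\<lambda>n. real n * \<rho> ^ T n) \<longlonglongrightarrow> 0" and \<epsilon>: "0 < \<epsilon>" and \<delta>: "0 < \<delta>"
      obtain k where k: "0 < k" and H: "high_prob M \<delta> (good T 1 1 k)"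
        using main[OF T \<delta>] zero_less_one by blast
      have ev: "\<forall>\<^sub>F n in sequentially. k / \<epsilon> + 1 \<le> sqrt n"
        using sqrt_n_at_top by (auto simp: filterlim_at_top)
      show "high_prob M \<delta> (\<lambda>n \<omega>. norm (?it T n \<omega> - ws) \<le> \<epsilon>)"
      proof (rule high_prob_eventually[OF H ev], unfold good_def, elim conjE)
        fix n \<omega> assume n: "k / \<epsilon> + 1 \<le> sqrt n" and le: "sqrt n * norm (?it T n \<omega> - ws) \<le> k"
        have "k / \<epsilon> * norm (?it T n \<omega> - ws) \<le> sqrt n * norm (?it T n \<omega> - ws)"
          using n by (intro mult_right_mono) auto
        then have "k / \<epsilon> * norm (?it T n \<omega> - ws) \<le> k" using le by linarith
        then show "norm (?it T n \<omega> - ws) \<le> \<epsilon>" using k \<epsilon> by (simp add: field_simps)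
      qed
    next
      fix T e h and \<epsilon> \<delta> :: real
      assume T: "(\<lambda>n. real n * \<rho> ^ T n) \<longlonglongrightarrow> 0" and h: "\<forall>d. Hh d h = e \<bullet> d"
        and \<epsilon>: "0 < \<epsilon>" and \<delta>: "0 < \<delta>"
      obtain k where k: "0 < k" and main': "\<And>q s. 0 < q \<Longrightarrow> 0 < s \<Longrightarrow> high_prob M \<delta> (good T q s k)"
        using main[OF T \<delta>] by blast
      define c where "c = norm h + 1"
      have c: "0 < c" "norm h \<le> c" by (auto simp: c_def add_nonneg_pos)
      \<comment> \<open>With these choices the Hessian error contributes
        \<open>k * (2 * q * c) = 2 * \<epsilon> / 3\<close> and the remaining gradient
        \<open>s * c = \<epsilon> / 3\<close>.\<close>
      define q where "q = \<epsilon> / (3 * k * c)"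
      define s where "s = \<epsilon> / (3 * c)"
      have qs: "0 < q" "0 < s" using \<epsilon> k c by (auto simp: q_def s_def)
      have ev: "\<forall>\<^sub>F n in sequentially. Hb * k / q + 1 \<le> sqrt n"
        using sqrt_n_at_top by (auto simp: filterlim_at_top)
      show "high_prob M \<delta> (\<lambda>n \<omega>. \<bar>sqrt n * (e \<bullet> (?it T n \<omega> - ws)) + sqrt n * (emp n (\<lambda>i. D i \<omega>) (gr ws) \<bullet> h)\<bar> \<le> \<epsilon>)"
      proof (rule high_prob_eventually[OF main'[OF qs] ev], unfold good_def, elim conjE)
        fix n \<omega>
        let ?d = "\<lambda>i. D i \<omega>" and ?D = "?it T n \<omega> - ws" and ?W = "?it T n \<omega>"
        assume n: "Hb * k / q + 1 \<le> sqrt n"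
          and E1: "\<forall>d e. \<bar>emp n ?d (hs 1 ws d e) - Hh d e\<bar> \<le> q * norm d * norm e"
          and W: "?W \<in> cball ws r" and g: "sqrt n * norm (emp n ?d (gr ?W)) \<le> s" and D: "sqrt n * norm ?D \<le> k"
        \<comment> \<open>\<open>u\<close> is no farther from \<open>ws\<close> than the iterate is,
          so the drift of the Hessian at \<open>u\<close> is at most \<open>Hb * norm ?D\<close>,
          which drops below \<open>q\<close> for large \<open>n\<close>.\<close>
        obtain u where u: "u \<in> cball ws r"
          "(emp n ?d (gr ?W) - emp n ?d (gr ws)) \<bullet> h = emp n ?d (hs 1 u ?D h)" "norm (u - ws) \<le> norm ?D"
          by (rule gradient_mean_value[OF _ W, of ws]) (use r in auto)
        have "Hb * k / q * norm ?D \<le> sqrt n * norm ?D" using n by (intro mult_right_mono) auto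
        then have "Hb * k / q * norm ?D \<le> k" using D by linarith
        then have HD: "Hb * norm ?D \<le> q" using k qs by (simp add: field_simps)
        have "Hb * norm (u - ws) \<le> Hb * norm ?D" using u(3) Hb_pos by (intro mult_left_mono) auto
        then have "(Hb * norm (u - ws) + q) * (norm ?D * norm h) \<le> (2 * q) * (norm ?D * norm h)"
          using HD by (intro mult_right_mono) auto
        moreover have "\<bar>emp n ?d (hs 1 u ?D h) - Hh ?D h\<bar> \<le> (Hb * norm (u - ws) + q) * norm ?D * norm h"
          by (rule emp_hs_near) (use E1 u r in auto)
        ultimately have "sqrt n * \<bar>emp n ?d (hs 1 u ?D h) - Hh ?D h\<bar> \<le> sqrt n * ((2 * q) * (norm ?D * norm h))"
          by (intro mult_left_mono) (auto simp: mult.assoc)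
        also have "\<dots> = (sqrt n * norm ?D) * (2 * q * norm h)" by (simp add: mult_ac)
        also have "\<dots> \<le> k * (2 * q * c)" using D qs c k by (intro mult_mono) auto
        also have "\<dots> = 2 * \<epsilon> / 3" using k c by (simp add: q_def)
        finally have 1: "\<bar>sqrt n * (emp n ?d (hs 1 u ?D h) - Hh ?D h)\<bar> \<le> 2 * \<epsilon> / 3" by (simp add: abs_mult)
        have "\<bar>sqrt n * (emp n ?d (gr ?W) \<bullet> h)\<bar> \<le> sqrt n * (norm (emp n ?d (gr ?W)) * norm h)"
          using Cauchy_Schwarz_ineq2[of "emp n ?d (gr ?W)" h] by (simp add: abs_mult mult_left_mono)
        also have "\<dots> = (sqrt n * norm (emp n ?d (gr ?W))) * norm h" by simp
        also have "\<dots> \<le> s * c" using g c qs by (intro mult_mono) auto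
        also have "\<dots> = \<epsilon> / 3" using c by (simp add: s_def)
        finally have 2: "\<bar>sqrt n * (emp n ?d (gr ?W) \<bullet> h)\<bar> \<le> \<epsilon> / 3" .
        have "sqrt n * (e \<bullet> ?D) + sqrt n * (emp n ?d (gr ws) \<bullet> h)
            = sqrt n * (emp n ?d (gr ?W) \<bullet> h) - sqrt n * (emp n ?d (hs 1 u ?D h) - Hh ?D h)"
          unfolding h[rule_format, of ?D] u(2)[symmetric] inner_diff_left by (simp add: right_diff_distrib)
        then show "\<bar>sqrt n * (e \<bullet> ?D) + sqrt n * (emp n ?d (gr ws) \<bullet> h)\<bar> \<le> \<epsilon>"
          using 1 2 by linarith
      qed
    qed
  qed
qed

end

section \<open>Matrices\<close>

lemma matrix_inv_right: "det A \<noteq> 0 \<Longrightarrow> A ** matrix_inv A = mat 1" for A :: "real^'n^'n"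
  unfolding invertible_det_nz[symmetric] invertible_def matrix_inv_def
  by (metis (mono_tags, lifting) someI_ex)

text \<open>Exhibits the entries of the inverse as quotients of polynomials in the entries of
  \<open>A\<close>, from which continuity on the regular matrices can be read off.\<close>

lemma matrix_inv_cramer:
  fixes A :: "real^'n^'n"
  assumes "det A \<noteq> 0"
  shows "matrix_inv A = (\<chi> k l. det (\<chi> i j. if j = k then axis l 1 $ i else A $ i $ j) / det A)"
proof -
  have "A *v (matrix_inv A *v axis l 1) = axis l 1" for l
    by (simp add: matrix_vector_mul_assoc matrix_inv_right[OF assms])
  then have "matrix_inv A *v axis l 1 = (\<chi> k. det (\<chi> i j. if j = k then axis l 1 $ i else A $ i $ j) / det A)" for l
    using cramer[OF assms] by blast
  then have "(matrix_inv A *v axis l 1) $ k = det (\<chi> i j. if j = k then axis l 1 $ i else A $ i $ j) / det A" for k l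
    by simp
  moreover have "(matrix_inv A *v axis l 1) $ k = matrix_inv A $ k $ l" for k l
    by (simp add: matrix_vector_mult_def axis_def if_distrib cong: if_cong)
  ultimately show ?thesis by (simp add: vec_eq_iff)
qed

lemma continuous_on_det [continuous_intros]:
  fixes f :: "'a::topological_space \<Rightarrow> real^'n^'n"
  assumes "continuous_on S f"
  shows "continuous_on S (\<lambda>x. det (f x))"
  unfolding det_def using assms by (intro continuous_intros)

lemma continuous_on_matrix_mult [continuous_intros]:
  fixes f :: "'a::topological_space \<Rightarrow> real^'n^'m" and g :: "'a \<Rightarrow> real^'k^'n"
  assumes "continuous_on S f" "continuous_on S g"
  shows "continuous_on S (\<lambda>x. f x ** g x)"
  unfolding matrix_matrix_mult_def using assms by (intro continuous_intros)

lemma continuous_on_transpose [continuous_intros]: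
  fixes f :: "'a::topological_space \<Rightarrow> real^'n^'m"
  assumes "continuous_on S f"
  shows "continuous_on S (\<lambda>x. transpose (f x))"
  unfolding transpose_def using assms by (intro continuous_intros)

lemma continuous_on_matrix_inv_regular: "continuous_on {A :: real^'n^'n. det A \<noteq> 0} matrix_inv"
proof -
  have "continuous_on {A :: real^'n^'n. det A \<noteq> 0}
     (\<lambda>A. \<chi> k l. det (\<chi> i j. if j = k then axis l 1 $ i else A $ i $ j) / det A)"
  proof (intro continuous_intros)
    fix k l i j :: 'n
    show "continuous_on {A :: real^'n^'n. det A \<noteq> 0} (\<lambda>A. if j = k then axis l 1 $ i else A $ i $ j)"
      by (cases "j = k") (auto intro!: continuous_intros)
  qed auto
  then show ?thesis by (subst continuous_on_cong[OF refl matrix_inv_cramer]) auto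
qed

lemma continuous_on_matrix_inv [continuous_intros]:
  fixes f :: "'a::topological_space \<Rightarrow> real^'n^'n"
  assumes "continuous_on S f" "\<And>x. x \<in> S \<Longrightarrow> det (f x) \<noteq> 0"
  shows "continuous_on S (\<lambda>x. matrix_inv (f x))"
  by (rule continuous_on_compose2[OF continuous_on_matrix_inv_regular assms(1)]) (use assms(2) in auto)

lemma open_det_nz: "open {A :: real^'n^'n. det A \<noteq> 0}"
  by (intro open_Collect_neq continuous_intros)

text \<open>On singular matrices the choice in \<open>matrix_inv\<close> is over an empty predicate,
  so its value there is one fixed matrix: the map is continuous on an open set and constant off it.
  This makes the studentised ratio a random variable even on samples whose plug-in matrices are
  singular.\<close>

lemma borel_measurable_matrix_inv [measurable]:
  "(matrix_inv :: real^'n^'n \<Rightarrow> _) \<in> borel_measurable borel"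
proof -
  have singular: "matrix_inv A = (SOME B. False)" if "det A = 0" for A :: "real^'n^'n"
    unfolding matrix_inv_def by (rule arg_cong[of _ _ Eps]) (use that invertible_det_nz[of A] in \<open>auto simp: invertible_def\<close>)
  have "(\<lambda>A :: real^'n^'n. if A \<in> {A. det A \<noteq> 0} then matrix_inv A else (SOME B. False)) \<in> borel_measurable borel"
    by (rule borel_measurable_continuous_on_if)
      (auto intro!: continuous_on_matrix_inv_regular borel_open open_det_nz)
  also have "(\<lambda>A :: real^'n^'n. if A \<in> {A. det A \<noteq> 0} then matrix_inv A else (SOME B. False)) = matrix_inv"
    using singular by auto
  finally show ?thesis .
qed

lemma borel_measurable_matrix_mult [measurable (raw)]:
  fixes f :: "'a \<Rightarrow> real^'n^'m" and g :: "'a \<Rightarrow> real^'k^'n"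
  assumes "f \<in> borel_measurable M" "g \<in> borel_measurable M"
  shows "(\<lambda>x. f x ** g x) \<in> borel_measurable M"
  by (rule borel_measurable_continuous_Pair[OF assms]) (intro continuous_intros)

lemma borel_measurable_transpose [measurable (raw)]:
  fixes f :: "'a \<Rightarrow> real^'n^'m"
  assumes "f \<in> borel_measurable M"
  shows "(\<lambda>x. transpose (f x)) \<in> borel_measurable M"
  by (rule borel_measurable_continuous_on[OF _ assms]) (intro continuous_intros)

section \<open>Matrices through their entries and bilinear forms\<close>

lemma borel_measurable_matrixI:
  fixes f :: "'a \<Rightarrow> real^'n^'m"
  assumes "\<And>i j. (\<lambda>x. f x $ i $ j) \<in> borel_measurable M"
  shows "f \<in> borel_measurable M"
  by (subst borel_measurable_euclidean_space) (use assms in \<open>auto simp: Basis_vec_def inner_axis\<close>)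

lemma borel_measurable_matrix_entry:
  fixes f :: "'a \<Rightarrow> real^'n^'m"
  assumes "f \<in> borel_measurable M"
  shows "(\<lambda>x. f x $ i $ j) \<in> borel_measurable M"
  by (rule borel_measurable_continuous_on[OF _ assms]) (intro continuous_intros)

lemma integrable_matrixI:
  fixes f :: "'a \<Rightarrow> real^'n^'m"
  assumes "\<And>i j. integrable M (\<lambda>x. f x $ i $ j)"
  shows "integrable M f"
proof -
  have "integrable M (\<lambda>x. \<Sum>b\<in>Basis. (f x \<bullet> b) *\<^sub>R b)"
    using assms by (intro Bochner_Integration.integrable_sum integrable_scaleR_left) (auto simp: Basis_vec_def inner_axis)
  then show ?thesis by (simp add: euclidean_representation)
qed

lemma integral_matrix_form:
  fixes f :: "'a \<Rightarrow> real^'n^'m"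
  assumes "integrable M f"
  shows "a \<bullet> (integral\<^sup>L M f *v b) = (\<integral>x. a \<bullet> (f x *v b) \<partial>M)"
proof -
  have "linear (\<lambda>A :: real^'n^'m. a \<bullet> (A *v b))"
    by (rule linearI) (simp_all add: matrix_vector_mult_add_rdistrib inner_add_right scaleR_matrix_vector_assoc[symmetric])
  then have "bounded_linear (\<lambda>A :: real^'n^'m. a \<bullet> (A *v b))" by (simp add: linear_conv_bounded_linear)
  from integral_bounded_linear[OF this assms] show ?thesis by simp
qed

lemma emp_matrix_entry:
  fixes f :: "'o \<Rightarrow> real^'n^'m"
  shows "emp n dat f $ i $ j = emp n dat (\<lambda>ob. f ob $ i $ j)"
  by (simp add: emp_def sum_component)

lemma matrix_form_entry: "A $ i $ j = axis i 1 \<bullet> (A *v axis j 1)" for A :: "real^'n^'m"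
  unfolding inner_axis' by (simp add: matrix_vector_mult_def axis_def if_distrib cong: if_cong)

lemma outer_form: "a \<bullet> (outer u v *v b) = (a \<bullet> u) * (v \<bullet> b)"
proof -
  have "outer u v *v b = (v \<bullet> b) *\<^sub>R u"
    by (simp add: vec_eq_iff matrix_vector_mult_def outer_def inner_vec_def sum_distrib_left mult_ac)
  then show ?thesis by simp
qed

lemma inner_transpose_mult: "a \<bullet> (transpose A *v b) = b \<bullet> (A *v a)" for A :: "real^'n^'m"
  by (metis dot_lmul_matrix inner_commute vector_transpose_matrix transpose_transpose)

lemma det_nz_if_pos:
  fixes A :: "real^'n^'n"
  assumes "\<And>v. v \<noteq> 0 \<Longrightarrow> 0 < v \<bullet> (A *v v)"
  shows "det A \<noteq> 0"
proof -
  have "\<exists>B. B ** A = mat 1"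
    unfolding matrix_left_invertible_ker using assms by (metis inner_zero_right less_irrefl)
  then show ?thesis using invertible_left_inverse invertible_det_nz by blast
qed

lemma norm_matrix_le:
  fixes A :: "real^'n^'m"
  assumes "\<And>i j. \<bar>A $ i $ j\<bar> \<le> q"
  shows "norm A \<le> real (CARD('m) * CARD('n)) * q"
proof -
  have "norm (A $ i) \<le> real CARD('n) * q" for i
    using order_trans[OF norm_le_l1_cart sum_mono[of UNIV "\<lambda>j. \<bar>A $ i $ j\<bar>" "\<lambda>_. q"]] assms by simp
  then have "(\<Sum>i\<in>UNIV. norm (A $ i)) \<le> (\<Sum>i\<in>(UNIV :: 'm set). real CARD('n) * q)" by (intro sum_mono)
  moreover have "norm A \<le> (\<Sum>i\<in>UNIV. norm (A $ i))"
    unfolding norm_vec_def by (rule L2_set_le_sum) simp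
  ultimately show ?thesis by simp
qed

lemma spec_norm_le:
  fixes A :: "real^'n^'m"
  shows "spec_norm A \<le> real (CARD('m) * CARD('n)) * norm A" and "0 \<le> spec_norm A"
proof -
  have "\<bar>A $ i $ j\<bar> \<le> norm A" for i j
    using component_le_norm_cart[of "A $ i" j] Finite_Cartesian_Product.norm_nth_le[of A i] by linarith
  from onorm_le_matrix_component[OF this] show "spec_norm A \<le> real (CARD('m) * CARD('n)) * norm A"
    by (simp add: spec_norm_def)
  show "0 \<le> spec_norm A" unfolding spec_norm_def by (intro onorm_pos_le matrix_vector_mul_bounded_linear)
qed

text \<open>The lower right block of the inverse of the symmetric block matrix with diagonal blocks
  \<open>A\<close>, \<open>B\<close> and lower left block \<open>C\<close>, when \<open>A\<close>
  and \<open>B\<close> are symmetric and the inverses exist.\<close>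

definition schur_inv :: "real^'n^'n \<Rightarrow> real^'m^'m \<Rightarrow> real^'n^'m \<Rightarrow> real^'m^'m" where
  "schur_inv A B C = matrix_inv (B - C ** matrix_inv A ** transpose C)"

lemma schur_inv_continuous:
  fixes A :: "real^'n^'n" and B :: "real^'m^'m" and C :: "real^'n^'m"
  assumes A: "det A \<noteq> 0" and S: "det (B - C ** matrix_inv A ** transpose C) \<noteq> 0" and \<epsilon>: "0 < \<epsilon>"
  obtains q where "0 < q" "\<And>A' B' C'. (\<And>i j. \<bar>(A' - A) $ i $ j\<bar> \<le> q) \<Longrightarrow> (\<And>i j. \<bar>(B' - B) $ i $ j\<bar> \<le> q) \<Longrightarrow>
      (\<And>i j. \<bar>(C' - C) $ i $ j\<bar> \<le> q) \<Longrightarrow> norm (schur_inv A' B' C' - schur_inv A B C) \<le> \<epsilon>"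
proof -
  let ?U = "{A :: real^'n^'n. det A \<noteq> 0} \<times> (UNIV :: ((real^'m^'m) \<times> (real^'n^'m)) set)"
  let ?s = "\<lambda>(A, B, C). B - C ** matrix_inv A ** transpose C"
  have U: "open ?U" by (intro open_Times open_det_nz open_UNIV)
  have s: "continuous_on ?U ?s"
    unfolding case_prod_unfold by (intro continuous_intros) auto
  \<comment> \<open>The triples for which both inversions are applied to regular matrices. The set
    is open, so continuity on it is continuity at the point \<open>(A, B, C)\<close>.\<close>
  let ?V = "?U \<inter> ?s -` {A. det A \<noteq> 0}"
  have V: "open ?V" by (rule continuous_open_preimage[OF s U open_det_nz])
  have "continuous_on ?V (\<lambda>x. matrix_inv (?s x))"
    by (intro continuous_intros continuous_on_subset[OF s]) auto
  then have "isCont (\<lambda>x. matrix_inv (?s x)) (A, B, C)"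
    by (rule bspec[OF iffD1[OF continuous_on_eq_continuous_at[OF V]]]) (use A S in simp)
  then have "\<exists>d>0. \<forall>x. dist x (A, B, C) < d \<longrightarrow> dist (matrix_inv (?s x)) (matrix_inv (?s (A, B, C))) < \<epsilon>"
    using \<epsilon> unfolding continuous_at_eps_delta by blast
  then obtain d where d: "0 < d" "\<And>A' B' C'. dist (A', B', C') (A, B, C) < d \<Longrightarrow>
      dist (schur_inv A' B' C') (schur_inv A B C) < \<epsilon>"
    unfolding schur_inv_def by auto
  \<comment> \<open>The total number of entries in the three blocks; an entrywise error of
    \<open>d / (2 * c)\<close> amounts to at most \<open>d / 2\<close> in the product norm.\<close>
  define c where "c = real (CARD('n) * CARD('n)) + real (CARD('m) * CARD('m)) + real (CARD('m) * CARD('n))"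
  have c: "0 < c" by (simp add: c_def add_pos_pos)
  show ?thesis
  proof (rule that[of "d / (2 * c)"])
    show "0 < d / (2 * c)" using d c by simp
    fix A' B' C'
    assume q: "\<And>i j. \<bar>(A' - A) $ i $ j\<bar> \<le> d / (2 * c)" "\<And>i j. \<bar>(B' - B) $ i $ j\<bar> \<le> d / (2 * c)"
      "\<And>i j. \<bar>(C' - C) $ i $ j\<bar> \<le> d / (2 * c)"
    have "dist (A', B', C') (A, B, C) \<le> norm (A' - A) + (norm (B' - B) + norm (C' - C))"
      using norm_Pair_le[of "A' - A" "(B' - B, C' - C)"] norm_Pair_le[of "B' - B" "C' - C"]
      by (simp add: dist_norm)
    also have "\<dots> \<le> c * (d / (2 * c))"
      using norm_matrix_le[of "A' - A", OF q(1)] norm_matrix_le[of "B' - B", OF q(2)] norm_matrix_le[of "C' - C", OF q(3)]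
      unfolding c_def distrib_right by linarith
    also have "\<dots> < d" using c d by simp
    finally have "dist (schur_inv A' B' C') (schur_inv A B C) < \<epsilon>" by (rule d(2))
    then show "norm (schur_inv A' B' C' - schur_inv A B C) \<le> \<epsilon>" by (simp add: dist_norm)
  qed
qed

section \<open>Agreement of \<open>grad\<close> with the blocks of \<open>gr\<close>\<close>

lemma grad_eqI:
  assumes "GDERIV f x :> D" shows "grad f x = D"
  unfolding grad_def
proof (rule the_equality)
  show "GDERIV f x :> D" by (rule assms)
  fix D' assume "GDERIV f x :> D'"
  then have "(\<lambda>h. h \<bullet> D') = (\<lambda>h. h \<bullet> D)"
    using assms unfolding gderiv_def by (rule has_derivative_unique)
  then have "(D' - D) \<bullet> D' = (D' - D) \<bullet> D" by meson
  then have "(D' - D) \<bullet> (D' - D) = 0" by (simp add: inner_diff_right)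
  then show "D' = D" by simp
qed

lemma GDERIV_emp:
  fixes f :: "'a::real_inner \<Rightarrow> 'o \<Rightarrow> real"
  assumes "\<And>ob. GDERIV (\<lambda>x. f x ob) x :> g ob"
  shows "GDERIV (\<lambda>x. emp n dat (f x)) x :> emp n dat g"
  unfolding gderiv_def emp_def
  by (rule has_derivative_eq_rhs[OF has_derivative_scaleR_right[OF has_derivative_sum]])
    (use assms in \<open>auto simp: gderiv_def inner_sum_right\<close>)

context logit_features
begin

lemma grad_emp_ell_fst:
  "grad (\<lambda>\<theta>. emp n dat (ell (\<theta>, \<gamma>))) \<theta> = fst (emp n dat (gr (\<theta>, \<gamma>)))"
proof -
  have ix: "GDERIV (\<lambda>\<theta>. ix (\<theta>, \<gamma>) ob) \<theta> :> sg (\<theta>, \<gamma>) ob *\<^sub>R z ob" for ob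
    unfolding gderiv_def ix_def sg_def lin_def by (auto intro!: derivative_eq_intros)
  have "GDERIV (\<lambda>\<theta>. ell (\<theta>, \<gamma>) ob) \<theta> :> fst (gr (\<theta>, \<gamma>) ob)" for ob
    using GDERIV_DERIV_compose[OF ix DERIV_logit_loss[of "y ob"], of ob]
    by (simp add: ell_def gr_def res_def)
  from grad_eqI[OF GDERIV_emp[OF this]] show ?thesis
    by (simp add: emp_def fst_sum)
qed

lemma grad_emp_ell_snd:
  "grad (\<lambda>\<gamma>. emp n dat (ell (\<theta>, \<gamma>))) \<gamma> = snd (emp n dat (gr (\<theta>, \<gamma>)))"
proof -
  have ix: "GDERIV (\<lambda>\<gamma>. ix (\<theta>, \<gamma>) ob) \<gamma> :> lin (\<theta>, \<gamma>) ob *\<^sub>R p ob" for ob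
    unfolding gderiv_def ix_def sg_def lin_def by (auto intro!: derivative_eq_intros)
  have "GDERIV (\<lambda>\<gamma>. ell (\<theta>, \<gamma>) ob) \<gamma> :> snd (gr (\<theta>, \<gamma>) ob)" for ob
    using GDERIV_DERIV_compose[OF ix DERIV_logit_loss[of "y ob"], of ob]
    by (simp add: ell_def gr_def res_def)
  from grad_eqI[OF GDERIV_emp[OF this]] show ?thesis
    by (simp add: emp_def snd_sum)
qed

end

text \<open>The weights \<open>g\<close> and \<open>h\<close> define two measures whose images under
  \<open>X\<close> agree on every event, so they integrate every function of \<open>X\<close> alike.
  With the label and its success probability as weights, this lifts the model from events to
  functions of the covariates.\<close>

lemma (in prob_space) weighted_integral_eq:
  fixes g h :: "'a \<Rightarrow> real"
  assumes [measurable]: "X \<in> measurable M C" "f \<in> borel_measurable C"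
    and g [measurable]: "g \<in> borel_measurable M" "\<And>\<omega>. 0 \<le> g \<omega>" "\<And>\<omega>. g \<omega> \<le> 1"
    and h [measurable]: "h \<in> borel_measurable M" "\<And>\<omega>. 0 \<le> h \<omega>" "\<And>\<omega>. h \<omega> \<le> 1"
    and eq: "\<And>A. A \<in> sets C \<Longrightarrow> (\<integral>\<omega>. indicator A (X \<omega>) * g \<omega> \<partial>M) = (\<integral>\<omega>. indicator A (X \<omega>) * h \<omega> \<partial>M)"
  shows "(\<integral>\<omega>. g \<omega> * f (X \<omega>) \<partial>M) = (\<integral>\<omega>. h \<omega> * (f (X \<omega>) :: real) \<partial>M)"
proof -
  have em: "emeasure (distr (density M (\<lambda>\<omega>. ennreal (k \<omega>))) C X) A = ennreal (\<integral>\<omega>. indicator A (X \<omega>) * k \<omega> \<partial>M)"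
    if A [measurable]: "A \<in> sets C" and k [measurable]: "k \<in> borel_measurable M" "\<And>\<omega>. 0 \<le> k \<omega>" "\<And>\<omega>. k \<omega> \<le> 1"
    for A and k :: "'a \<Rightarrow> real"
  proof -
    have "integrable M (\<lambda>\<omega>. indicator A (X \<omega>) * k \<omega>)"
      by (rule integrable_const_bound[of _ 1]) (use k in \<open>auto simp: indicator_def\<close>)
    have "emeasure (distr (density M (\<lambda>\<omega>. ennreal (k \<omega>))) C X) A = emeasure (density M (\<lambda>\<omega>. ennreal (k \<omega>))) (X -` A \<inter> space M)"
      by (subst emeasure_distr) auto
    also have "\<dots> = (\<integral>\<^sup>+\<omega>. ennreal (k \<omega>) * indicator (X -` A \<inter> space M) \<omega> \<partial>M)"
      by (subst emeasure_density) auto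
    also have "\<dots> = (\<integral>\<^sup>+\<omega>. ennreal (indicator A (X \<omega>) * k \<omega>) \<partial>M)"
      by (intro nn_integral_cong) (auto simp: indicator_def)
    also have "\<dots> = ennreal (\<integral>\<omega>. indicator A (X \<omega>) * k \<omega> \<partial>M)"
      by (rule nn_integral_eq_integral) (use k \<open>integrable M _\<close> in auto)
    finally show ?thesis .
  qed
  have "distr (density M (\<lambda>\<omega>. ennreal (g \<omega>))) C X = distr (density M (\<lambda>\<omega>. ennreal (h \<omega>))) C X"
    by (rule measure_eqI) (simp_all add: em g h eq)
  then have "integral\<^sup>L (distr (density M (\<lambda>\<omega>. ennreal (g \<omega>))) C X) f = integral\<^sup>L (distr (density M (\<lambda>\<omega>. ennreal (h \<omega>))) C X) f"
    by simp
  then show ?thesis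
    using g h by (simp add: integral_distr integral_density)
qed

section \<open>Information matrices and studentization\<close>

locale logit_sample_cart = logit_sample p0 p z y K ws M N D cov
  for p0 :: "'o \<Rightarrow> real" and p :: "'o \<Rightarrow> real^'d2" and z :: "'o \<Rightarrow> real^'d1"
    and y K ws and M :: "'w measure" and N D and cov :: "'o \<Rightarrow> 'c"
begin

definition mtt :: "(real^'d1) \<times> (real^'d2) \<Rightarrow> 'o \<Rightarrow> real^'d1^'d1" where
  "mtt w ob = (logistic_deriv (ix w ob) * (sg w ob)\<^sup>2) *\<^sub>R outer (z ob) (z ob)"
definition mgg :: "(real^'d1) \<times> (real^'d2) \<Rightarrow> 'o \<Rightarrow> real^'d2^'d2" where
  "mgg w ob = (logistic_deriv (ix w ob) * (lin w ob)\<^sup>2) *\<^sub>R outer (p ob) (p ob)"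
text \<open>As in \<open>hs\<close>, the exact Hessian block is obtained for
  \<open>\<kappa> = 1\<close> and the plug-in block for \<open>\<kappa> = 0\<close>.\<close>

definition mgt :: "real \<Rightarrow> (real^'d1) \<times> (real^'d2) \<Rightarrow> 'o \<Rightarrow> real^'d1^'d2" where
  "mgt \<kappa> w ob = (logistic_deriv (ix w ob) * sg w ob * lin w ob + \<kappa> * res w ob) *\<^sub>R outer (p ob) (z ob)"

text \<open>All blocks are values of the one form \<open>hs\<close>; \<open>\<kappa>\<close> is felt
  only in the mixed block because \<open>d2ix\<close> vanishes within a block.\<close>

lemma block_forms:
  "a \<bullet> (mtt w ob *v a') = hs \<kappa> w (a, 0) (a', 0) ob"
  "c \<bullet> (mgt \<kappa> w ob *v a) = hs \<kappa> w (0, c) (a, 0) ob"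
  "c \<bullet> (mgg w ob *v c') = hs \<kappa> w (0, c) (0, c') ob"
  unfolding mtt_def mgt_def mgg_def scaleR_matrix_vector_assoc[symmetric] inner_scaleR_right outer_form
  by (simp_all add: hs_def dix_def d2ix_def power2_eq_square inner_commute algebra_simps)

lemma block_entries:
  "mtt w ob $ i $ j = hs 0 w (axis i 1, 0) (axis j 1, 0) ob"
  "mgt \<kappa> w ob $ k $ j = hs \<kappa> w (0, axis k 1) (axis j 1, 0) ob"
  "mgg w ob $ k $ l = hs 0 w (0, axis k 1) (0, axis l 1) ob"
  unfolding matrix_form_entry by (rule block_forms)+

definition Itt :: "real^'d1^'d1" where "Itt = Eobs M (D 0) (mtt ws)"
definition Igg :: "real^'d2^'d2" where "Igg = Eobs M (D 0) (mgg ws)"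
definition Igt :: "real^'d1^'d2" where "Igt = Eobs M (D 0) (mgt 1 ws)"

lemma block_integrable:
  "integrable M (\<lambda>\<omega>. mtt ws (D 0 \<omega>))" "integrable M (\<lambda>\<omega>. mgg ws (D 0 \<omega>))"
  "\<bar>\<kappa>\<bar> \<le> 1 \<Longrightarrow> integrable M (\<lambda>\<omega>. mgt \<kappa> ws (D 0 \<omega>))"
  by (rule integrable_matrixI, simp add: block_entries hs_integrable)+

lemma info_forms:
  "a \<bullet> (Itt *v a') = Hh (a, 0) (a', 0)"
  "c \<bullet> (Igg *v c') = Hh (0, c) (0, c')"
  "c \<bullet> (Igt *v a) = Hh (0, c) (a, 0)"
  unfolding Itt_def Igg_def Igt_def Eobs_def
    integral_matrix_form[OF block_integrable(1)] integral_matrix_form[OF block_integrable(2)]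
    integral_matrix_form[OF block_integrable(3)[of 1, simplified]]
    block_forms(1)[where \<kappa> = 0] block_forms(2) block_forms(3)[where \<kappa> = 0]
  using hs_mean[of 0] hs_mean[of 1] by (simp_all add: Eobs_def)

lemma Hh_sym: "Hh d e = Hh e d"
  unfolding Hh_def by (rule arg_cong[of _ _ "Eobs M (D 0)"]) (auto simp: hs_def d2ix_def mult_ac)

lemma Hh_blocks:
  "Hh (a, c) (a', c') = a \<bullet> (Itt *v a') + c \<bullet> (Igt *v a') + c' \<bullet> (Igt *v a) + c \<bullet> (Igg *v c')"
proof -
  have "Hh (a, c) (a', c') = Hh ((a, 0) + (0, c)) ((a', 0) + (0, c'))" by simp
  also have "\<dots> = Hh (a, 0) (a', 0) + Hh (0, c) (a', 0) + Hh (a, 0) (0, c') + Hh (0, c) (0, c')"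
    by (simp only: bilinear_ladd[OF bilinear_Hh] bilinear_radd[OF bilinear_Hh])
  finally show ?thesis
    using Hh_sym[of "(a, 0)" "(0, c')"] by (simp add: info_forms)
qed

text \<open>Completing the square in \<open>c\<close>: for fixed \<open>a\<close> the form is
  minimal at \<open>c = - k\<close>, and its minimum is the Schur complement evaluated at
  \<open>a\<close>.\<close>

lemma Hh_pos_of_schur:
  assumes gg: "\<And>c. c \<noteq> 0 \<Longrightarrow> 0 < c \<bullet> (Igg *v c)"
    and pd: "pos_def (Itt - transpose Igt ** matrix_inv Igg ** Igt)" and d: "d \<noteq> 0"
  shows "0 < Hh d d"
proof -
  obtain a c where ac: "d = (a, c)" by (cases d)
  define k where "k = matrix_inv Igg *v (Igt *v a)"
  have k: "Igg *v k = Igt *v a"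
    by (simp add: k_def matrix_vector_mul_assoc matrix_mul_assoc matrix_inv_right[OF det_nz_if_pos[OF gg]])
  have sym: "k \<bullet> (Igg *v c) = c \<bullet> (Igg *v k)" using Hh_sym by (simp add: info_forms)
  have "a \<bullet> ((transpose Igt ** matrix_inv Igg ** Igt) *v a) = k \<bullet> (Igt *v a)"
    by (simp only: k_def matrix_vector_mul_assoc[symmetric] inner_transpose_mult)
  then have schur: "a \<bullet> ((Itt - transpose Igt ** matrix_inv Igg ** Igt) *v a) = a \<bullet> (Itt *v a) - k \<bullet> (Igt *v a)"
    by (simp add: matrix_vector_mult_diff_rdistrib inner_diff_right)
  have "(c + k) \<bullet> (Igg *v (c + k)) = c \<bullet> (Igg *v c) + 2 * (c \<bullet> (Igt *v a)) + k \<bullet> (Igt *v a)"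
    using sym by (simp add: matrix_vector_right_distrib inner_add_left inner_add_right k)
  then have eq: "Hh d d = (c + k) \<bullet> (Igg *v (c + k)) + a \<bullet> ((Itt - transpose Igt ** matrix_inv Igg ** Igt) *v a)"
    unfolding ac Hh_blocks schur by simp
  have nn: "0 \<le> (c + k) \<bullet> (Igg *v (c + k))"
    using gg[of "c + k"] by (cases "c + k = 0") auto
  show ?thesis
  proof (cases "a = 0")
    case True
    then have "k = 0" "c \<noteq> 0" using d ac by (auto simp: k_def zero_prod_def)
    then show ?thesis using gg[of c] True eq by simp
  next
    case False
    then have "0 < a \<bullet> ((Itt - transpose Igt ** matrix_inv Igg ** Igt) *v a)"
      using pd by (simp add: pos_def_def)
    then show ?thesis using nn eq by simp
  qed
qed

end

locale logit_sample_regular = logit_sample_cart p0 p z y K ws M N D cov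
  for p0 :: "'o \<Rightarrow> real" and p :: "'o \<Rightarrow> real^'d2" and z :: "'o \<Rightarrow> real^'d1"
    and y K ws and M :: "'w measure" and N D and cov :: "'o \<Rightarrow> 'c" +
  assumes Hh_pos: "\<And>d. d \<noteq> 0 \<Longrightarrow> 0 < Hh d d"
begin

lemma det_Itt: "det Itt \<noteq> 0"
  by (rule det_nz_if_pos) (simp add: info_forms Hh_pos zero_prod_def)

text \<open>Block elimination: the theta component of the second argument is chosen so that the
  pairing no longer depends on \<open>a\<close>.\<close>

lemma schur_form:
  "Hh (a, c) (- (matrix_inv Itt *v (transpose Igt *v x)), x)
    = c \<bullet> ((Igg - Igt ** matrix_inv Itt ** transpose Igt) *v x)"
proof -
  define u where "u = matrix_inv Itt *v (transpose Igt *v x)"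
  have "Itt *v u = transpose Igt *v x"
    by (simp add: u_def matrix_vector_mul_assoc matrix_mul_assoc matrix_inv_right[OF det_Itt])
  then have "a \<bullet> (Itt *v u) = x \<bullet> (Igt *v a)" by (simp only: inner_transpose_mult)
  moreover have "(Igt ** matrix_inv Itt ** transpose Igt) *v x = Igt *v u"
    by (simp only: u_def matrix_vector_mul_assoc[symmetric])
  ultimately show ?thesis
    unfolding u_def[symmetric] Hh_blocks
    by (simp add: matrix_vector_mult_diff_rdistrib inner_diff_right linear_neg[OF matrix_vector_mul_linear])
qed

lemma det_schur: "det (Igg - Igt ** matrix_inv Itt ** transpose Igt) \<noteq> 0"
proof (rule det_nz_if_pos)
  fix x :: "real^'d2" assume "x \<noteq> 0"
  then show "0 < x \<bullet> ((Igg - Igt ** matrix_inv Itt ** transpose Igt) *v x)"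
    unfolding schur_form[of "- (matrix_inv Itt *v (transpose Igt *v x))" x x, symmetric]
    by (intro Hh_pos) (simp add: zero_prod_def)
qed

text \<open>The inverse information applied to the unit vector of the \<open>i\<close>-th gamma
  coordinate, obtained by back substitution.\<close>

definition direction :: "'d2 \<Rightarrow> (real^'d1) \<times> (real^'d2)" where
  "direction i = (let x = schur_inv Itt Igg Igt *v axis i 1 in (- (matrix_inv Itt *v (transpose Igt *v x)), x))"

lemma Hh_direction: "Hh d (direction i) = (0, axis i 1) \<bullet> d"
proof -
  obtain a c where ac: "d = (a, c)" by (cases d)
  show ?thesis
    unfolding ac direction_def Let_def schur_form schur_inv_def
    by (simp add: matrix_vector_mul_assoc matrix_inv_right[OF det_schur] inner_commute)
qed

text \<open>Together with \<open>score_variance\<close> this identifies the limiting variance of the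
  \<open>i\<close>-th coordinate.\<close>

lemma Hh_direction_self: "Hh (direction i) (direction i) = schur_inv Itt Igg Igt $ i $ i"
  unfolding Hh_direction matrix_form_entry by (simp add: direction_def Let_def)

lemma asymptotic_variance_pos: "0 < schur_inv Itt Igg Igt $ i $ i"
proof -
  have "Hh (0, axis i 1) (direction i) = 1" unfolding Hh_direction by (simp add: inner_axis_axis)
  then have "direction i \<noteq> 0" using bilinear_rzero[OF bilinear_Hh] by force
  then show ?thesis using Hh_pos Hh_direction_self by metis
qed

definition Shat :: "nat \<Rightarrow> 'w \<Rightarrow> (real^'d1) \<times> (real^'d2) \<Rightarrow> real^'d2^'d2" where
  "Shat n \<omega> w = schur_inv (emp n (\<lambda>i. D i \<omega>) (mtt w)) (emp n (\<lambda>i. D i \<omega>) (mgg w)) (emp n (\<lambda>i. D i \<omega>) (mgt 0 w))"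

lemma Shat_measurable:
  assumes [measurable]: "W \<in> borel_measurable M"
  shows "(\<lambda>\<omega>. Shat n \<omega> (W \<omega>)) \<in> borel_measurable M"
proof -
  note [measurable] = hs_measurable
  have entry: "(\<lambda>\<omega>. emp n (\<lambda>i. D i \<omega>) (hs \<kappa> (W \<omega>) d e)) \<in> borel_measurable M" for \<kappa> d e
    unfolding emp_def by measurable
  have [measurable]: "(\<lambda>\<omega>. emp n (\<lambda>i. D i \<omega>) (mtt (W \<omega>))) \<in> borel_measurable M"
    "(\<lambda>\<omega>. emp n (\<lambda>i. D i \<omega>) (mgg (W \<omega>))) \<in> borel_measurable M"
    "(\<lambda>\<omega>. emp n (\<lambda>i. D i \<omega>) (mgt 0 (W \<omega>))) \<in> borel_measurable M"
    by (rule borel_measurable_matrixI, unfold emp_matrix_entry block_entries, rule entry)+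
  show ?thesis unfolding Shat_def schur_inv_def by measurable
qed

lemma Shat_consistent:
  assumes W: "\<And>\<epsilon> \<delta>. 0 < \<epsilon> \<Longrightarrow> 0 < \<delta> \<Longrightarrow> high_prob M \<delta> (\<lambda>n \<omega>. norm (W n \<omega> - ws) \<le> \<epsilon>)"
    and \<epsilon>: "0 < \<epsilon>" and \<delta>: "0 < \<delta>"
  shows "high_prob M \<delta> (\<lambda>n \<omega>. norm (Shat n \<omega> (W n \<omega>) - schur_inv Itt Igg Igt) \<le> \<epsilon>)"
proof -
  obtain q where q: "0 < q" "\<And>A' B' C'. (\<And>i j. \<bar>(A' - Itt) $ i $ j\<bar> \<le> q) \<Longrightarrow> (\<And>i j. \<bar>(B' - Igg) $ i $ j\<bar> \<le> q) \<Longrightarrow>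
      (\<And>i j. \<bar>(C' - Igt) $ i $ j\<bar> \<le> q) \<Longrightarrow> norm (schur_inv A' B' C' - schur_inv Itt Igg Igt) \<le> \<epsilon>"
    using schur_inv_continuous[OF det_Itt det_schur \<epsilon>] by blast
  \<comment> \<open>Half of the entrywise tolerance \<open>q\<close> is reserved for the drift from
    \<open>ws\<close> to the estimate, at most \<open>Hb * s\<close>, and half for the sampling
    error at \<open>ws\<close>; the cap at 1 keeps the estimate in the unit ball.\<close>
  define s where "s = min 1 (q / (2 * Hb))"
  have s: "0 < s" "s \<le> 1" "s \<le> q / (2 * Hb)" using q Hb_pos by (auto simp: s_def)
  have Hs: "Hb * s \<le> q / 2" using s(3) Hb_pos by (simp add: field_simps)
  have H: "high_prob M \<delta> (\<lambda>n \<omega>. norm (W n \<omega> - ws) \<le> s \<and>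
      (\<forall>d e. \<bar>emp n (\<lambda>i. D i \<omega>) (hs 0 ws d e) - Hh d e\<bar> \<le> q / 2 * norm d * norm e))"
    by (rule high_prob_conj[OF W[of s "\<delta> / 2"] info_law[of 0 "\<delta> / 2" "q / 2"]]) (use s q \<delta> in auto)
  show ?thesis
  proof (rule high_prob_mono[OF H], intro always_eventually allI ballI impI, elim conjE)
    fix n \<omega>
    assume Wn: "norm (W n \<omega> - ws) \<le> s"
      and E: "\<forall>d e. \<bar>emp n (\<lambda>i. D i \<omega>) (hs 0 ws d e) - Hh d e\<bar> \<le> q / 2 * norm d * norm e"
    have near: "\<bar>emp n (\<lambda>i. D i \<omega>) (hs 0 (W n \<omega>) d e) - Hh d e\<bar> \<le> q" if de: "norm d = 1" "norm e = 1" for d e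
    proof -
      have "\<bar>emp n (\<lambda>i. D i \<omega>) (hs 0 (W n \<omega>) d e) - Hh d e\<bar> \<le> (Hb * norm (W n \<omega> - ws) + q / 2) * norm d * norm e"
        by (rule emp_hs_near) (use E Wn s in \<open>auto simp: dist_norm norm_minus_commute\<close>)
      moreover have "Hb * norm (W n \<omega> - ws) \<le> Hb * s" using Wn Hb_pos by (intro mult_left_mono) auto
      ultimately show ?thesis using Hs de by simp
    qed
    have entries: "Itt $ i $ j = Hh (axis i 1, 0) (axis j 1, 0)" "Igg $ k $ l = Hh (0, axis k 1) (0, axis l 1)"
      "Igt $ k $ j = Hh (0, axis k 1) (axis j 1, 0)" for i j k l
      unfolding matrix_form_entry info_forms by simp_all
    show "norm (Shat n \<omega> (W n \<omega>) - schur_inv Itt Igg Igt) \<le> \<epsilon>"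
      unfolding Shat_def
      by (rule q(2)) (simp_all add: emp_matrix_entry block_entries entries near norm_Pair)
  qed
qed

lemma studentized_normal:
  assumes asym: "asym_linear W"
    and meas [measurable]: "\<And>n. W n \<in> borel_measurable M"
  shows "weak_conv_m (\<lambda>n. distr M borel (\<lambda>\<omega>. sqrt n * (axis i 1 \<bullet> (snd (W n \<omega>) - snd ws))
      / sqrt (axis i 1 \<bullet> (Shat n \<omega> (W n \<omega>) *v axis i 1)))) std_normal_distribution"
proof -
  have W: "high_prob M \<delta> (\<lambda>n \<omega>. norm (W n \<omega> - ws) \<le> \<epsilon>)" if "0 < \<epsilon>" "0 < \<delta>" for \<epsilon> \<delta>
    using asym that by (simp add: asym_linear_def)
  define v where "v = schur_inv Itt Igg Igt $ i $ i"
  have v: "0 < v" unfolding v_def by (rule asymptotic_variance_pos)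
  \<comment> \<open>The sign of the linear expansion is absorbed into the summand, so that the
    leading term is a normalised sum with a plus sign.\<close>
  define f where "f = (\<lambda>ob. - (gr ws ob \<bullet> direction i))"
  have f [measurable]: "f \<in> borel_measurable N" unfolding f_def by measurable
  have fb: "\<bar>f ob\<bar> \<le> 2 * Cb\<^sup>2 * norm (direction i)" for ob
    using gr_inner_le[of ob "direction i"] by (simp add: f_def)
  have f0: "Eobs M (D 0) f = 0"
    using score_mean_inner[of "direction i"] by (simp add: f_def Eobs_def)
  have f2: "Eobs M (D 0) (\<lambda>ob. (f ob)\<^sup>2) = v"
    using score_variance[of "direction i"] by (simp add: f_def v_def Hh_direction_self)
  have femp: "emp n dat f = - (emp n dat (gr ws) \<bullet> direction i)" for n dat
    by (simp add: f_def emp_inner) (simp add: emp_def sum_negf)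
  define X where "X = (\<lambda>n \<omega>. sqrt (real n) * emp n (\<lambda>i. D i \<omega>) f / sqrt v)"
  define R where "R = (\<lambda>n \<omega>. sqrt (real n) * (((0, axis i 1) :: (real^'d1) \<times> (real^'d2)) \<bullet> (W n \<omega> - ws))
      + sqrt n * (emp n (\<lambda>i. D i \<omega>) (gr ws) \<bullet> direction i))"
  have entry: "axis i 1 \<bullet> (A *v axis i 1) = A $ i $ i" for A :: "real^'d2^'d2"
    by (rule matrix_form_entry[symmetric])
  have [measurable]: "(\<lambda>\<omega>. Shat n \<omega> (W n \<omega>) $ i $ i) \<in> borel_measurable M" for n
    by (intro borel_measurable_matrix_entry Shat_measurable meas)
  show ?thesis
    unfolding entry
  proof (rule weak_conv_m_ratio[where X = X and R = R and v = v])
    show "X n \<in> borel_measurable M" for n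
      unfolding X_def emp_def by measurable
    show "(\<lambda>\<omega>. sqrt (real n) * (axis i 1 \<bullet> (snd (W n \<omega>) - snd ws)) / sqrt (Shat n \<omega> (W n \<omega>) $ i $ i)) \<in> borel_measurable M" for n
      by measurable
    show "weak_conv_m (\<lambda>n. distr M borel (X n)) std_normal_distribution"
      unfolding X_def by (rule central_limit_emp[OF f fb f0 f2 v])
    show "\<exists>k. high_prob M \<delta> (\<lambda>n \<omega>. \<bar>X n \<omega>\<bar> \<le> k)" if \<delta>: "0 < \<delta>" for \<delta>
    proof -
      obtain k where k: "high_prob M \<delta> (\<lambda>n \<omega>. sqrt n * \<bar>emp n (\<lambda>i. D i \<omega>) f - 0\<bar> \<le> k)"
        using sqrt_deviation_tight[OF f fb \<delta>] unfolding f0 by blast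
      have "high_prob M \<delta> (\<lambda>n \<omega>. \<bar>X n \<omega>\<bar> \<le> k / sqrt v)"
        by (rule high_prob_mono[OF k])
          (auto simp: X_def abs_mult v less_imp_le intro!: always_eventually divide_right_mono)
      then show ?thesis by blast
    qed
    show "sqrt (real n) * (axis i 1 \<bullet> (snd (W n \<omega>) - snd ws)) / sqrt (Shat n \<omega> (W n \<omega>) $ i $ i)
        = (sqrt v * X n \<omega> + R n \<omega>) / sqrt (Shat n \<omega> (W n \<omega>) $ i $ i)" for n \<omega>
    proof -
      have "sqrt v * X n \<omega> = - (sqrt n * (emp n (\<lambda>i. D i \<omega>) (gr ws) \<bullet> direction i))"
        using v by (simp add: X_def femp)
      moreover have "((0, axis i 1) :: (real^'d1) \<times> (real^'d2)) \<bullet> (W n \<omega> - ws) = axis i 1 \<bullet> (snd (W n \<omega>) - snd ws)"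
        by (simp add: inner_prod_def)
      ultimately show ?thesis unfolding R_def by simp
    qed
    show "high_prob M \<delta> (\<lambda>n \<omega>. \<bar>R n \<omega>\<bar> \<le> \<epsilon>)" if "0 < \<epsilon>" "0 < \<delta>" for \<epsilon> \<delta>
      using asym that Hh_direction[of _ i] unfolding asym_linear_def R_def by blast
    show "high_prob M \<delta> (\<lambda>n \<omega>. \<bar>Shat n \<omega> (W n \<omega>) $ i $ i - v\<bar> \<le> \<epsilon>)" if "0 < \<epsilon>" "0 < \<delta>" for \<epsilon> \<delta>
    proof (rule high_prob_mono, rule Shat_consistent[OF W], assumption+, rule that, rule that,
        intro always_eventually allI ballI impI)
      fix n \<omega> assume "norm (Shat n \<omega> (W n \<omega>) - schur_inv Itt Igg Igt) \<le> \<epsilon>"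
      then show "\<bar>Shat n \<omega> (W n \<omega>) $ i $ i - v\<bar> \<le> \<epsilon>"
        using component_le_norm_cart[of "(Shat n \<omega> (W n \<omega>) - schur_inv Itt Igg Igt) $ i" i]
          Finite_Cartesian_Product.norm_nth_le[of "Shat n \<omega> (W n \<omega>) - schur_inv Itt Igg Igt" i]
        by (simp add: v_def)
    qed
  qed (rule v)
qed

lemma Shat_conv_in_prob:
  assumes asym: "asym_linear W"
  shows "conv_in_prob M (\<lambda>n \<omega>. spec_norm (Shat n \<omega> (W n \<omega>) - schur_inv Itt Igg Igt)) 0"
  unfolding conv_in_prob_iff
proof (intro allI impI)
  fix \<epsilon> \<delta> :: real assume \<epsilon>: "0 < \<epsilon>" and \<delta>: "0 < \<delta>"
  define c where "c = real (CARD('d2) * CARD('d2))"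
  have c: "0 < c" by (simp add: c_def)
  have H: "high_prob M \<delta> (\<lambda>n \<omega>. norm (Shat n \<omega> (W n \<omega>) - schur_inv Itt Igg Igt) \<le> \<epsilon> / c)"
    by (rule Shat_consistent) (use c \<epsilon> \<delta> asym in \<open>auto simp: asym_linear_def\<close>)
  show "high_prob M \<delta> (\<lambda>n \<omega>. dist (spec_norm (Shat n \<omega> (W n \<omega>) - schur_inv Itt Igg Igt)) 0 \<le> \<epsilon>)"
  proof (rule high_prob_mono[OF H], intro always_eventually allI ballI impI)
    fix n \<omega> assume "norm (Shat n \<omega> (W n \<omega>) - schur_inv Itt Igg Igt) \<le> \<epsilon> / c"
    then have "c * norm (Shat n \<omega> (W n \<omega>) - schur_inv Itt Igg Igt) \<le> \<epsilon>" using c by (simp add: field_simps)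
    then show "dist (spec_norm (Shat n \<omega> (W n \<omega>) - schur_inv Itt Igg Igt)) 0 \<le> \<epsilon>"
      using spec_norm_le[of "Shat n \<omega> (W n \<omega>) - schur_inv Itt Igg Igt"] by (simp add: c_def)
  qed
qed

end

section \<open>Transfer to the stated model\<close>

lemma agd_eq_agd_step:
  assumes "\<And>\<theta> \<gamma>. grad (\<lambda>th. L th \<gamma>) \<theta> = fst (G (\<theta>, \<gamma>))" "\<And>\<theta> \<gamma>. grad (\<lambda>g. L \<theta> g) \<gamma> = snd (G (\<theta>, \<gamma>))"
  shows "agd L \<eta>1 \<eta>2 \<theta>0 \<gamma>0 t = (agd_step G \<eta>1 \<eta>2 ^^ t) (\<theta>0, \<gamma>0)"
  by (induction t) (simp_all add: assms agd_step_def Let_def)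

text \<open>A positive semidefinite second-moment matrix without the eigenvalue 0 is definite, and
  definiteness survives a strictly positive reweighting of the integrand.\<close>
lemma weighted_second_moment_pos:
  fixes P :: "'w \<Rightarrow> real^'n" and g m :: "'w \<Rightarrow> real"
  assumes g: "\<And>\<omega>. 0 \<le> g \<omega>" and m: "\<And>\<omega>. 0 < m \<omega>"
    and int: "integrable M (\<lambda>\<omega>. g \<omega> *\<^sub>R outer (P \<omega>) (P \<omega>))"
    and int': "integrable M (\<lambda>\<omega>. (m \<omega> * g \<omega>) *\<^sub>R outer (P \<omega>) (P \<omega>))"
    and l: "0 < lambda_min (integral\<^sup>L M (\<lambda>\<omega>. g \<omega> *\<^sub>R outer (P \<omega>) (P \<omega>)))"
    and v: "v \<noteq> 0"
  shows "0 < v \<bullet> (integral\<^sup>L M (\<lambda>\<omega>. (m \<omega> * g \<omega>) *\<^sub>R outer (P \<omega>) (P \<omega>)) *v v)"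
proof -
  let ?A = "integral\<^sup>L M (\<lambda>\<omega>. g \<omega> *\<^sub>R outer (P \<omega>) (P \<omega>))"
  have form: "a \<bullet> ((c *\<^sub>R outer u u) *v b) = c * ((a \<bullet> u) * (b \<bullet> u))" for a b u :: "real^'n" and c
    unfolding scaleR_matrix_vector_assoc[symmetric] inner_scaleR_right outer_form by (simp add: inner_commute)
  have A: "a \<bullet> (?A *v b) = (\<integral>\<omega>. g \<omega> * ((a \<bullet> P \<omega>) * (b \<bullet> P \<omega>)) \<partial>M)" for a b
    unfolding integral_matrix_form[OF int] form ..
  have B: "v \<bullet> (integral\<^sup>L M (\<lambda>\<omega>. (m \<omega> * g \<omega>) *\<^sub>R outer (P \<omega>) (P \<omega>)) *v v)
      = (\<integral>\<omega>. m \<omega> * g \<omega> * ((v \<bullet> P \<omega>) * (v \<bullet> P \<omega>)) \<partial>M)"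
    unfolding integral_matrix_form[OF int'] form ..
  have nonneg: "0 \<le> m \<omega> * g \<omega> * ((v \<bullet> P \<omega>) * (v \<bullet> P \<omega>))" for \<omega>
    by (intro mult_nonneg_nonneg[OF mult_nonneg_nonneg zero_le_square] g less_imp_le[OF m])
  have intB: "integrable M (\<lambda>\<omega>. m \<omega> * g \<omega> * ((v \<bullet> P \<omega>) * (v \<bullet> P \<omega>)))"
  proof -
    have "linear (\<lambda>A :: real^'n^'n. v \<bullet> (A *v v))"
      by (rule linearI) (simp_all add: matrix_vector_mult_add_rdistrib inner_add_right scaleR_matrix_vector_assoc[symmetric])
    then have "bounded_linear (\<lambda>A :: real^'n^'n. v \<bullet> (A *v v))" by (simp add: linear_conv_bounded_linear)
    from integrable_bounded_linear[OF this int'] show ?thesis unfolding form .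
  qed
  \<comment> \<open>If the weighted form vanished at \<open>v\<close>, the integrand would vanish
    almost everywhere; dividing by \<open>m\<close> shows that \<open>v\<close> lies in the kernel
    of the unweighted matrix, so 0 would be an eigenvalue.\<close>
  have "(\<integral>\<omega>. m \<omega> * g \<omega> * ((v \<bullet> P \<omega>) * (v \<bullet> P \<omega>)) \<partial>M) \<noteq> 0"
  proof
    assume "(\<integral>\<omega>. m \<omega> * g \<omega> * ((v \<bullet> P \<omega>) * (v \<bullet> P \<omega>)) \<partial>M) = 0"
    then have "AE \<omega> in M. m \<omega> * g \<omega> * ((v \<bullet> P \<omega>) * (v \<bullet> P \<omega>)) = 0"
      using integral_nonneg_eq_0_iff_AE[OF intB] nonneg by auto
    then have ae: "AE \<omega> in M. g \<omega> * ((a \<bullet> P \<omega>) * (v \<bullet> P \<omega>)) = 0" for a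
      by eventually_elim (use m in \<open>auto simp: less_le\<close>)
    have "a \<bullet> (?A *v v) = 0" for a
      unfolding A by (rule integral_eq_zero_AE[OF ae])
    then have "?A *v v = 0" by (metis inner_eq_zero_iff)
    then have "0 \<in> {l. \<exists>v. v \<noteq> 0 \<and> ?A *v v = l *\<^sub>R v}" using v by auto
    \<comment> \<open>\<open>lambda_min\<close> is an infimum of a set of reals, which says
      something about its elements only if the set is bounded below.\<close>
    moreover have "bdd_below {l. \<exists>v. v \<noteq> 0 \<and> ?A *v v = l *\<^sub>R v}"
    proof (rule bdd_belowI[of _ 0], clarify)
      fix l u assume u: "u \<noteq> 0" "?A *v u = l *\<^sub>R u"
      have "0 \<le> u \<bullet> (?A *v u)" unfolding A using g by (intro integral_nonneg_AE) auto
      then have "0 \<le> l * (norm u)\<^sup>2" using u by (simp add: power2_norm_eq_inner)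
      then show "0 \<le> l" using u(1) by (simp add: zero_le_mult_iff)
    qed
    ultimately have "lambda_min ?A \<le> 0" unfolding lambda_min_def by (rule cInf_lower)
    then show False using l by linarith
  qed
  moreover have "0 \<le> (\<integral>\<omega>. m \<omega> * g \<omega> * ((v \<bullet> P \<omega>) * (v \<bullet> P \<omega>)) \<partial>M)"
    using nonneg by (intro integral_nonneg_AE) auto
  ultimately show ?thesis unfolding B by linarith
qed

theorem theorem5:
  fixes M :: "'w measure"
    and Mx :: "'x measure" and Ms :: "'s measure" and Ma :: "'a measure"
    and D :: "nat \<Rightarrow> 'w \<Rightarrow> ('x,'s,'a) obs"
    and phi :: "'s \<Rightarrow> 'a \<Rightarrow> real^'d1"
    and psi0 :: "'x \<Rightarrow> real" and psi :: "'x \<Rightarrow> real^'d2"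
    and \<theta>s :: "real^'d1" and \<gamma>s :: "real^'d2"
    and \<phi>max \<psi>max \<theta>max \<gamma>max lphi lpsi :: real
  defines "N \<equiv> Mx \<Otimes>\<^sub>M Ms \<Otimes>\<^sub>M Ma \<Otimes>\<^sub>M Ma \<Otimes>\<^sub>M (count_space UNIV :: bool measure)"
    and "d1 \<equiv> CARD('d1)" and "d2 \<equiv> CARD('d2)"
  assumes P: "prob_space M"
    \<comment> \<open>measurability of the known feature maps\<close>
    and meas_phi: "(\<lambda>(s, a). phi s a) \<in> borel_measurable (Ms \<Otimes>\<^sub>M Ma)"
    and meas_psi0: "psi0 \<in> borel_measurable Mx"
    and meas_psi: "psi \<in> borel_measurable Mx"
    \<comment> \<open>i.i.d. observations\<close>
    and meas_D: "\<And>i. D i \<in> measurable M N"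
    and indep: "prob_space.indep_vars M (\<lambda>_. N) D UNIV"
    and ident: "\<And>i. distr M N (D i) = distr M N (D 0)"
    \<comment> \<open>the model: P(y = 1 | x, s, a0, a1) = mu(sigma_{gamma*}(x) theta*^T z)\<close>
    and model: "\<And>A. A \<in> sets (Mx \<Otimes>\<^sub>M Ms \<Otimes>\<^sub>M Ma \<Otimes>\<^sub>M Ma) \<Longrightarrow>
        measure M {\<omega> \<in> space M. (ob_x (D 0 \<omega>), ob_s (D 0 \<omega>), ob_a0 (D 0 \<omega>), ob_a1 (D 0 \<omega>)) \<in> A
                                  \<and> ob_y (D 0 \<omega>)}
        = Eobs M (D 0) (\<lambda>ob. indicator A (ob_x ob, ob_s ob, ob_a0 ob, ob_a1 ob)
                    * logistic (uidx psi0 psi phi \<theta>s \<gamma>s ob))"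
    \<comment> \<open>(A1)\<close>
    and A1a: "\<And>s a. norm (phi s a) \<le> \<phi>max"
    and A1b: "infnorm \<theta>s \<le> \<theta>max"
    \<comment> \<open>(A2)\<close>
    and A2a: "\<exists>x. psi0 x \<noteq> 0"
    and A2b: "\<And>x. sqrt ((psi0 x)\<^sup>2 + (norm (psi x))\<^sup>2) \<le> \<psi>max"
    and A2c: "max 1 (infnorm \<gamma>s) \<le> \<gamma>max"
    \<comment> \<open>(A3)\<close>
    and A3a: "lambda_min (Eobs M (D 0) (\<lambda>ob. (sig psi0 psi \<gamma>s (ob_x ob))\<^sup>2 *\<^sub>R outer (zv phi ob) (zv phi ob))) = lphi"
    and A3b: "lphi > 0"
    and A3c: "lambda_min (Eobs M (D 0) (\<lambda>ob. (\<theta>s \<bullet> zv phi ob)\<^sup>2 *\<^sub>R outer (psi (ob_x ob)) (psi (ob_x ob)))) = lpsi"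
    and A3d: "lpsi > 0"
    \<comment> \<open>(A4)\<close>
    and A4: "spec_norm (Eobs M (D 0) (hgt psi0 psi phi \<theta>s \<gamma>s))
               < min lphi lpsi / (6 * c_zero d1 d2 lphi lpsi \<phi>max \<psi>max \<theta>max \<gamma>max)"
    \<comment> \<open>(A5): Fisher blocks = expectations of the Hessian blocks of L_n at the truth\<close>
    and A5: "pos_def (Eobs M (D 0) (htt psi0 psi phi \<theta>s \<gamma>s)
               - transpose (Eobs M (D 0) (hess_gt psi0 psi phi \<theta>s \<gamma>s))
                 ** matrix_inv (Eobs M (D 0) (hgg psi0 psi phi \<theta>s \<gamma>s))
                 ** Eobs M (D 0) (hess_gt psi0 psi phi \<theta>s \<gamma>s))"
  shows "\<exists>b0>0. \<exists>\<eta>0>0. \<forall>b \<theta>0 \<gamma>0 \<eta>1 \<eta>2.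
     b < b0 \<and> norm (\<theta>0 - \<theta>s) \<le> b / sqrt 2 \<and> norm (\<gamma>0 - \<gamma>s) \<le> b / sqrt 2
     \<and> 0 < \<eta>1 \<and> \<eta>1 < \<eta>0 \<and> 0 < \<eta>2 \<and> \<eta>2 < \<eta>0 \<longrightarrow>
     (\<exists>\<rho>1. 0 < \<rho>1 \<and> \<rho>1 < 1 \<and>
       (\<forall>T :: nat \<Rightarrow> nat. (\<lambda>n. real n * \<rho>1 ^ T n) \<longlonglongrightarrow> 0 \<longrightarrow>
         (let est = (\<lambda>n \<omega>. agd (loss psi0 psi phi n (\<lambda>i. D i \<omega>)) \<eta>1 \<eta>2 \<theta>0 \<gamma>0 (T n));
              Shat = (\<lambda>n \<omega>. S_gamma_sq psi0 psi phi n (\<lambda>i. D i \<omega>) (fst (est n \<omega>)) (snd (est n \<omega>)));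
              Itt = Eobs M (D 0) (htt psi0 psi phi \<theta>s \<gamma>s);
              Igg = Eobs M (D 0) (hgg psi0 psi phi \<theta>s \<gamma>s);
              Itg = transpose (Eobs M (D 0) (hess_gt psi0 psi phi \<theta>s \<gamma>s))
          in conv_in_prob M (\<lambda>n \<omega>. spec_norm (Shat n \<omega> - matrix_inv (Igg - transpose Itg ** matrix_inv Itt ** Itg))) 0
           \<and> (\<forall>i :: 'd2. weak_conv_m
                 (\<lambda>n. distr M borel (\<lambda>\<omega>. sqrt (real n) * (axis i 1 \<bullet> (snd (est n \<omega>) - \<gamma>s))
                        / sqrt (axis i 1 \<bullet> (Shat n \<omega> *v axis i 1))))
                 std_normal_distribution))))"
proof -
  interpret prob_space M by (rule P)
  \<comment> \<open>The factor 2 accounts for \<open>zv\<close> being a difference of two feature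
    vectors; the 1 makes higher powers of the bound dominate lower ones.\<close>
  define K where "K = max 1 (max (2 * \<phi>max) \<psi>max)"
  let ?C = "Mx \<Otimes>\<^sub>M Ms \<Otimes>\<^sub>M Ma \<Otimes>\<^sub>M Ma"
  define p0 where "p0 = (\<lambda>ob :: ('x,'s,'a) obs. psi0 (ob_x ob))"
  define p where "p = (\<lambda>ob :: ('x,'s,'a) obs. psi (ob_x ob))"
  define y where "y = (\<lambda>ob :: ('x,'s,'a) obs. of_bool (ob_y ob) :: real)"
  define cov where "cov = (\<lambda>ob :: ('x,'s,'a) obs. (ob_x ob, ob_s ob, ob_a0 ob, ob_a1 ob))"
  note [measurable] = meas_psi0 meas_psi meas_D
  have [measurable]: "ob_x \<in> measurable N Mx" "ob_s \<in> measurable N Ms" "ob_a0 \<in> measurable N Ma"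
    "ob_a1 \<in> measurable N Ma" "ob_y \<in> measurable N (count_space UNIV)"
    unfolding N_def ob_x_def[abs_def] ob_s_def[abs_def] ob_a0_def[abs_def] ob_a1_def[abs_def] ob_y_def[abs_def]
    by measurable
  have cov_meas [measurable]: "cov \<in> measurable N ?C" unfolding cov_def by measurable
  have p0_meas [measurable]: "p0 \<in> borel_measurable N" and p_meas [measurable]: "p \<in> borel_measurable N"
    unfolding p0_def p_def by measurable
  have y_meas [measurable]: "y \<in> borel_measurable N" unfolding y_def by measurable
  have phi2: "(\<lambda>ob. phi (ob_s ob) (a ob)) \<in> borel_measurable N" if [measurable]: "a \<in> measurable N Ma" for a
  proof -
    have "(\<lambda>ob. (\<lambda>(s, a). phi s a) (ob_s ob, a ob)) \<in> borel_measurable N"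
      by (rule measurable_compose[OF _ meas_phi]) measurable
    then show ?thesis by simp
  qed
  have z_meas [measurable]: "zv phi \<in> borel_measurable N"
    unfolding zv_def[abs_def] by (intro borel_measurable_diff phi2) measurable
  have psi_le: "\<bar>psi0 x\<bar> \<le> \<psi>max" "norm (psi x) \<le> \<psi>max" for x
    using order_trans[OF real_sqrt_le_mono[of "(psi0 x)\<^sup>2" "(psi0 x)\<^sup>2 + (norm (psi x))\<^sup>2"] A2b[of x]]
      order_trans[OF real_sqrt_le_mono[of "(norm (psi x))\<^sup>2" "(psi0 x)\<^sup>2 + (norm (psi x))\<^sup>2"] A2b[of x]]
    by simp_all
  have z_le: "norm (zv phi ob) \<le> 2 * \<phi>max" for ob
    unfolding zv_def using norm_triangle_ineq4[of "phi (ob_s ob) (ob_a1 ob)" "phi (ob_s ob) (ob_a0 ob)"]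
      A1a[of "ob_s ob" "ob_a1 ob"] A1a[of "ob_s ob" "ob_a0 ob"] by linarith
  \<comment> \<open>The features are interpreted on their own first, since the label identity
    required by the larger locale is phrased with \<open>LF.ix\<close>.\<close>
  interpret LF: logit_features p0 p "zv phi" y K "(\<theta>s, \<gamma>s)"
    by unfold_locales
      (use psi_le z_le in \<open>auto simp: K_def p0_def p_def y_def le_max_iff_disj\<close>)
  have ix_eq: "LF.ix (\<theta>, \<gamma>) = uidx psi0 psi phi \<theta> \<gamma>" for \<theta> \<gamma>
    unfolding fun_eq_iff LF.ix_def LF.sg_def LF.lin_def uidx_def sig_def by (simp add: p0_def p_def)
  have ix_meas [measurable]: "uidx psi0 psi phi \<theta>s \<gamma>s \<in> borel_measurable N"
    unfolding ix_eq[symmetric] LF.ix_def[abs_def] LF.sg_def LF.lin_def by measurable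
  have cov_features: "p0 ob = p0 ob' \<and> p ob = p ob' \<and> zv phi ob = zv phi ob'" if "cov ob = cov ob'" for ob ob'
    using that by (auto simp: cov_def p0_def p_def zv_def)
  have model_eq: "Eobs M (D 0) (\<lambda>ob. y ob * f ob) = Eobs M (D 0) (\<lambda>ob. logistic (LF.ix (\<theta>s, \<gamma>s) ob) * f ob)"
    if f [measurable]: "f \<in> borel_measurable N" and f_cov: "\<And>ob ob'. cov ob = cov ob' \<Longrightarrow> f ob = f ob'"
    for f :: "('x,'s,'a) obs \<Rightarrow> real"
  proof -
    \<comment> \<open>A function of the covariates is factored through \<open>cov\<close> by
      freezing the label; the value \<open>True\<close> is arbitrary.\<close>
    define f' where "f' = (\<lambda>(x, s, a, b). f (x, s, a, b, True))"
    have f'_meas: "f' \<in> borel_measurable ?C"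
      unfolding f'_def using f unfolding N_def by measurable
    have f'_eq: "f ob = f' (cov ob)" for ob
      unfolding f'_def cov_def by (auto intro!: f_cov simp: cov_def ob_x_def ob_s_def ob_a0_def ob_a1_def)
    have "(\<integral>\<omega>. y (D 0 \<omega>) * f' (cov (D 0 \<omega>)) \<partial>M)
        = (\<integral>\<omega>. logistic (uidx psi0 psi phi \<theta>s \<gamma>s (D 0 \<omega>)) * f' (cov (D 0 \<omega>)) \<partial>M)"
    proof (rule weighted_integral_eq[where X = "\<lambda>\<omega>. cov (D 0 \<omega>)" and C = ?C and f = f'])
      fix A assume A [measurable]: "A \<in> sets ?C"
      have "(\<integral>\<omega>. indicator A (cov (D 0 \<omega>)) * y (D 0 \<omega>) \<partial>M)
          = (\<integral>\<omega>. indicator {\<omega> \<in> space M. cov (D 0 \<omega>) \<in> A \<and> ob_y (D 0 \<omega>)} \<omega> \<partial>M)"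
        by (rule Bochner_Integration.integral_cong) (auto simp: indicator_def y_def)
      also have "\<dots> = measure M {\<omega> \<in> space M. cov (D 0 \<omega>) \<in> A \<and> ob_y (D 0 \<omega>)}"
        by (simp add: Int_def conj_ac)
      finally show "(\<integral>\<omega>. indicator A (cov (D 0 \<omega>)) * y (D 0 \<omega>) \<partial>M)
          = (\<integral>\<omega>. indicator A (cov (D 0 \<omega>)) * logistic (uidx psi0 psi phi \<theta>s \<gamma>s (D 0 \<omega>)) \<partial>M)"
        using model[OF A] by (simp add: cov_def Eobs_def)
    qed (use f'_meas logistic_pos logistic_less_1 in \<open>auto simp: y_def less_imp_le\<close>)
    then show ?thesis by (simp add: Eobs_def ix_eq f'_eq)
  qed
  interpret F: logit_sample_cart p0 p "zv phi" y K "(\<theta>s, \<gamma>s)" M N D cov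
  proof unfold_locales
    show "distr M N (D i) = distr M N (D 0)" for i by (rule ident)
    show "y ob = 0 \<or> y ob = 1" for ob by (simp add: y_def)
    show "p0 ob = p0 ob' \<and> p ob = p ob' \<and> zv phi ob = zv phi ob'" if "cov ob = cov ob'" for ob ob'
      by (rule cov_features[OF that])
    show "Eobs M (D 0) (\<lambda>ob. y ob * f ob) = Eobs M (D 0) (\<lambda>ob. logistic (LF.ix (\<theta>s, \<gamma>s) ob) * f ob)"
      if "f \<in> borel_measurable N" "\<And>ob ob'. cov ob = cov ob' \<Longrightarrow> f ob = f ob'" for f
      by (rule model_eq[OF that])
  qed (use indep in auto)
  have blocks: "htt psi0 psi phi \<theta> \<gamma> = F.mtt (\<theta>, \<gamma>)" "hgg psi0 psi phi \<theta> \<gamma> = F.mgg (\<theta>, \<gamma>)"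
    "hgt psi0 psi phi \<theta> \<gamma> = F.mgt 0 (\<theta>, \<gamma>)" "hess_gt psi0 psi phi \<theta> \<gamma> = F.mgt 1 (\<theta>, \<gamma>)" for \<theta> \<gamma>
    unfolding fun_eq_iff htt_def hgg_def hgt_def hess_gt_def F.mtt_def F.mgg_def F.mgt_def mw_def
        logistic_deriv_def LF.res_def ix_eq LF.sg_def LF.lin_def sig_def
    by (simp_all add: p0_def p_def y_def scaleR_add_left)
  \<comment> \<open>(A3) concerns the second-moment matrix without the logistic weight; the weight
    is strictly positive, so definiteness carries over.\<close>
  have Igg_pos: "0 < v \<bullet> (F.Igg *v v)" if v: "v \<noteq> 0" for v
  proof -
    have "0 < v \<bullet> (integral\<^sup>L M (\<lambda>\<omega>. (logistic_deriv (LF.ix (\<theta>s, \<gamma>s) (D 0 \<omega>)) * (LF.lin (\<theta>s, \<gamma>s) (D 0 \<omega>))\<^sup>2)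
        *\<^sub>R outer (p (D 0 \<omega>)) (p (D 0 \<omega>))) *v v)"
    proof (rule weighted_second_moment_pos[OF _ _ _ _ _ v])
      show "integrable M (\<lambda>\<omega>. (LF.lin (\<theta>s, \<gamma>s) (D 0 \<omega>))\<^sup>2 *\<^sub>R outer (p (D 0 \<omega>)) (p (D 0 \<omega>)))"
      proof (rule integrable_matrixI)
        fix i j
        have bound: "\<bar>(LF.lin (\<theta>s, \<gamma>s) ob)\<^sup>2 * (p ob $ i * p ob $ j)\<bar> \<le> LF.Cb\<^sup>2 * (K * K)" for ob
          unfolding abs_mult
          using power_mono[OF LF.lin_le[OF F.ws_ball] abs_ge_zero, of ob 2] LF.K1
            order_trans[OF component_le_norm_cart LF.pK, of ob]
          by (intro mult_mono) auto
        have "(\<lambda>ob. (LF.lin (\<theta>s, \<gamma>s) ob)\<^sup>2 * (p ob $ i * p ob $ j)) \<in> borel_measurable N"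
          unfolding cart_eq_inner_axis by measurable
        from F.integrable_bounded[OF this bound, of 0]
        show "integrable M (\<lambda>\<omega>. ((LF.lin (\<theta>s, \<gamma>s) (D 0 \<omega>))\<^sup>2 *\<^sub>R outer (p (D 0 \<omega>)) (p (D 0 \<omega>))) $ i $ j)"
          by (simp add: outer_def)
      qed
      show "integrable M (\<lambda>\<omega>. (logistic_deriv (LF.ix (\<theta>s, \<gamma>s) (D 0 \<omega>)) * (LF.lin (\<theta>s, \<gamma>s) (D 0 \<omega>))\<^sup>2)
        *\<^sub>R outer (p (D 0 \<omega>)) (p (D 0 \<omega>)))"
        using F.block_integrable(2) by (simp add: F.mgg_def)
      show "0 < lambda_min (integral\<^sup>L M (\<lambda>\<omega>. (LF.lin (\<theta>s, \<gamma>s) (D 0 \<omega>))\<^sup>2 *\<^sub>R outer (p (D 0 \<omega>)) (p (D 0 \<omega>))))"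
        using A3c A3d unfolding Eobs_def LF.lin_def by (simp add: p_def)
    qed (auto simp: logistic_deriv_pos)
    then show ?thesis by (simp add: F.Igg_def Eobs_def F.mgg_def)
  qed
  have "pos_def (F.Itt - transpose F.Igt ** matrix_inv F.Igg ** F.Igt)"
    using A5 by (simp add: blocks F.Itt_def F.Igt_def F.Igg_def)
  from F.Hh_pos_of_schur[OF Igg_pos this] have Hpos: "\<And>d. d \<noteq> 0 \<Longrightarrow> 0 < F.Hh d d" .
  interpret R: logit_sample_regular p0 p "zv phi" y K "(\<theta>s, \<gamma>s)" M N D cov
    by unfold_locales (rule Hpos)
  have loss_eq: "loss psi0 psi phi n dat \<theta> \<gamma> = emp n dat (LF.ell (\<theta>, \<gamma>))" for n dat \<theta> \<gamma>
    unfolding loss_def emp_def LF.ell_def ix_eq sum_negf by (simp add: y_def)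
  have agd_eq: "agd (loss psi0 psi phi n (\<lambda>i. D i \<omega>)) \<eta>1 \<eta>2 \<theta>0 \<gamma>0 (T n) = F.iterate \<eta>1 \<eta>2 (\<theta>0, \<gamma>0) T n \<omega>"
    for n \<omega> \<eta>1 \<eta>2 \<theta>0 \<gamma>0 T
    unfolding F.iterate_def
    by (rule agd_eq_agd_step) (simp_all add: loss_eq LF.grad_emp_ell_fst LF.grad_emp_ell_snd)
  have S_eq: "S_gamma_sq psi0 psi phi n (\<lambda>i. D i \<omega>) (fst w) (snd w) = R.Shat n \<omega> w" for n \<omega> w
    by (simp add: S_gamma_sq_def Let_def blocks R.Shat_def schur_inv_def)
  obtain b0 \<eta>0 where b0: "0 < b0" and \<eta>0: "0 < \<eta>0"
    and main: "\<And>b w0 \<eta>1 \<eta>2. b < b0 \<and> norm (w0 - (\<theta>s, \<gamma>s)) \<le> b \<and> 0 < \<eta>1 \<and> \<eta>1 < \<eta>0 \<and> 0 < \<eta>2 \<and> \<eta>2 < \<eta>0 \<Longrightarrow>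
    \<exists>\<rho>. 0 < \<rho> \<and> \<rho> < 1 \<and> (\<forall>T. (\<lambda>n. real n * \<rho> ^ T n) \<longlonglongrightarrow> 0 \<longrightarrow> F.asym_linear (F.iterate \<eta>1 \<eta>2 w0 T))"
    using F.agd_asymptotics[OF Hpos] by blast
  show ?thesis
  proof (rule exI[of _ b0], rule conjI[OF b0], rule exI[of _ \<eta>0], rule conjI[OF \<eta>0], intro allI impI)
    fix b \<theta>0 \<gamma>0 \<eta>1 \<eta>2
    assume H: "b < b0 \<and> norm (\<theta>0 - \<theta>s) \<le> b / sqrt 2 \<and> norm (\<gamma>0 - \<gamma>s) \<le> b / sqrt 2
      \<and> 0 < \<eta>1 \<and> \<eta>1 < \<eta>0 \<and> 0 < \<eta>2 \<and> \<eta>2 < \<eta>0"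
    \<comment> \<open>The sign of \<open>b\<close> is implied by its bounding a norm.\<close>
    have "0 \<le> b / sqrt 2" using H norm_ge_zero order_trans by blast
    then have "0 \<le> b" by (simp add: zero_le_divide_iff)
    \<comment> \<open>The two block radii \<open>b / sqrt 2\<close> combine to radius
      \<open>b\<close> in the Euclidean norm of the pair.\<close>
    have "(norm ((\<theta>0, \<gamma>0) - (\<theta>s, \<gamma>s)))\<^sup>2 \<le> (b / sqrt 2)\<^sup>2 + (b / sqrt 2)\<^sup>2"
      using H power_mono[of "norm (\<theta>0 - \<theta>s)" "b / sqrt 2" 2] power_mono[of "norm (\<gamma>0 - \<gamma>s)" "b / sqrt 2" 2]
      by (simp add: norm_Pair_sq)
    also have "\<dots> = b\<^sup>2" by (simp add: power_divide)
    finally have "norm ((\<theta>0, \<gamma>0) - (\<theta>s, \<gamma>s)) \<le> b" using \<open>0 \<le> b\<close> by (rule power2_le_imp_le)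
    with main[of b "(\<theta>0, \<gamma>0)" \<eta>1 \<eta>2] H obtain \<rho> where \<rho>: "0 < \<rho>" "\<rho> < 1"
      and asym: "\<And>T. (\<lambda>n. real n * \<rho> ^ T n) \<longlonglongrightarrow> 0 \<Longrightarrow> F.asym_linear (F.iterate \<eta>1 \<eta>2 (\<theta>0, \<gamma>0) T)"
      by blast
    have goal: "conv_in_prob M (\<lambda>n \<omega>. spec_norm (R.Shat n \<omega> (F.iterate \<eta>1 \<eta>2 (\<theta>0, \<gamma>0) T n \<omega>) - schur_inv F.Itt F.Igg F.Igt)) 0
      \<and> (\<forall>i. weak_conv_m (\<lambda>n. distr M borel (\<lambda>\<omega>. sqrt (real n) * (axis i 1 \<bullet> (snd (F.iterate \<eta>1 \<eta>2 (\<theta>0, \<gamma>0) T n \<omega>) - \<gamma>s))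
          / sqrt (axis i 1 \<bullet> (R.Shat n \<omega> (F.iterate \<eta>1 \<eta>2 (\<theta>0, \<gamma>0) T n \<omega>) *v axis i 1)))) std_normal_distribution)"
      if T: "(\<lambda>n. real n * \<rho> ^ T n) \<longlonglongrightarrow> 0" for T
    proof (intro conjI allI)
      let ?W = "F.iterate \<eta>1 \<eta>2 (\<theta>0, \<gamma>0) T"
      have meas: "?W n \<in> borel_measurable M" for n
        unfolding F.iterate_def by (rule F.iterates_measurable)
      show "conv_in_prob M (\<lambda>n \<omega>. spec_norm (R.Shat n \<omega> (?W n \<omega>) - schur_inv F.Itt F.Igg F.Igt)) 0"
        by (rule R.Shat_conv_in_prob[OF asym[OF T]])
      fix i
      from R.studentized_normal[OF asym[OF T] meas, of i]
      show "weak_conv_m (\<lambda>n. distr M borel (\<lambda>\<omega>. sqrt (real n) * (axis i 1 \<bullet> (snd (?W n \<omega>) - \<gamma>s))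
          / sqrt (axis i 1 \<bullet> (R.Shat n \<omega> (?W n \<omega>) *v axis i 1)))) std_normal_distribution"
        by simp
    qed
    have lim_eq: "matrix_inv (Eobs M (D 0) (hgg psi0 psi phi \<theta>s \<gamma>s) - transpose (transpose (Eobs M (D 0) (hess_gt psi0 psi phi \<theta>s \<gamma>s)))
        ** matrix_inv (Eobs M (D 0) (htt psi0 psi phi \<theta>s \<gamma>s)) ** transpose (Eobs M (D 0) (hess_gt psi0 psi phi \<theta>s \<gamma>s)))
        = schur_inv F.Itt F.Igg F.Igt"
      by (simp add: schur_inv_def blocks F.Itt_def F.Igg_def F.Igt_def)
    show "\<exists>\<rho>1. 0 < \<rho>1 \<and> \<rho>1 < 1 \<and>
       (\<forall>T :: nat \<Rightarrow> nat. (\<lambda>n. real n * \<rho>1 ^ T n) \<longlonglongrightarrow> 0 \<longrightarrow>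
         (let est = (\<lambda>n \<omega>. agd (loss psi0 psi phi n (\<lambda>i. D i \<omega>)) \<eta>1 \<eta>2 \<theta>0 \<gamma>0 (T n));
              Shat = (\<lambda>n \<omega>. S_gamma_sq psi0 psi phi n (\<lambda>i. D i \<omega>) (fst (est n \<omega>)) (snd (est n \<omega>)));
              Itt = Eobs M (D 0) (htt psi0 psi phi \<theta>s \<gamma>s);
              Igg = Eobs M (D 0) (hgg psi0 psi phi \<theta>s \<gamma>s);
              Itg = transpose (Eobs M (D 0) (hess_gt psi0 psi phi \<theta>s \<gamma>s))
          in conv_in_prob M (\<lambda>n \<omega>. spec_norm (Shat n \<omega> - matrix_inv (Igg - transpose Itg ** matrix_inv Itt ** Itg))) 0
           \<and> (\<forall>i :: 'd2. weak_conv_m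
                 (\<lambda>n. distr M borel (\<lambda>\<omega>. sqrt (real n) * (axis i 1 \<bullet> (snd (est n \<omega>) - \<gamma>s))
                        / sqrt (axis i 1 \<bullet> (Shat n \<omega> *v axis i 1))))
                 std_normal_distribution)))"
      by (rule exI[of _ \<rho>], intro conjI \<rho> allI impI, unfold Let_def agd_eq S_eq lim_eq, rule goal)
  qed
qed

end
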